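(* Let $k$ be a field, $S = k[x_1,\ldots,x_n]$ with $n\ge 1$, and $I \subset S$ a proper homogeneous ideal, $d = \dim S/I$. Let $t$ be an integer with $0 \le t \le \min\{d,n-1\}$. Assume that $c_i(I) < \infty$ for $i = 0,\ldots,t$. Then $$\operatorname{reg}_t(S/I) = \max\{c_i(I) \mid i = 0,\ldots,t\}.$$
   Context: $S$ is standard graded and $\mathfrak m = (x_1,\ldots,x_n)$. $H^i_{\mathfrak m}(S/I)$ is the $i$th (graded) local cohomology module, $a_i(S/I) := \max\{r \mid H^i_{\mathfrak m}(S/I)_r \ne 0\}$, with $a_i(S/I) = -\infty$ if $H^i_{\mathfrak m}(S/I)=0$, and $\operatorname{reg}_t(S/I) := \max\{a_i(S/I)+i \mid i=0,\ldots,t\}$ (partial regularity). $\operatorname{in}(I)$ denotes the initial ideal of $I$ with respect to the (degree) reverse lexicographic order with $x_1>\cdots>x_n$. For $0\le i\le \min\{d,n-1\}$ put $S_i = k[x_1,\ldots,x_{n-i}]$. Let $J_i\subset S_i$ be the ideal obtained from $\operatorname{in}(I)$ by the evaluation $x_{n-i+1}=\cdots=x_n=0$; i.e. $J_i$ is generated by the monomial generators of $\operatorname{in}(I)$ not divisible by any of $x_{n-i+1},\ldots,x_n$. Let $\tilde J_i\subset S_i$ be the ideal of $S_i$ generated by the monomials obtained from those of $J_i$ by setting $x_{n-i}=1$ (so $J_i\subseteq\tilde J_i$). Define $c_i(I) := \sup\{r \mid (\tilde J_i/J_i)_r \neq 0\}$, with $c_i(I)=-\infty$ if $\tilde J_i=J_i$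 (the value $\infty$ is allowed). *)

theory Defs
  imports
    "HOL-Library.Poly_Mapping"
    "HOL-Library.Extended_Nat"
    "HOL-Library.Extended_Real"
    "HOL-Algebra.QuotRing"
    "HOL-Algebra.Module"
    "HOL-Algebra.Product_Groups"
begin

section \<open>Polynomial rings\<close>

text \<open>
  A monomial is a finitely supported exponent vector; the variable \<open>x\<^sub>j\<close> has index \<open>j\<close>, starting
  with \<open>j = 1\<close>. All polynomial rings \<open>k[x\<^sub>1,\<dots>,x\<^sub>m]\<close> over the field \<open>k\<close>
  are subsets of one type, so that \<open>k[x\<^sub>1,\<dots>,x\<^sub>m] \<subseteq> k[x\<^sub>1,\<dots>,x\<^sub>n]\<close> for \<open>m \<le> n\<close>.
\<close>

type_synonym mon = "nat \<Rightarrow>\<^sub>0 nat"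
type_synonym 'k mpoly = "mon \<Rightarrow>\<^sub>0 'k"

definition mons :: "nat \<Rightarrow> mon set"
  where "mons n = {m. Poly_Mapping.keys m \<subseteq> {1..n}}"

definition mon_deg :: "mon \<Rightarrow> nat"
  where "mon_deg m = (\<Sum>j\<in>Poly_Mapping.keys m. Poly_Mapping.lookup m j)"

definition poly_ring :: "nat \<Rightarrow> 'k::field mpoly ring"
  where "poly_ring n =
    \<lparr>carrier = {f. Poly_Mapping.keys f \<subseteq> mons n}, mult = (*), one = 1, zero = 0, add = (+)\<rparr>"

definition monomial :: "mon \<Rightarrow> 'k::field mpoly"
  where "monomial m = Poly_Mapping.single m 1"

definition var :: "nat \<Rightarrow> 'k::field mpoly"
  where "var j = monomial (Poly_Mapping.single j 1)"

definition poly_subst :: "(nat \<Rightarrow> 'k::field mpoly) \<Rightarrow> 'k mpoly \<Rightarrow> 'k mpoly"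
  where "poly_subst \<sigma> f =
    (\<Sum>m\<in>Poly_Mapping.keys f. Poly_Mapping.single 0 (Poly_Mapping.lookup f m) *
       (\<Prod>j\<in>Poly_Mapping.keys m. \<sigma> j ^ Poly_Mapping.lookup m j))"

definition hom_part :: "nat \<Rightarrow> int \<Rightarrow> 'k::field mpoly set"
  where "hom_part n r =
    {f \<in> carrier (poly_ring n). \<forall>m\<in>Poly_Mapping.keys f. int (mon_deg m) = r}"

definition hom_component :: "nat \<Rightarrow> 'k::field mpoly \<Rightarrow> 'k mpoly"
  where "hom_component r f =
    (\<Sum>m | m \<in> Poly_Mapping.keys f \<and> mon_deg m = r. Poly_Mapping.single m (Poly_Mapping.lookup f m))"

definition homogeneous_ideal :: "nat \<Rightarrow> 'k::field mpoly set \<Rightarrow> bool"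
  where "homogeneous_ideal n I \<longleftrightarrow>
    ideal I (poly_ring n) \<and> (\<forall>f\<in>I. \<forall>r. hom_component r f \<in> I)"

lemma carrier_poly_ring: "f \<in> carrier (poly_ring n) \<longleftrightarrow> Poly_Mapping.keys f \<subseteq> mons n"
  by (simp add: poly_ring_def)

lemma mons_add: "a \<in> mons n \<Longrightarrow> b \<in> mons n \<Longrightarrow> a + b \<in> mons n"
  using Poly_Mapping.keys_add[of a b] unfolding mons_def by blast

lemma cring_poly_ring: "cring (poly_ring n :: 'k::field mpoly ring)"
proof (rule cringI)
  let ?R = "poly_ring n :: 'k mpoly ring"
  have add: "f + g \<in> carrier ?R" if "f \<in> carrier ?R" "g \<in> carrier ?R" for f g
    using that Poly_Mapping.keys_add[of f g] unfolding carrier_poly_ring by blast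
  have mult: "f * g \<in> carrier ?R" if "f \<in> carrier ?R" "g \<in> carrier ?R" for f g
    using that Poly_Mapping.keys_mult[of f g] mons_add[of _ n] unfolding carrier_poly_ring by blast
  have zero: "0 \<in> carrier ?R" by (simp add: carrier_poly_ring)
  have one: "1 \<in> carrier ?R" by (simp add: carrier_poly_ring mons_def)
  have inv: "- f \<in> carrier ?R" if "f \<in> carrier ?R" for f
    using that by (simp add: carrier_poly_ring)
  have ops: "mult ?R = (*)" "add ?R = (+)" "one ?R = 1" "zero ?R = 0"
    by (simp_all add: poly_ring_def)
  show "abelian_group ?R"
  proof (rule abelian_groupI, unfold ops)
    fix f assume "f \<in> carrier ?R"
    then show "\<exists>g\<in>carrier ?R. g + f = 0" by (intro bexI[of _ "- f"] inv) simp_all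
  qed (simp_all add: add zero ac_simps)
  show "comm_monoid ?R"
    by (rule comm_monoidI, unfold ops) (simp_all add: mult one ac_simps)
  show "(f \<oplus>\<^bsub>?R\<^esub> g) \<otimes>\<^bsub>?R\<^esub> h = f \<otimes>\<^bsub>?R\<^esub> h \<oplus>\<^bsub>?R\<^esub> g \<otimes>\<^bsub>?R\<^esub> h" for f g h
    unfolding ops by (rule distrib_right)
qed

section \<open>Krull dimension\<close>

text \<open>Only applied to nonzero rings: the supremum is \<open>0\<close> for the zero ring.\<close>

definition krull_dim :: "('a, 'b) ring_scheme \<Rightarrow> enat"
  where "krull_dim R = Sup {enat l | l :: nat. \<exists>P :: nat \<Rightarrow> 'a set.
    (\<forall>i\<le>l. primeideal (P i) R) \<and> (\<forall>i<l. P i \<subset> P (Suc i))}"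

section \<open>Initial ideals\<close>

text \<open>Degree reverse lexicographic order with \<open>x\<^sub>1 > x\<^sub>2 > \<dots>\<close>.\<close>

definition drl_less :: "mon \<Rightarrow> mon \<Rightarrow> bool"
  where "drl_less u v \<longleftrightarrow> mon_deg u < mon_deg v \<or>
    mon_deg u = mon_deg v \<and>
    (\<exists>j. Poly_Mapping.lookup u j > Poly_Mapping.lookup v j \<and>
         (\<forall>l>j. Poly_Mapping.lookup u l = Poly_Mapping.lookup v l))"

definition lead_mon :: "'k::field mpoly \<Rightarrow> mon"
  where "lead_mon f = (THE m. m \<in> Poly_Mapping.keys f \<and>
    (\<forall>u\<in>Poly_Mapping.keys f. u \<noteq> m \<longrightarrow> drl_less u m))"

definition initial_ideal :: "nat \<Rightarrow> 'k::field mpoly set \<Rightarrow> 'k mpoly set"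
  where "initial_ideal n I = Idl\<^bsub>poly_ring n\<^esub> {monomial (lead_mon f) | f. f \<in> I \<and> f \<noteq> 0}"

section \<open>The invariants \<open>c\<^sub>i\<close>\<close>

definition J_ideal :: "nat \<Rightarrow> 'k::field mpoly set \<Rightarrow> nat \<Rightarrow> 'k mpoly set"
  where "J_ideal n I i =
    poly_subst (\<lambda>j. if j > n - i then 0 else var j) ` initial_ideal n I"

definition J_tilde :: "nat \<Rightarrow> 'k::field mpoly set \<Rightarrow> nat \<Rightarrow> 'k mpoly set"
  where "J_tilde n I i = Idl\<^bsub>poly_ring (n - i)\<^esub>
    {poly_subst (\<lambda>j. if j = n - i then 1 else var j) (monomial m) | m. monomial m \<in> J_ideal n I i}"

text \<open>
  The degree \<open>r\<close> part of \<open>J_tilde / J_ideal\<close> is the image of the forms of degree \<open>r\<close> in \<open>J_tilde\<close>;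
  it is nonzero iff one of these forms is not in \<open>J_ideal\<close>.
\<close>

definition c_inv :: "nat \<Rightarrow> 'k::field mpoly set \<Rightarrow> nat \<Rightarrow> ereal"
  where "c_inv n I i = Sup {ereal (real_of_int r) | r.
    \<exists>f \<in> J_tilde n I i \<inter> hom_part (n - i) r. f \<notin> J_ideal n I i}"

section \<open>Localization of a module at the powers of an element\<close>

text \<open>\<open>fraction R M s m a\<close> is the fraction \<open>m / s\<^sup>a\<close>, as an equivalence class of pairs.\<close>

definition fraction :: "('a, 'c) ring_scheme \<Rightarrow> ('a, 'b, 'd) module_scheme \<Rightarrow> 'a \<Rightarrow> 'b \<Rightarrow> nat \<Rightarrow> ('b \<times> nat) set"
  where "fraction R M s m a = {(m', a'). m' \<in> carrier M \<and>
    (\<exists>l::nat. (s [^]\<^bsub>R\<^esub> (l + a')) \<odot>\<^bsub>M\<^esub> m = (s [^]\<^bsub>R\<^esub> (l + a)) \<odot>\<^bsub>M\<^esub> m')}"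

text \<open>The fields \<open>mult\<close> and \<open>one\<close> of a module record carry no meaning.\<close>

definition localization ::
    "('a, 'c) ring_scheme \<Rightarrow> ('a, 'b, 'd) module_scheme \<Rightarrow> 'a \<Rightarrow> ('a, ('b \<times> nat) set) module"
  where "localization R M s =
    \<lparr>carrier = {fraction R M s m a | m a. m \<in> carrier M},
     mult = undefined, one = undefined,
     zero = fraction R M s \<zero>\<^bsub>M\<^esub> 0,
     add = (\<lambda>X Y. \<Union>(m, a)\<in>X. \<Union>(m', a')\<in>Y.
        fraction R M s ((s [^]\<^bsub>R\<^esub> a') \<odot>\<^bsub>M\<^esub> m \<oplus>\<^bsub>M\<^esub> (s [^]\<^bsub>R\<^esub> a) \<odot>\<^bsub>M\<^esub> m') (a + a')),
     smult = (\<lambda>c X. \<Union>(m, a)\<in>X. fraction R M s (c \<odot>\<^bsub>M\<^esub> m) a)\<rparr>"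

section \<open>Local cohomology\<close>

text \<open>
  The local cohomology of the module \<open>M\<close> with support in the ideal generated by
  \<open>x\<^sub>1,\<dots>,x\<^sub>n\<close>, as the cohomology of the Cech complex: its \<open>p\<close>-th term is the direct sum of the
  localizations of \<open>M\<close> at \<open>x\<^sub>F = \<Prod>\<^bsub>j\<in>F\<^esub> x\<^sub>j\<close>, where \<open>F\<close> ranges over the \<open>p\<close>-element subsets
  of \<open>{1,\<dots>,n}\<close>.
\<close>

definition faces :: "nat \<Rightarrow> nat \<Rightarrow> nat set set"
  where "faces n p = {F. F \<subseteq> {1..n} \<and> card F = p}"

definition face_prod :: "('a, 'c) ring_scheme \<Rightarrow> (nat \<Rightarrow> 'a) \<Rightarrow> nat set \<Rightarrow> 'a"
  where "face_prod R x F = finprod R x F"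

definition cech_loc :: "('a, 'c) ring_scheme \<Rightarrow> ('a, 'b, 'd) module_scheme \<Rightarrow> (nat \<Rightarrow> 'a) \<Rightarrow> nat set
    \<Rightarrow> ('a, ('b \<times> nat) set) module"
  where "cech_loc R M x F = localization R M (face_prod R x F)"

definition cech_group :: "('a, 'c) ring_scheme \<Rightarrow> ('a, 'b, 'd) module_scheme \<Rightarrow> (nat \<Rightarrow> 'a) \<Rightarrow> nat \<Rightarrow> nat
    \<Rightarrow> (nat set \<Rightarrow> ('b \<times> nat) set) monoid"
  where "cech_group R M x n p = product_group (faces n p) (\<lambda>F. add_monoid (cech_loc R M x F))"

text \<open>
  The localization map from \<open>M\<close> localized at \<open>x\<^bsub>G - {j}\<^esub>\<close> to \<open>M\<close> localized at \<open>x\<^sub>G\<close>,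
  for \<open>j \<in> G\<close>; it sends \<open>m / x\<^bsub>G - {j}\<^esub>\<^sup>a\<close> to \<open>x\<^sub>j\<^sup>a m / x\<^sub>G\<^sup>a\<close>.
\<close>

definition cech_res :: "('a, 'c) ring_scheme \<Rightarrow> ('a, 'b, 'd) module_scheme \<Rightarrow> (nat \<Rightarrow> 'a)
    \<Rightarrow> nat set \<Rightarrow> nat \<Rightarrow> ('b \<times> nat) set \<Rightarrow> ('b \<times> nat) set"
  where "cech_res R M x G j X =
    (\<Union>(m, a)\<in>X. fraction R M (face_prod R x G) ((x j [^]\<^bsub>R\<^esub> a) \<odot>\<^bsub>M\<^esub> m) a)"

definition cech_diff :: "('a, 'c) ring_scheme \<Rightarrow> ('a, 'b, 'd) module_scheme \<Rightarrow> (nat \<Rightarrow> 'a) \<Rightarrow> nat \<Rightarrow> nat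
    \<Rightarrow> (nat set \<Rightarrow> ('b \<times> nat) set) \<Rightarrow> nat set \<Rightarrow> ('b \<times> nat) set"
  where "cech_diff R M x n p f = (\<lambda>G \<in> faces n (Suc p).
    finsum (cech_loc R M x G)
      (\<lambda>j. if even (card {l \<in> G. l < j})
           then cech_res R M x G j (f (G - {j}))
           else \<ominus>\<^bsub>cech_loc R M x G\<^esub> cech_res R M x G j (f (G - {j}))) G)"

definition cech_cocycles :: "('a, 'c) ring_scheme \<Rightarrow> ('a, 'b, 'd) module_scheme \<Rightarrow> (nat \<Rightarrow> 'a) \<Rightarrow> nat \<Rightarrow> nat
    \<Rightarrow> (nat set \<Rightarrow> ('b \<times> nat) set) set"
  where "cech_cocycles R M x n p =
    kernel (cech_group R M x n p) (cech_group R M x n (Suc p)) (cech_diff R M x n p)"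

definition cech_coboundaries :: "('a, 'c) ring_scheme \<Rightarrow> ('a, 'b, 'd) module_scheme \<Rightarrow> (nat \<Rightarrow> 'a) \<Rightarrow> nat \<Rightarrow> nat
    \<Rightarrow> (nat set \<Rightarrow> ('b \<times> nat) set) set"
  where "cech_coboundaries R M x n p =
    (case p of 0 \<Rightarrow> {\<one>\<^bsub>cech_group R M x n 0\<^esub>}
     | Suc q \<Rightarrow> cech_diff R M x n q ` carrier (cech_group R M x n q))"

definition local_cohomology :: "('a, 'c) ring_scheme \<Rightarrow> ('a, 'b, 'd) module_scheme \<Rightarrow> (nat \<Rightarrow> 'a) \<Rightarrow> nat \<Rightarrow> nat
    \<Rightarrow> (nat set \<Rightarrow> ('b \<times> nat) set) set monoid"
  where "local_cohomology R M x n p =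
    ((cech_group R M x n p)\<lparr>carrier := cech_cocycles R M x n p\<rparr>) Mod cech_coboundaries R M x n p"

text \<open>
  The grading, for \<open>x\<^sub>1,\<dots>,x\<^sub>n\<close> of degree \<open>1\<close> and a grading \<open>gr\<close> of \<open>M\<close>: the fraction
  \<open>m / x\<^sub>F\<^sup>a\<close> has degree \<open>deg m - a |F|\<close>.
\<close>

definition cech_loc_part :: "('a, 'c) ring_scheme \<Rightarrow> ('a, 'b, 'd) module_scheme \<Rightarrow> (int \<Rightarrow> 'b set)
    \<Rightarrow> (nat \<Rightarrow> 'a) \<Rightarrow> nat set \<Rightarrow> int \<Rightarrow> ('b \<times> nat) set set"
  where "cech_loc_part R M gr x F r =
    {fraction R M (face_prod R x F) m a | m a. m \<in> gr (r + int a * int (card F))}"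

definition local_cohomology_part :: "('a, 'c) ring_scheme \<Rightarrow> ('a, 'b, 'd) module_scheme
    \<Rightarrow> (int \<Rightarrow> 'b set) \<Rightarrow> (nat \<Rightarrow> 'a) \<Rightarrow> nat \<Rightarrow> nat \<Rightarrow> int \<Rightarrow> (nat set \<Rightarrow> ('b \<times> nat) set) set set"
  where "local_cohomology_part R M gr x n p r =
    {cech_coboundaries R M x n p #>\<^bsub>cech_group R M x n p\<^esub> f | f.
       f \<in> cech_cocycles R M x n p \<and> (\<forall>F\<in>faces n p. f F \<in> cech_loc_part R M gr x F r)}"

section \<open>Partial regularity of \<open>S/I\<close>\<close>

definition quot_module :: "('a, 'b) ring_scheme \<Rightarrow> 'a set \<Rightarrow> ('a, 'a set) module"
  where "quot_module R I =
    \<lparr>carrier = carrier (R Quot I), mult = mult (R Quot I), one = one (R Quot I),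
     zero = zero (R Quot I), add = add (R Quot I),
     smult = (\<lambda>c X. \<Union>y\<in>X. I +>\<^bsub>R\<^esub> (c \<otimes>\<^bsub>R\<^esub> y))\<rparr>"

definition quot_part :: "nat \<Rightarrow> 'k::field mpoly set \<Rightarrow> int \<Rightarrow> 'k mpoly set set"
  where "quot_part n I r = {I +>\<^bsub>poly_ring n\<^esub> f | f. f \<in> hom_part n r}"

text \<open>
  The maximum of the degrees \<open>r\<close> with \<open>H\<^sup>i(S/I)\<^sub>r \<noteq> 0\<close> is taken as a supremum: this is \<open>-\<infinity>\<close> if there
  is no such \<open>r\<close>, and \<open>\<infinity>\<close> if they are unbounded.
\<close>

definition a_inv :: "nat \<Rightarrow> 'k::field mpoly set \<Rightarrow> nat \<Rightarrow> ereal"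
  where "a_inv n I i =
    (let S = poly_ring n; M = quot_module S I in
     Sup {ereal (real_of_int r) | r.
       local_cohomology_part S M (quot_part n I) var n i r \<noteq> {\<one>\<^bsub>local_cohomology S M var n i\<^esub>}})"

definition partial_reg :: "nat \<Rightarrow> 'k::field mpoly set \<Rightarrow> nat \<Rightarrow> ereal"
  where "partial_reg n I t = Max ((\<lambda>i. a_inv n I i + ereal (real i)) ` {0..t})"

end

theory Submission
  imports Defs
begin

text \<open>
  Multiplication by a variable \<open>z\<close> for which the saturation \<open>(I : z\<^sup>\<infinity>) / I\<close> vanishes in large degrees gives a
  long exact sequence relating the local cohomology of \<open>S/I\<close> and of \<open>S/(I + (z))\<close>, whose kernel term
  \<open>(I : z)/I\<close> contributes to degree \<open>0\<close> only. Since every class in \<open>H\<^sup>i\<close> is killed by a power of \<open>z\<close>,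
  a nonzero class of \<open>H\<^bsup>i+1\<^esup>(S/I)\<close> in degree \<open>r\<close> forces one of \<open>H\<^sup>i(S/(I + (z)))\<close> in some degree
  \<open>> r\<close>, and conversely a class of \<open>H\<^sup>i(S/(I + (z)))\<close> in degree \<open>r\<close> comes from \<open>H\<^sup>i(S/I)\<close> in degree
  \<open>r\<close> or from \<open>H\<^bsup>i+1\<^esup>(S/I)\<close> in degree \<open>r - 1\<close>. Moreover \<open>H\<^sup>0(S/I) = (I : z\<^sup>\<infinity>)/I\<close>. Cutting
  successively by \<open>x\<^sub>n, x\<^bsub>n-1\<^esub>, \<dots>\<close> expresses the partial regularity by the top degrees of the
  saturations of the sections, and for the reverse lexicographic order these are read off from the
  initial ideal.

  The localizations disappear because the Cech cohomology is the direct limit over \<open>a\<close> of the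
  cohomology of the Koszul complexes of \<open>x\<^sub>1\<^sup>a, \<dots>, x\<^sub>n\<^sup>a\<close> on \<open>S/I\<close>, and Koszul cochains are just
  families of polynomials modulo \<open>I\<close>.
\<close>

section \<open>Polynomials and the reverse lexicographic order\<close>

text \<open>The finiteness of the \<open>c_i\<close> is what makes the cutting possible. The
  variables \<open>x_n\<close>, \<open>x_(n-1)\<close>, ... need not be regular on the successive
  sections, but each fails to be injective in bounded degrees only. On a nonempty face
  \<open>F\<close> the transition map \<open>x_F^s\<close> raises degrees beyond this bound, so the
  failure dies in the limit; on the empty face it survives. All sections are kept as quotients of
  the one ring S, with Koszul complexes on all n variables, although the \<open>c_i\<close> are
  defined over the smaller rings S_i. The same cochains can then be read modulo two ideals. No exact
  sequence of groups is built. The recursion uses two statements on degrees of nonzero classes,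
  proved by chasing representatives. In both directions the sum of the degree and the cohomological
  index does not drop, which is why \<open>a_i + i\<close> appears. As a class may move to another
  index, only the maximum over 0,...,t is recovered. The cohomology of S/I is never compared with
  that of S/in(I): only the saturations of the sections are read off from monomials.\<close>

lift_definition filter_keys :: "('a \<Rightarrow> bool) \<Rightarrow> ('a \<Rightarrow>\<^sub>0 'b::zero) \<Rightarrow> ('a \<Rightarrow>\<^sub>0 'b)"
  is "\<lambda>P f m. if P m then f m else 0"
  by (erule finite_subset[rotated]) auto

lemma lookup_filter_keys [simp]:
  "Poly_Mapping.lookup (filter_keys P f) m = (if P m then Poly_Mapping.lookup f m else 0)"
  by transfer simp

lemma keys_filter_keys [simp]: "Poly_Mapping.keys (filter_keys P f) = {m \<in> Poly_Mapping.keys f. P m}"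
  by (auto simp: in_keys_iff split: if_splits)

lemma filter_keys_add: "filter_keys P (f + g) = filter_keys P f + filter_keys P g"
  by (rule poly_mapping_eqI) (simp add: lookup_add)

lemma filter_keys_diff:
  "filter_keys P (f - g) = filter_keys P f - filter_keys P (g :: _ \<Rightarrow>\<^sub>0 'b::cancel_comm_monoid_add)"
  by (rule poly_mapping_eqI) (simp add: lookup_minus)

lemma filter_keys_uminus: "filter_keys P (- f) = - filter_keys P (f :: _ \<Rightarrow>\<^sub>0 'b::ab_group_add)"
  by (rule poly_mapping_eqI) simp

lemma filter_keys_0 [simp]: "filter_keys P 0 = 0"
  by (rule poly_mapping_eqI) simp

lemma filter_keys_id: "(\<And>m. m \<in> Poly_Mapping.keys f \<Longrightarrow> P m) \<Longrightarrow> filter_keys P f = f"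
  by (rule poly_mapping_eqI) (auto simp: in_keys_iff)

lemma filter_keys_filter_keys: "filter_keys P (filter_keys Q f) = filter_keys (\<lambda>m. P m \<and> Q m) f"
  by (rule poly_mapping_eqI) simp

lemma filter_keys_sum: "filter_keys P (sum f A) = (\<Sum>a\<in>A. filter_keys P (f a))"
  by (induction A rule: infinite_finite_induct) (simp_all add: filter_keys_add)

section \<open>Products with monomials\<close>

lemma lookup_single_mult_add:
  fixes f :: "'k::field mpoly"
  shows "Poly_Mapping.lookup (Poly_Mapping.single u c * f) (u + v) = c * Poly_Mapping.lookup f v"
  by (simp add: lookup_mult lookup_single when_mult)

lemma keys_single_mult:
  fixes f :: "'k::field mpoly"
  assumes "c \<noteq> 0"
  shows "Poly_Mapping.keys (Poly_Mapping.single u c * f) = (+) u ` Poly_Mapping.keys f"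
proof
  show "Poly_Mapping.keys (Poly_Mapping.single u c * f) \<subseteq> (+) u ` Poly_Mapping.keys f"
    using Poly_Mapping.keys_mult[of "Poly_Mapping.single u c" f] assms by auto
  show "(+) u ` Poly_Mapping.keys f \<subseteq> Poly_Mapping.keys (Poly_Mapping.single u c * f)"
    using assms by (auto simp: in_keys_iff lookup_single_mult_add)
qed

lemma keys_monomial_mult:
  fixes f :: "'k::field mpoly"
  shows "Poly_Mapping.keys (monomial u * f) = (+) u ` Poly_Mapping.keys f"
  by (simp add: monomial_def keys_single_mult)

lemma filter_keys_monomial_mult:
  fixes f :: "'k::field mpoly"
  shows "filter_keys P (monomial u * f) = monomial u * filter_keys (\<lambda>v. P (u + v)) f"
proof (rule poly_mapping_eqI)
  fix m
  show "Poly_Mapping.lookup (filter_keys P (monomial u * f)) m =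
    Poly_Mapping.lookup (monomial u * filter_keys (\<lambda>v. P (u + v)) f) m"
  proof (cases "\<exists>v. m = u + v")
    case True
    then show ?thesis by (auto simp: monomial_def lookup_single_mult_add)
  next
    case False
    then have "m \<notin> Poly_Mapping.keys (monomial u * g)" for g :: "'k mpoly"
      by (auto simp: keys_monomial_mult)
    then show ?thesis by (simp add: in_keys_iff)
  qed
qed

lemma monomial_mult: "monomial u * monomial v = (monomial (u + v) :: 'k::field mpoly)"
  by (simp add: monomial_def mult_single)

lemma monomial_0: "monomial 0 = (1 :: 'k::field mpoly)"
  by (simp add: monomial_def)

lemma keys_monomial [simp]: "Poly_Mapping.keys (monomial u :: 'k::field mpoly) = {u}"
  by (simp add: monomial_def)

lemma monomial_prod: "(\<Prod>a\<in>A. monomial (u a)) = (monomial (\<Sum>a\<in>A. u a) :: 'k::field mpoly)"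
  by (induction A rule: infinite_finite_induct) (simp_all add: monomial_0 monomial_mult)

lemma var_power: "var j ^ k = (monomial (Poly_Mapping.single j k) :: 'k::field mpoly)"
proof (induction k)
  case (Suc k)
  then show ?case by (simp add: var_def monomial_mult single_add[symmetric])
qed (simp add: monomial_0)

lemma sum_single_lookup: "(\<Sum>a\<in>Poly_Mapping.keys f. Poly_Mapping.single a (Poly_Mapping.lookup f a)) = f"
  by (rule poly_mapping_eqI) (simp add: lookup_sum lookup_single when_def in_keys_iff)

lemma sum_single_lookup_filter:
  "(\<Sum>a | a \<in> Poly_Mapping.keys f \<and> P a. Poly_Mapping.single a (Poly_Mapping.lookup f a)) = filter_keys P f"
  by (rule poly_mapping_eqI) (auto simp: lookup_sum lookup_single when_def in_keys_iff)

lemma hom_component_eq: "hom_component r f = filter_keys (\<lambda>m. mon_deg m = r) f"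
  unfolding hom_component_def by (rule sum_single_lookup_filter)

section \<open>Exponent vectors and their degrees\<close>

lemma mons_0 [simp]: "0 \<in> mons n"
  by (simp add: mons_def)

lemma mons_mono: "m \<le> n \<Longrightarrow> mons m \<subseteq> mons n"
  by (fastforce simp: mons_def)

lemma mons_single: "j \<in> {1..n} \<Longrightarrow> Poly_Mapping.single j k \<in> mons n"
  by (simp add: mons_def)

lemma keys_add_nat: "Poly_Mapping.keys (u + v) = Poly_Mapping.keys u \<union> Poly_Mapping.keys (v :: mon)"
  by (auto simp: in_keys_iff lookup_add)

lemma mons_add_iff: "u + v \<in> mons n \<longleftrightarrow> u \<in> mons n \<and> v \<in> mons n"
  by (auto simp: mons_def keys_add_nat)

lemma mon_deg_superset:
  "finite A \<Longrightarrow> Poly_Mapping.keys m \<subseteq> A \<Longrightarrow> mon_deg m = (\<Sum>j\<in>A. Poly_Mapping.lookup m j)"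
  unfolding mon_deg_def by (rule sum.mono_neutral_left) (auto simp: in_keys_iff)

lemma mon_deg_add: "mon_deg (u + v) = mon_deg u + mon_deg v"
  using mon_deg_superset[of "Poly_Mapping.keys u \<union> Poly_Mapping.keys v"]
  by (simp add: keys_add_nat lookup_add sum.distrib)

lemma mon_deg_single [simp]: "mon_deg (Poly_Mapping.single j k) = k"
  by (simp add: mon_deg_def)

lemma lookup_le_mon_deg: "Poly_Mapping.lookup m j \<le> mon_deg m"
proof (cases "j \<in> Poly_Mapping.keys m")
  case True
  then show ?thesis unfolding mon_deg_def by (intro member_le_sum) auto
qed (simp add: in_keys_iff)

text \<open>Each exponent is bounded by the degree. This stands in for well-foundedness of the
  order: a smallest leading monomial is later sought among forms of one degree.\<close>

lemma finite_mons_deg: "finite {m \<in> mons n. mon_deg m = r}"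
proof -
  have "Poly_Mapping.lookup ` {m \<in> mons n. mon_deg m = r} \<subseteq>
    {f. \<forall>j. (j \<in> {1..n} \<longrightarrow> f j \<in> {..r}) \<and> (j \<notin> {1..n} \<longrightarrow> f j = 0)}"
    using lookup_le_mon_deg by (auto simp: mons_def in_keys_iff subset_iff)
  then have "finite (Poly_Mapping.lookup ` {m \<in> mons n. mon_deg m = r})"
    by (rule finite_subset) (intro finite_set_of_finite_funs finite_atLeastAtMost finite_atMost)
  then show ?thesis
    by (rule finite_imageD) (rule inj_onI, rule poly_mapping_eqI, simp)
qed

section \<open>The reverse lexicographic order and leading monomials\<close>

lemma drl_irrefl: "\<not> drl_less u u"
  by (simp add: drl_less_def)

lemma drl_trans:
  assumes "drl_less u v" "drl_less v w"
  shows "drl_less u w"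
proof (cases "mon_deg u = mon_deg v \<and> mon_deg v = mon_deg w")
  case True
  with assms obtain i j where
    i: "Poly_Mapping.lookup u i > Poly_Mapping.lookup v i" "\<forall>l>i. Poly_Mapping.lookup u l = Poly_Mapping.lookup v l"
    and j: "Poly_Mapping.lookup v j > Poly_Mapping.lookup w j" "\<forall>l>j. Poly_Mapping.lookup v l = Poly_Mapping.lookup w l"
    by (auto simp: drl_less_def)
  have "Poly_Mapping.lookup u (max i j) > Poly_Mapping.lookup w (max i j)"
    by (cases i j rule: linorder_cases) (use i j in auto)
  moreover have "\<forall>l>max i j. Poly_Mapping.lookup u l = Poly_Mapping.lookup w l"
    using i j by simp
  ultimately show ?thesis using True by (auto simp: drl_less_def)
next
  case False
  with assms show ?thesis by (auto simp: drl_less_def)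
qed

lemma drl_total: "u \<noteq> v \<Longrightarrow> drl_less u v \<or> drl_less v u"
proof (cases "mon_deg u" "mon_deg v" rule: linorder_cases)
  case equal
  assume "u \<noteq> v"
  \<comment> \<open>The last variable whose exponents differ decides the comparison; it exists
    because both supports are finite.\<close>
  let ?D = "{j. Poly_Mapping.lookup u j \<noteq> Poly_Mapping.lookup v j}"
  have "?D \<noteq> {}" using \<open>u \<noteq> v\<close> by (auto intro: poly_mapping_eqI)
  moreover have fin: "finite ?D"
    by (rule finite_subset[of _ "Poly_Mapping.keys u \<union> Poly_Mapping.keys v"]) (auto simp: in_keys_iff)
  ultimately have "Max ?D \<in> ?D" by (rule Max_in[rotated])
  moreover have "Poly_Mapping.lookup u l = Poly_Mapping.lookup v l" if "l > Max ?D" for l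
    using that Max_ge[OF fin, of l] by auto
  ultimately show ?thesis
    using equal unfolding drl_less_def by (metis (mono_tags, lifting) linorder_neqE_nat mem_Collect_eq)
qed (auto simp: drl_less_def)

lemma drl_add_left: "drl_less (m + u) (m + v) \<longleftrightarrow> drl_less u v"
  by (simp add: drl_less_def mon_deg_add lookup_add)

text \<open>The order inspects the last variables first, and a larger exponent there makes a
  monomial smaller. Since \<open>v\<close> has no variable beyond \<open>x_w\<close>, the last one
  occurring in \<open>u\<close> decides.\<close>

lemma drl_less_mons:
  assumes "u \<notin> mons w" "v \<in> mons w" "u \<in> mons n" "mon_deg u = mon_deg v"
  shows "drl_less u v"
proof -
  define D where "D = {j \<in> Poly_Mapping.keys u. j > w}"
  have "D \<noteq> {}" using assms by (auto simp: D_def mons_def subset_iff not_le)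
  moreover have fin: "finite D" by (simp add: D_def)
  ultimately have M: "Max D \<in> D" by (rule Max_in[rotated])
  then have M': "Max D > w" "Poly_Mapping.lookup u (Max D) > 0" unfolding D_def by (simp_all add: in_keys_iff)
  have v: "Poly_Mapping.lookup v l = 0" if "l > w" for l
    using that assms(2) by (auto simp: mons_def subset_iff in_keys_iff)
  have "Poly_Mapping.lookup u l = Poly_Mapping.lookup v l" if l: "l > Max D" for l
  proof -
    have "l \<notin> D" using l Max_ge[OF fin, of l] by (meson not_le)
    then show ?thesis using l M' v[of l] by (simp add: D_def in_keys_iff)
  qed
  then show ?thesis
    using assms(4) M' v[OF M'(1)] unfolding drl_less_def by metis
qed

text \<open>Stated for an abstract relation so that it also applies to the reversed order, where it
  yields a smallest leading monomial.\<close>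

lemma finite_total_greatest:
  assumes "finite A" "A \<noteq> {}"
    and trans: "\<And>u v w. R u v \<Longrightarrow> R v w \<Longrightarrow> R u w"
    and total: "\<And>u v. u \<noteq> v \<Longrightarrow> R u v \<or> R v u"
  shows "\<exists>m\<in>A. \<forall>u\<in>A. u \<noteq> m \<longrightarrow> R u m"
  using assms(1,2)
proof (induction A rule: finite_ne_induct)
  case (insert a A)
  then obtain m where m: "m \<in> A" "\<forall>u\<in>A. u \<noteq> m \<longrightarrow> R u m" by auto
  show ?case
  proof (cases "R a m \<or> a = m")
    case True
    with m show ?thesis by auto
  next
    case False
    then have "R m a" using total by blast
    with m trans show ?thesis by (intro bexI[of _ a]) auto
  qed
qed simp

lemma lead_monI:
  assumes "m \<in> Poly_Mapping.keys f" "\<And>u. u \<in> Poly_Mapping.keys f \<Longrightarrow> u \<noteq> m \<Longrightarrow> drl_less u m"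
  shows "lead_mon f = m"
  unfolding lead_mon_def
proof (rule the_equality)
  show "m \<in> Poly_Mapping.keys f \<and> (\<forall>u\<in>Poly_Mapping.keys f. u \<noteq> m \<longrightarrow> drl_less u m)" using assms by auto
  fix m' assume "m' \<in> Poly_Mapping.keys f \<and> (\<forall>u\<in>Poly_Mapping.keys f. u \<noteq> m' \<longrightarrow> drl_less u m')"
  then show "m' = m" using assms drl_trans drl_irrefl by metis
qed

lemma
  assumes "f \<noteq> 0"
  shows lead_mon_in_keys: "lead_mon f \<in> Poly_Mapping.keys f"
    and lead_mon_greatest: "u \<in> Poly_Mapping.keys f \<Longrightarrow> u \<noteq> lead_mon f \<Longrightarrow> drl_less u (lead_mon f)"
proof -
  have "\<exists>m\<in>Poly_Mapping.keys f. \<forall>u\<in>Poly_Mapping.keys f. u \<noteq> m \<longrightarrow> drl_less u m"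
    by (rule finite_total_greatest[OF finite_keys _ drl_trans drl_total]) (use assms in auto)
  then obtain m where m: "m \<in> Poly_Mapping.keys f" "\<forall>u\<in>Poly_Mapping.keys f. u \<noteq> m \<longrightarrow> drl_less u m"
    by blast
  then have "lead_mon f = m" by (intro lead_monI) auto
  with m show "lead_mon f \<in> Poly_Mapping.keys f"
    "u \<in> Poly_Mapping.keys f \<Longrightarrow> u \<noteq> lead_mon f \<Longrightarrow> drl_less u (lead_mon f)" by auto
qed

lemma lead_mon_monomial_mult:
  assumes "(f :: 'k::field mpoly) \<noteq> 0"
  shows "lead_mon (monomial u * f) = u + lead_mon f"
proof (rule lead_monI)
  show "u + lead_mon f \<in> Poly_Mapping.keys (monomial u * f)"
    using lead_mon_in_keys[OF assms] by (simp add: keys_monomial_mult)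
  fix v assume "v \<in> Poly_Mapping.keys (monomial u * f)" "v \<noteq> u + lead_mon f"
  then show "drl_less v (u + lead_mon f)"
    using lead_mon_greatest[OF assms] by (auto simp: keys_monomial_mult drl_add_left)
qed

lemma monomial_neq_0 [simp]: "monomial u \<noteq> (0 :: 'k::field mpoly)"
  by (metis keys_monomial keys_zero insert_not_empty)

section \<open>Ideals of the polynomial ring\<close>

lemma poly_ring_ops [simp]:
  "mult (poly_ring n) = (*)" "add (poly_ring n) = (+)"
  "one (poly_ring n) = 1" "zero (poly_ring n) = 0"
  by (simp_all add: poly_ring_def)

lemma poly_ring_closed:
  fixes f g :: "'k::field mpoly"
  shows "f \<in> carrier (poly_ring n) \<Longrightarrow> g \<in> carrier (poly_ring n) \<Longrightarrow> f + g \<in> carrier (poly_ring n)"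
    and "f \<in> carrier (poly_ring n) \<Longrightarrow> g \<in> carrier (poly_ring n) \<Longrightarrow> f * g \<in> carrier (poly_ring n)"
    and "f \<in> carrier (poly_ring n) \<Longrightarrow> - f \<in> carrier (poly_ring n)"
    and "0 \<in> carrier (poly_ring n :: 'k mpoly ring)" "1 \<in> carrier (poly_ring n :: 'k mpoly ring)"
proof -
  interpret cring "poly_ring n :: 'k mpoly ring" by (rule cring_poly_ring)
  show "f \<in> carrier (poly_ring n) \<Longrightarrow> g \<in> carrier (poly_ring n) \<Longrightarrow> f + g \<in> carrier (poly_ring n)"
    "f \<in> carrier (poly_ring n) \<Longrightarrow> g \<in> carrier (poly_ring n) \<Longrightarrow> f * g \<in> carrier (poly_ring n)"
    "0 \<in> carrier (poly_ring n :: 'k mpoly ring)" "1 \<in> carrier (poly_ring n :: 'k mpoly ring)"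
    using a_closed[of f g] m_closed[of f g] zero_closed one_closed unfolding poly_ring_ops by - assumption+
  show "f \<in> carrier (poly_ring n) \<Longrightarrow> - f \<in> carrier (poly_ring n)"
    by (simp add: carrier_poly_ring)
qed

lemma poly_ring_a_inv:
  fixes f :: "'k::field mpoly"
  assumes "f \<in> carrier (poly_ring n)"
  shows "\<ominus>\<^bsub>poly_ring n\<^esub> f = - f"
proof -
  interpret cring "poly_ring n :: 'k mpoly ring" by (rule cring_poly_ring)
  have "- f \<oplus>\<^bsub>poly_ring n\<^esub> f = \<zero>\<^bsub>poly_ring n\<^esub>" by (simp only: poly_ring_ops left_minus)
  from minus_equality[OF this assms poly_ring_closed(3)[OF assms]] show ?thesis .
qed

lemma poly_ring_diff_closed:
  "f \<in> carrier (poly_ring n) \<Longrightarrow> g \<in> carrier (poly_ring n) \<Longrightarrow> f - g \<in> carrier (poly_ring n :: 'k::field mpoly ring)"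
  using poly_ring_closed(1)[of f n "- g"] poly_ring_closed(3)[of g n] by simp

lemma monomial_closed: "u \<in> mons n \<Longrightarrow> monomial u \<in> carrier (poly_ring n :: 'k::field mpoly ring)"
  by (simp add: carrier_poly_ring)

lemma filter_keys_closed: "f \<in> carrier (poly_ring n) \<Longrightarrow> filter_keys P f \<in> carrier (poly_ring n :: 'k::field mpoly ring)"
  by (auto simp: carrier_poly_ring)

lemma
  fixes I :: "'k::field mpoly set"
  assumes "ideal I (poly_ring n)"
  shows ideal_carrier: "f \<in> I \<Longrightarrow> f \<in> carrier (poly_ring n)"
    and ideal_zero: "0 \<in> I"
    and ideal_add: "f \<in> I \<Longrightarrow> g \<in> I \<Longrightarrow> f + g \<in> I"
    and ideal_uminus: "f \<in> I \<Longrightarrow> - f \<in> I"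
    and ideal_mult: "f \<in> I \<Longrightarrow> h \<in> carrier (poly_ring n) \<Longrightarrow> h * f \<in> I"
proof -
  interpret ideal I "poly_ring n" by fact
  show c: "f \<in> carrier (poly_ring n)" if "f \<in> I" for f using that by (rule Icarr)
  show "0 \<in> I" using additive_subgroup.zero_closed[OF is_additive_subgroup] by (simp only: poly_ring_ops)
  show a: "f + g \<in> I" if "f \<in> I" "g \<in> I" for f g 
    using additive_subgroup.a_closed[OF is_additive_subgroup that] by (simp only: poly_ring_ops)
  show u: "- f \<in> I" if "f \<in> I" for f 
    using additive_subgroup.a_inv_closed[OF is_additive_subgroup that] poly_ring_a_inv[OF c[OF that]] by (simp only:)
  show "h * f \<in> I" if "f \<in> I" "h \<in> carrier (poly_ring n)" for f h
    using I_l_closed[OF that] by (simp only: poly_ring_ops)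
qed

lemma poly_ring_idealI:
  fixes J :: "'k::field mpoly set"
  assumes "J \<subseteq> carrier (poly_ring n)" "0 \<in> J"
    and "\<And>f g. f \<in> J \<Longrightarrow> g \<in> J \<Longrightarrow> f + g \<in> J"
    and "\<And>f h. f \<in> J \<Longrightarrow> h \<in> carrier (poly_ring n) \<Longrightarrow> h * f \<in> J"
  shows "ideal J (poly_ring n)"
proof (rule idealI)
  interpret cring "poly_ring n :: 'k mpoly ring" by (rule cring_poly_ring)
  show "ring (poly_ring n :: 'k mpoly ring)" by (rule ring_axioms)
  have u: "- f \<in> J" if "f \<in> J" for f
    using assms(4)[OF that poly_ring_closed(3)[OF poly_ring_closed(5)]] by simp
  show "subgroup J (add_monoid (poly_ring n))"
  proof (rule subgroup.intro)
    show "J \<subseteq> carrier (add_monoid (poly_ring n))" using assms by simp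
    show "inv\<^bsub>add_monoid (poly_ring n)\<^esub> f \<in> J" if "f \<in> J" for f
    proof -
      have "f \<in> carrier (poly_ring n)" using that assms(1) by auto
      from poly_ring_a_inv[OF this] have "inv\<^bsub>add_monoid (poly_ring n)\<^esub> f = - f" unfolding Ring.a_inv_def .
      then show ?thesis using u[OF that] by simp
    qed
  qed (use assms in simp_all)
  show "h \<otimes>\<^bsub>poly_ring n\<^esub> f \<in> J" "f \<otimes>\<^bsub>poly_ring n\<^esub> h \<in> J"
    if "f \<in> J" "h \<in> carrier (poly_ring n)" for f h
    using assms(4)[OF that] by (simp_all only: poly_ring_ops mult.commute)
qed

text \<open>Monomial ideals described by their exponents. This is the upper bound to which
  minimality of a generated ideal is applied, both for the initial ideal and for
  \<open>J_tilde\<close>.\<close>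

lemma ideal_keys_subset:
  assumes "K \<subseteq> mons n" "\<And>u v. u \<in> K \<Longrightarrow> v \<in> mons n \<Longrightarrow> v + u \<in> K"
  shows "ideal {f :: 'k::field mpoly. Poly_Mapping.keys f \<subseteq> K} (poly_ring n)"
proof (rule poly_ring_idealI)
  show "{f :: 'k mpoly. Poly_Mapping.keys f \<subseteq> K} \<subseteq> carrier (poly_ring n)"
    using assms(1) by (auto simp: carrier_poly_ring)
  show "f + g \<in> {f :: 'k mpoly. Poly_Mapping.keys f \<subseteq> K}"
    if "f \<in> {f. Poly_Mapping.keys f \<subseteq> K}" "g \<in> {f. Poly_Mapping.keys f \<subseteq> K}" for f g
    using that Poly_Mapping.keys_add[of f g] by auto
  show "h * f \<in> {f :: 'k mpoly. Poly_Mapping.keys f \<subseteq> K}"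
    if "f \<in> {f. Poly_Mapping.keys f \<subseteq> K}" "h \<in> carrier (poly_ring n)" for f h
    using that Poly_Mapping.keys_mult[of h f] assms(2) by (fastforce simp: carrier_poly_ring)
qed simp

lemma ideal_memI:
  fixes J :: "'k::field mpoly set"
  assumes "ideal J (poly_ring n)" "\<And>u. u \<in> Poly_Mapping.keys f \<Longrightarrow> monomial u \<in> J"
  shows "f \<in> J"
proof -
  have "(\<Sum>u\<in>A. Poly_Mapping.single u (Poly_Mapping.lookup f u)) \<in> J"
    if "finite A" "A \<subseteq> Poly_Mapping.keys f" for A
    using that
  proof (induction A rule: finite_induct)
    case (insert u A)
    have "Poly_Mapping.single 0 (Poly_Mapping.lookup f u) * monomial u \<in> J"
      by (rule ideal_mult[OF assms(1)]) (use insert assms in \<open>auto simp: carrier_poly_ring\<close>)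
    then show ?case using insert ideal_add[OF assms(1)] by (simp add: monomial_def mult_single)
  qed (simp add: ideal_zero[OF assms(1)])
  from this[of "Poly_Mapping.keys f"] show ?thesis by (simp add: sum_single_lookup)
qed

section \<open>Koszul cohomology of a hyperplane section\<close>

definition koszul_sign :: "nat set \<Rightarrow> nat \<Rightarrow> 'a::comm_ring_1"
  where "koszul_sign G j = (if even (card {l \<in> G. l < j}) then 1 else - 1)"

text \<open>The differential of the Koszul complex of the powers \<open>x_j^a\<close>. It is what
  the Cech differential does to numerators when the component at each \<open>F\<close> has
  denominator \<open>x_F^a\<close>.\<close>

definition koszul_diff :: "(nat \<Rightarrow> 'a::comm_ring_1) \<Rightarrow> nat \<Rightarrow> (nat set \<Rightarrow> 'a) \<Rightarrow> nat set \<Rightarrow> 'a"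
  where "koszul_diff x a m G = (\<Sum>j\<in>G. koszul_sign G j * x j ^ a * m (G - {j}))"

text \<open>Contraction with the basis vector \<open>e_w\<close>, a homotopy between multiplication
  by \<open>x_w^a\<close> and zero.\<close>

definition koszul_homotopy :: "nat \<Rightarrow> (nat set \<Rightarrow> 'a::comm_ring_1) \<Rightarrow> nat set \<Rightarrow> 'a"
  where "koszul_homotopy w m F = (if w \<in> F then 0 else koszul_sign (insert w F) w * m (insert w F))"

lemma koszul_sign_square [simp]: "koszul_sign G j * koszul_sign G j = (1::'a::comm_ring_1)"
  by (simp add: koszul_sign_def)

lemma koszul_sign_insert_self: "koszul_sign (insert w A) w = koszul_sign A w"
  unfolding koszul_sign_def by (rule arg_cong[of _ _ "\<lambda>A. if even (card A) then 1 else - 1"]) auto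

lemma koszul_sign_insert:
  assumes "finite G" "w \<notin> G" "w \<noteq> j"
  shows "koszul_sign (insert w G) j = (if w < j then - koszul_sign G j else koszul_sign G j)"
proof -
  have "{l \<in> insert w G. l < j} = (if w < j then insert w {l \<in> G. l < j} else {l \<in> G. l < j})"
    by auto
  then show ?thesis
    using assms by (simp add: koszul_sign_def)
qed

text \<open>If \<open>j < w\<close>, then \<open>j\<close> counts towards the sign of
  \<open>w\<close>; otherwise \<open>w\<close> counts towards the sign of \<open>j\<close>. So
  exactly one of the two insertions flips a sign.\<close>

lemma koszul_sign_swap:
  assumes "finite G" "w \<notin> G" "j \<in> G"
  shows "koszul_sign G j * koszul_sign (insert w (G - {j})) w =
    - (koszul_sign (insert w G) w * koszul_sign (insert w G) j :: 'a::comm_ring_1)"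
proof -
  have "G = insert j (G - {j})" using assms by auto
  have "koszul_sign G w = (if j < w then - koszul_sign (G - {j}) w else (koszul_sign (G - {j}) w :: 'a))"
    using koszul_sign_insert[of "G - {j}" j w, where 'a = 'a] \<open>G = insert j (G - {j})\<close> assms by (metis DiffD2 finite_Diff singletonI)
  moreover have "koszul_sign (insert w G) j = (if w < j then - koszul_sign G j else (koszul_sign G j :: 'a))"
    using koszul_sign_insert[of G w j, where 'a = 'a] assms by metis
  moreover have "j \<noteq> w" using assms by auto
  ultimately show ?thesis using assms by (cases "j < w") (auto simp: koszul_sign_insert_self mult.commute)
qed

text \<open>If \<open>w\<close> lies in \<open>G\<close>, only the summand \<open>j = w\<close>
  survives, since the contraction vanishes on faces containing \<open>w\<close>. Otherwise this
  summand comes from the second term, and all the others cancel in pairs by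
  \<open>koszul_sign_swap\<close>.\<close>

lemma koszul_homotopy_formula:
  assumes "finite G"
  shows "koszul_diff x a (koszul_homotopy w m) G + koszul_homotopy w (koszul_diff x a m) G = x w ^ a * m G"
proof (cases "w \<in> G")
  case True
  have "koszul_diff x a (koszul_homotopy w m) G
      = (\<Sum>j\<in>G. if j = w then x w ^ a * m G else 0)"
    unfolding koszul_diff_def
  proof (rule sum.cong)
    fix j assume "j \<in> G"
    show "koszul_sign G j * x j ^ a * koszul_homotopy w m (G - {j}) = (if j = w then x w ^ a * m G else 0)"
    proof (cases "j = w")
      case True
      have "koszul_sign G w * x w ^ a * (koszul_sign G w * m G)
        = (koszul_sign G w * koszul_sign G w) * (x w ^ a * m G)" by (simp only: ac_simps)
      with True \<open>w \<in> G\<close> show ?thesis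
        by (simp add: koszul_homotopy_def insert_absorb)
    next
      case False
      with \<open>w \<in> G\<close> show ?thesis by (simp add: koszul_homotopy_def)
    qed
  qed simp
  also have "\<dots> = x w ^ a * m G" using True assms by simp
  finally show ?thesis using True by (simp add: koszul_homotopy_def)
next
  case False
  let ?s = "koszul_sign (insert w G) w"
  have 1: "koszul_homotopy w (koszul_diff x a m) G
     = ?s * (?s * x w ^ a * m G) + ?s * (\<Sum>j\<in>G. koszul_sign (insert w G) j * x j ^ a * m (insert w G - {j}))"
    using False assms by (simp add: koszul_homotopy_def koszul_diff_def distrib_left)
  have "koszul_diff x a (koszul_homotopy w m) G =
     (\<Sum>j\<in>G. - (?s * (koszul_sign (insert w G) j * x j ^ a * m (insert w G - {j}))))"
    unfolding koszul_diff_def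
  proof (rule sum.cong)
    fix j assume j: "j \<in> G"
    then have "j \<noteq> w" using False by auto
    have "koszul_sign G j * x j ^ a * koszul_homotopy w m (G - {j})
      = (koszul_sign G j * koszul_sign (insert w (G - {j})) w) * x j ^ a * m (insert w (G - {j}))"
      using False by (simp add: koszul_homotopy_def ac_simps)
    also have "\<dots> = - (?s * koszul_sign (insert w G) j) * x j ^ a * m (insert w G - {j})"
      using koszul_sign_swap[OF assms False j, where 'a = 'a] \<open>j \<noteq> w\<close> by (simp add: insert_Diff_if)
    finally show "koszul_sign G j * x j ^ a * koszul_homotopy w m (G - {j})
      = - (?s * (koszul_sign (insert w G) j * x j ^ a * m (insert w G - {j})))" 
      by (simp add: ac_simps)
  qed simp
  also have "\<dots> = - (?s * (\<Sum>j\<in>G. koszul_sign (insert w G) j * x j ^ a * m (insert w G - {j})))"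
    by (simp add: sum_negf sum_distrib_left)
  moreover have "?s * (?s * x w ^ a * m G) = x w ^ a * m G"
    by (simp add: mult.assoc[symmetric])
  ultimately show ?thesis by (simp add: 1)
qed

text \<open>The summands \<open>T j i\<close> of the double sum are antisymmetric. The sum is split
  into \<open>i < j\<close> and \<open>j < i\<close>, because showing that it equals its own
  negative would not suffice in characteristic 2.\<close>

lemma koszul_diff_diff:
  assumes "finite G"
  shows "koszul_diff x a (koszul_diff x a m) G = 0"
proof -
  define T where "T j i = koszul_sign G j * x j ^ a * (koszul_sign (G - {j}) i * x i ^ a * m (G - {j} - {i}))" for j i
  have anti: "T j i = - T i j" if "j \<in> G" "i \<in> G" "i \<noteq> j" for i j
  proof -
    have a: "insert j (G - {j}) = G" "insert j (G - {j} - {i}) = G - {i}" using that by auto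
    have "koszul_sign (G - {j}) i * koszul_sign (G - {i}) j = - (koszul_sign G j * koszul_sign G i :: 'a)"
      using koszul_sign_swap[of "G - {j}" j i, where 'a = 'a] that assms
      by (simp only: a insert_Diff_single insert_absorb finite_Diff) auto
    then have "koszul_sign G j * koszul_sign (G - {j}) i =
       - (koszul_sign G i * koszul_sign (G - {i}) j :: 'a)"
      by (auto simp: koszul_sign_def split: if_splits)
    then have s: "koszul_sign G j * koszul_sign (G - {j}) i * (x i ^ a * x j ^ a * m (G - {j} - {i})) =
       - (koszul_sign G i * koszul_sign (G - {i}) j) * (x i ^ a * x j ^ a * m (G - {j} - {i}))"
      by simp
    have d: "G - {i} - {j} = G - {j} - {i}" by auto
    show ?thesis unfolding T_def d using s by (simp add: ac_simps)
  qed
  have split: "(\<Sum>i\<in>G - {j}. T j i) = (\<Sum>i\<in>{i\<in>G. i < j}. T j i) + (\<Sum>i\<in>{i\<in>G. j < i}. T j i)" for j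
  proof -
    have "G - {j} = {i\<in>G. i < j} \<union> {i\<in>G. j < i}" by auto
    moreover have "(\<Sum>i\<in>{i\<in>G. i < j} \<union> {i\<in>G. j < i}. T j i)
        = (\<Sum>i\<in>{i\<in>G. i < j}. T j i) + (\<Sum>i\<in>{i\<in>G. j < i}. T j i)"
      by (rule sum.union_disjoint) (use assms in auto)
    ultimately show ?thesis by metis
  qed
  have "koszul_diff x a (koszul_diff x a m) G = (\<Sum>j\<in>G. \<Sum>i\<in>G - {j}. T j i)"
    by (simp add: koszul_diff_def T_def sum_distrib_left)
  also have "\<dots> = (\<Sum>j\<in>G. \<Sum>i\<in>{i\<in>G. i < j}. T j i) + (\<Sum>j\<in>G. \<Sum>i\<in>{i\<in>G. j < i}. T j i)"
    by (simp add: split sum.distrib)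
  also have "(\<Sum>j\<in>G. \<Sum>i\<in>{i\<in>G. j < i}. T j i) = (\<Sum>i\<in>G. \<Sum>j\<in>{j\<in>G. j < i}. T j i)"
    by (rule sum.swap_restrict[OF assms assms])
  also have "\<dots> = (\<Sum>i\<in>G. \<Sum>j\<in>{j\<in>G. j < i}. - T i j)"
    by (intro sum.cong refl anti) auto
  also have "(\<Sum>j\<in>G. \<Sum>i\<in>{i\<in>G. i < j}. T j i) + \<dots> = 0"
    by (simp add: sum_negf)
  finally show ?thesis .
qed

lemma koszul_diff_minus: "koszul_diff x a (\<lambda>F. f F - g F) G = koszul_diff x a f G - koszul_diff x a g G"
  by (simp add: koszul_diff_def right_diff_distrib sum_subtractf)

lemma koszul_diff_cmult: "koszul_diff x a (\<lambda>F. c * f F) G = c * koszul_diff x a f G"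
  by (simp add: koszul_diff_def sum_distrib_left ac_simps)

text \<open>The transition maps of the direct system form a map of complexes from exponent
  \<open>a\<close> to exponent \<open>a + l\<close>.\<close>

lemma koszul_diff_rescale:
  assumes "finite G"
  shows "koszul_diff x (a + l) (\<lambda>F. prod x F ^ l * m F) G = prod x G ^ l * koszul_diff x a m G"
  unfolding koszul_diff_def sum_distrib_left
proof (rule sum.cong)
  fix j assume "j \<in> G"
  then have "prod x G = x j * prod x (G - {j})" using assms by (simp add: prod.remove)
  then show "koszul_sign G j * x j ^ (a + l) * (prod x (G - {j}) ^ l * m (G - {j}))
    = prod x G ^ l * (koszul_sign G j * x j ^ a * m (G - {j}))"
    by (simp add: power_add power_mult_distrib ac_simps)
qed simp

lemma koszul_diff_empty [simp]: "koszul_diff x a m {} = 0"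
  by (simp add: koszul_diff_def)

lemma koszul_diff_singleton [simp]: "koszul_diff x a m {j} = x j ^ a * m {}"
  by (simp add: koszul_diff_def koszul_sign_def Collect_conv_if)

section \<open>Graded cochains and their direct limit\<close>

lemma faces_finite: "F \<in> faces n p \<Longrightarrow> finite F"
  by (auto simp: faces_def intro: finite_subset)

lemma faces_remove: "G \<in> faces n (Suc p) \<Longrightarrow> j \<in> G \<Longrightarrow> G - {j} \<in> faces n p"
  by (frule faces_finite) (auto simp: faces_def)

lemma faces_insert: "F \<in> faces n p \<Longrightarrow> w \<notin> F \<Longrightarrow> w \<in> {1..n} \<Longrightarrow> insert w F \<in> faces n (Suc p)"
  by (frule faces_finite) (auto simp: faces_def)

lemma faces_0: "faces n 0 = {{}}"
  by (auto simp: faces_def card_eq_0_iff dest: finite_subset[OF _ finite_atLeastAtMost])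

text \<open>The axioms of this locale and of \<open>graded_ideal\<close> collect what Koszul
  differentials, contractions and transition maps need. They are met by S with each section ideal,
  so that one argument covers all steps of the recursion.\<close>

locale graded_vars =
  fixes x :: "nat \<Rightarrow> 'a::comm_ring_1" and n :: nat and gr :: "int \<Rightarrow> 'a set"
  assumes gr_zero: "0 \<in> gr r"
    and gr_add: "f \<in> gr r \<Longrightarrow> g \<in> gr r \<Longrightarrow> f + g \<in> gr r"
    and gr_uminus: "f \<in> gr r \<Longrightarrow> - f \<in> gr r"
    and gr_x: "j \<in> {1..n} \<Longrightarrow> f \<in> gr r \<Longrightarrow> x j * f \<in> gr (r + 1)"
begin

lemma gr_diff: "f \<in> gr r \<Longrightarrow> g \<in> gr r \<Longrightarrow> f - g \<in> gr r"
  using gr_add[of f r "- g"] gr_uminus[of g r] by simp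

lemma gr_sum: "(\<And>j. j \<in> A \<Longrightarrow> f j \<in> gr r) \<Longrightarrow> sum f A \<in> gr r"
  by (induction A rule: infinite_finite_induct) (auto intro: gr_zero gr_add)

lemma gr_power: "j \<in> {1..n} \<Longrightarrow> f \<in> gr r \<Longrightarrow> x j ^ a * f \<in> gr (r + int a)"
proof (induction a)
  case (Suc a)
  then show ?case using gr_x[of j "x j ^ a * f" "r + int a"] by (simp add: ac_simps)
qed simp

lemma gr_prod: 
  assumes "finite F"
  shows "F \<subseteq> {1..n} \<Longrightarrow> f \<in> gr r \<Longrightarrow> prod x F ^ a * f \<in> gr (r + int a * int (card F))"
  using assms
proof (induction F arbitrary: r rule: finite_induct)
  case (insert j F)
  have "x j ^ a * (prod x F ^ a * f) \<in> gr (r + int a * int (card F) + int a)"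
    by (rule gr_power) (use insert in auto)
  with insert show ?case by (simp add: power_mult_distrib algebra_simps)
qed simp

lemma gr_prod_face:
  "F \<in> faces n p \<Longrightarrow> f \<in> gr r \<Longrightarrow> prod x F ^ a * f \<in> gr (r + int a * int p)"
  using gr_prod[of F f r a] faces_finite[of F n p] by (auto simp: faces_def)

lemma gr_sign: "f \<in> gr r \<Longrightarrow> koszul_sign G j * f \<in> gr r"
  by (simp add: koszul_sign_def gr_uminus)

lemma gr_koszul_diff:
  assumes "G \<in> faces n (Suc p)" "\<And>F. F \<in> faces n p \<Longrightarrow> m F \<in> gr r"
  shows "koszul_diff x a m G \<in> gr (r + int a)"
  unfolding koszul_diff_def mult.assoc
proof (intro gr_sum gr_sign gr_power)
  fix j assume "j \<in> G"
  with assms(1) show "m (G - {j}) \<in> gr r" "j \<in> {1..n}"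
    by (auto intro: assms(2) faces_remove) (auto simp: faces_def)
qed

text \<open>A fraction with numerator \<open>m F\<close> and denominator \<open>x_F^a\<close> has
  degree \<open>r\<close> if the numerator has degree \<open>r + a * p\<close>, where
  \<open>p\<close> is the size of \<open>F\<close>.\<close>

definition koszul_cocycle where "koszul_cocycle I p r a m \<longleftrightarrow>
  (\<forall>F\<in>faces n p. m F \<in> gr (r + int a * int p)) \<and> (\<forall>G\<in>faces n (Suc p). koszul_diff x a m G \<in> I)"

text \<open>
  Triviality in the direct limit over \<open>a\<close>, whose transition maps multiply the \<open>F\<close>-component by
  \<open>x\<^sub>F\<^sup>l\<close>. For \<open>p = 0\<close> the index \<open>p - 1\<close> is truncated to \<open>0\<close>; this is harmless because the only
  face is then \<open>{}\<close>, where every Koszul differential vanishes.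
\<close>

definition koszul_trivial where "koszul_trivial I p r a m \<longleftrightarrow>
  (\<exists>l h. (\<forall>F\<in>faces n (p - 1). h F \<in> gr (r + int (a + l) * (int p - 1))) \<and>
         (\<forall>F\<in>faces n p. prod x F ^ l * m F - koszul_diff x (a + l) h F \<in> I))"

definition nonzero_cohomology where "nonzero_cohomology I p r \<longleftrightarrow>
  (\<exists>a m. koszul_cocycle I p r a m \<and> \<not> koszul_trivial I p r a m)"

lemma koszul_trivialI:
  assumes "\<And>F. F \<in> faces n (p - 1) \<Longrightarrow> h F \<in> gr (r + int (a + l) * (int p - 1))"
    and "\<And>F. F \<in> faces n p \<Longrightarrow> prod x F ^ l * m F - koszul_diff x (a + l) h F \<in> I"
  shows "koszul_trivial I p r a m"
  using assms unfolding koszul_trivial_def by blast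

end

locale graded_ideal = graded_vars +
  fixes I :: "'a set"
  assumes I_zero: "0 \<in> I"
    and I_add: "f \<in> I \<Longrightarrow> g \<in> I \<Longrightarrow> f + g \<in> I"
    and I_uminus: "f \<in> I \<Longrightarrow> - f \<in> I"
    and I_x: "j \<in> {1..n} \<Longrightarrow> f \<in> I \<Longrightarrow> x j * f \<in> I"
begin

lemma I_diff: "f \<in> I \<Longrightarrow> g \<in> I \<Longrightarrow> f - g \<in> I"
  using I_add[of f "- g"] I_uminus[of g] by simp

lemma I_sum: "(\<And>j. j \<in> A \<Longrightarrow> f j \<in> I) \<Longrightarrow> sum f A \<in> I"
  by (induction A rule: infinite_finite_induct) (auto intro: I_zero I_add)

lemma I_power: "j \<in> {1..n} \<Longrightarrow> f \<in> I \<Longrightarrow> x j ^ a * f \<in> I"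
proof (induction a)
  case (Suc a)
  then show ?case using I_x[of j "x j ^ a * f"] by (simp add: ac_simps)
qed simp

lemma I_prod: 
  assumes "finite F"
  shows "F \<subseteq> {1..n} \<Longrightarrow> f \<in> I \<Longrightarrow> prod x F ^ a * f \<in> I"
  using assms
proof (induction F rule: finite_induct)
  case (insert j F)
  then show ?case using I_power[of j "prod x F ^ a * f" a]
    by (simp add: power_mult_distrib ac_simps)
qed simp

lemma I_prod_face: "F \<in> faces n p \<Longrightarrow> f \<in> I \<Longrightarrow> prod x F ^ a * f \<in> I"
  using I_prod[of F f a] faces_finite[of F n p] by (auto simp: faces_def)

lemma I_sign: "f \<in> I \<Longrightarrow> koszul_sign G j * f \<in> I"
  by (simp add: koszul_sign_def I_uminus)

lemma I_koszul_diff: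
  assumes "G \<in> faces n (Suc p)" "\<And>F. F \<in> faces n p \<Longrightarrow> m F \<in> I"
  shows "koszul_diff x a m G \<in> I"
  unfolding koszul_diff_def mult.assoc
proof (intro I_sum I_sign I_power)
  fix j assume "j \<in> G"
  with assms(1) show "m (G - {j}) \<in> I" "j \<in> {1..n}"
    by (auto intro: assms(2) faces_remove) (auto simp: faces_def)
qed

text \<open>Contracting a cocycle \<open>m\<close> with \<open>e_w\<close> gives a cochain whose
  differential is \<open>x_w^a m\<close> up to the contraction of \<open>d m\<close>, and this error
  lies in \<open>I\<close>. The class dies without passing to a larger exponent, hence
  \<open>l = 0\<close>.\<close>

lemma koszul_cocycle_torsion:
  assumes "koszul_cocycle I (Suc p) r a m" and w: "w \<in> {1..n}"
  shows "koszul_trivial I (Suc p) (r + int a) a (\<lambda>F. x w ^ a * m F)"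
proof (rule koszul_trivialI[where l = 0 and h = "koszul_homotopy w m"])
  fix F assume "F \<in> faces n (Suc p - 1)"
  then have F: "F \<in> faces n p" by simp
  have "r + int a + int (a + 0) * (int (Suc p) - 1) = r + int a * int (Suc p)"
    by (simp add: algebra_simps)
  with F show "koszul_homotopy w m F \<in> gr (r + int a + int (a + 0) * (int (Suc p) - 1))"
    using assms gr_sign[of "m (insert w F)" "r + int a * int (Suc p)" "insert w F" w] faces_insert[OF F _ w]
    unfolding koszul_cocycle_def koszul_homotopy_def
    by (cases "w \<in> F") (simp_all only: gr_zero if_True if_False simp_thms)
next
  fix F assume F: "F \<in> faces n (Suc p)"
  have "koszul_homotopy w (koszul_diff x a m) F \<in> I"
    using assms(1) I_sign[of "koszul_diff x a m (insert w F)" "insert w F" w] faces_insert[OF F _ w]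
    unfolding koszul_cocycle_def koszul_homotopy_def
    by (cases "w \<in> F") (simp_all only: I_zero if_True if_False simp_thms)
  then show "prod x F ^ 0 * (x w ^ a * m F) - koszul_diff x (a + 0) (koszul_homotopy w m) F \<in> I"
    using koszul_homotopy_formula[OF faces_finite[OF F], of x a w m, symmetric]
    by simp
qed

end

text \<open>
  \<open>I'\<close> plays the role of \<open>I + (x\<^sub>w)\<close>, of which only the homogeneous elements matter; \<open>c\<close> bounds the
  degrees of \<open>(I : x\<^sub>w\<^sup>\<infinity>) / I\<close>.
\<close>

locale hyperplane_section = graded_ideal +
  fixes I' :: "'a set" and w :: nat and c :: int
  assumes w: "w \<in> {1..n}"
    and I': "f \<in> gr e \<Longrightarrow> f \<in> I' \<longleftrightarrow> (\<exists>g\<in>gr (e - 1). f - x w * g \<in> I)"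
    and colon: "f \<in> gr e \<Longrightarrow> e > c \<Longrightarrow> x w ^ k * f \<in> I \<Longrightarrow> f \<in> I"
begin

text \<open>On a nonempty face the transition map by \<open>x_F^s\<close> raises the degree by at
  least \<open>s\<close>, hence beyond the bound \<open>c\<close> on the degrees of
  \<open>x_w\<close>-torsion. This is why multiplication by \<open>x_w\<close> may be cancelled in
  the limit in positive cohomological degree.\<close>

lemma colon_prod:
  assumes F: "F \<in> faces n (Suc p)" and f: "f \<in> gr e" "x w * f \<in> I" and s: "e + int s > c"
  shows "prod x F ^ s * f \<in> I"
proof (rule colon[where e = "e + int s * int (Suc p)" and k = 1])
  show "prod x F ^ s * f \<in> gr (e + int s * int (Suc p))" by (rule gr_prod_face[OF F f(1)])
  show "c < e + int s * int (Suc p)" using s by (simp add: algebra_simps) 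
      (smt (verit) mult_nonneg_nonneg of_nat_0_le_iff)
  show "x w ^ 1 * (prod x F ^ s * f) \<in> I"
    using I_prod_face[OF F f(2), of s] by (simp add: ac_simps)
qed

text \<open>A class in degree 0 is an element killed by powers of all variables. Conversely,
  \<open>x_w\<close>-torsion is bounded in degree, so multiplying by a high power of any variable
  takes a torsion element into \<open>I\<close>.\<close>

lemma nonzero_cohomology_0_iff:
  "nonzero_cohomology I 0 r \<longleftrightarrow> (\<exists>f\<in>gr r. f \<notin> I \<and> (\<exists>k. x w ^ k * f \<in> I))"
proof
  assume "nonzero_cohomology I 0 r"
  then obtain a m where cm: "koszul_cocycle I 0 r a m" and t: "\<not> koszul_trivial I 0 r a m"
    unfolding nonzero_cohomology_def by blast
  have "m {} \<in> gr r" using cm by (simp add: koszul_cocycle_def faces_0)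
  moreover have "m {} \<notin> I"
    using t koszul_trivialI[of 0 "\<lambda>_. 0" r a 0 m I] by (auto simp: faces_0 gr_zero)
  moreover have "x w ^ a * m {} \<in> I"
  proof -
    have "{w} \<in> faces n (Suc 0)" using w by (simp add: faces_def)
    then have "koszul_diff x a m {w} \<in> I"
      using cm unfolding koszul_cocycle_def by blast
    then show ?thesis by simp
  qed
  ultimately show "\<exists>f\<in>gr r. f \<notin> I \<and> (\<exists>k. x w ^ k * f \<in> I)" by blast
next
  assume "\<exists>f\<in>gr r. f \<notin> I \<and> (\<exists>k. x w ^ k * f \<in> I)"
  then obtain f k where f: "f \<in> gr r" "f \<notin> I" "x w ^ k * f \<in> I" by blast
  \<comment> \<open>Chosen so that \<open>r + a\<close> exceeds the bound \<open>c\<close>.\<close>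
  define a where "a = nat (c - r + 1)"
  have "x j ^ a * f \<in> I" if "j \<in> {1..n}" for j
  proof (rule colon[where k = k])
    show "x j ^ a * f \<in> gr (r + int a)" by (rule gr_power[OF that f(1)])
    show "c < r + int a" by (simp add: a_def)
    show "x w ^ k * (x j ^ a * f) \<in> I" using I_power[OF that f(3), of a] by (simp add: ac_simps)
  qed
  then have "koszul_cocycle I 0 r a (\<lambda>_. f)"
    using f by (auto simp: koszul_cocycle_def faces_def card_1_singleton_iff)
  moreover have "\<not> koszul_trivial I 0 r a (\<lambda>_. f)"
    using f by (auto simp: koszul_trivial_def faces_0)
  ultimately show "nonzero_cohomology I 0 r" unfolding nonzero_cohomology_def by blast
qed

text \<open>
  Torsion provides a class \<open>m'\<close> with \<open>x\<^sub>w m' = d h\<close> modulo \<open>I\<close>; then \<open>h\<close> is a nontrivial cocycle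
  modulo \<open>I'\<close>.
\<close>

lemma nonzero_cohomology_SucD:
  assumes "nonzero_cohomology I (Suc p) r"
  shows "\<exists>k. nonzero_cohomology I' p (r + int k + 1)"
proof -
  obtain a m where cm: "koszul_cocycle I (Suc p) r a m" and t: "\<not> koszul_trivial I (Suc p) r a m"
    using assms unfolding nonzero_cohomology_def by blast
  define Q where "Q k = koszul_trivial I (Suc p) (r + int k) a (\<lambda>F. x w ^ k * m F)" for k
  have "Q a" unfolding Q_def by (rule koszul_cocycle_torsion[OF cm w])
  moreover have "\<not> Q 0" using t by (simp add: Q_def)
  \<comment> \<open>The last power of \<open>x_w\<close> that does not kill the class.\<close>
  ultimately obtain k where k: "\<not> Q k" "Q (Suc k)"
    by (induction a) auto
  define r' where "r' = r + int k"
  define m' where "m' F = x w ^ k * m F" for F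
  have m'gr: "m' F \<in> gr (r' + int a * int (Suc p))" if "F \<in> faces n (Suc p)" for F
    using gr_power[OF w, of "m F" "r + int a * int (Suc p)" k] cm that
    by (simp add: koszul_cocycle_def m'_def r'_def algebra_simps)
  have nt: "\<not> koszul_trivial I (Suc p) r' a m'"
    using k(1) by (simp add: Q_def m'_def[abs_def] r'_def)
  obtain l h where h: "\<And>F. F \<in> faces n p \<Longrightarrow> h F \<in> gr (r' + 1 + int (a + l) * int p)"
    and hb: "\<And>F. F \<in> faces n (Suc p) \<Longrightarrow> prod x F ^ l * (x w * m' F) - koszul_diff x (a + l) h F \<in> I"
    using k(2) unfolding Q_def koszul_trivial_def m'_def r'_def
    by (auto simp: algebra_simps)
  have "nonzero_cohomology I' p (r' + 1)"
    unfolding nonzero_cohomology_def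
  proof (intro exI conjI)
    show "koszul_cocycle I' p (r' + 1) (a + l) h"
      unfolding koszul_cocycle_def
    proof (intro conjI ballI)
      fix G assume G: "G \<in> faces n (Suc p)"
      have "koszul_diff x (a + l) h G \<in> gr (r' + 1 + int (a + l) * int p + int (a + l))"
        by (rule gr_koszul_diff[OF G h])
      moreover have "prod x G ^ l * m' G \<in> gr (r' + 1 + int (a + l) * int p + int (a + l) - 1)"
        using gr_prod_face[OF G m'gr[OF G], of l] by (simp add: algebra_simps)
      moreover have "koszul_diff x (a + l) h G - x w * (prod x G ^ l * m' G) \<in> I"
        using I_uminus[OF hb[OF G]] by (simp add: algebra_simps)
      ultimately show "koszul_diff x (a + l) h G \<in> I'"
        using I' by blast
    qed (rule h)
    show "\<not> koszul_trivial I' p (r' + 1) (a + l) h"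
    proof
      \<comment> \<open>Triviality modulo \<open>I'\<close> means \<open>h = d e + x_w q\<close>
        modulo \<open>I\<close> after a transition map. Applying \<open>d\<close> gives
        \<open>x_w m' = x_w d q\<close>, and cancelling \<open>x_w\<close> makes \<open>m'\<close>
        trivial.\<close>
      assume "koszul_trivial I' p (r' + 1) (a + l) h"
      then obtain l' e where e: "\<And>F. F \<in> faces n (p - 1) \<Longrightarrow> e F \<in> gr (r' + 1 + int (a + l + l') * (int p - 1))"
        and eb: "\<And>F. F \<in> faces n p \<Longrightarrow> prod x F ^ l' * h F - koszul_diff x (a + l + l') e F \<in> I'"
        unfolding koszul_trivial_def by blast
      let ?b = "a + l + l'"
      have "\<exists>q\<in>gr (r' + int ?b * int p). prod x F ^ l' * h F - koszul_diff x ?b e F - x w * q \<in> I"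
        if F: "F \<in> faces n p" for F
      proof -
        have "koszul_diff x ?b e F \<in> gr (r' + 1 + int ?b * int p)"
        \<comment> \<open>For \<open>p = 0\<close> the index \<open>p - 1\<close> is truncated; the
          only face is then empty and the differential on it is 0, which lies in every
          degree.\<close>
        proof (cases p)
          case 0
          with F show ?thesis by (simp add: faces_0 gr_zero)
        next
          case (Suc p')
          with gr_koszul_diff[of F p' e "r' + 1 + int ?b * (int p - 1)" ?b] F e show ?thesis
            by (simp add: algebra_simps)
        qed
        moreover have "prod x F ^ l' * h F \<in> gr (r' + 1 + int ?b * int p)"
          using gr_prod_face[OF F h[OF F], of l'] by (simp add: algebra_simps)
        ultimately show ?thesis
          using I'[OF gr_diff] eb[OF F] by fastforce
      qed
      then obtain q where q: "\<And>F. F \<in> faces n p \<Longrightarrow> q F \<in> gr (r' + int ?b * int p)"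
        and qb: "\<And>F. F \<in> faces n p \<Longrightarrow> prod x F ^ l' * h F - koszul_diff x ?b e F - x w * q F \<in> I"
        by metis
      have z: "x w * (prod x G ^ (l + l') * m' G - koszul_diff x ?b q G) \<in> I" if G: "G \<in> faces n (Suc p)" for G
      proof -
        have "koszul_diff x ?b (\<lambda>F. prod x F ^ l' * h F - koszul_diff x ?b e F - x w * q F) G \<in> I"
          by (rule I_koszul_diff[OF G qb])
        then have "prod x G ^ l' * koszul_diff x (a + l) h G - x w * koszul_diff x ?b q G \<in> I"
          using faces_finite[OF G]
          by (simp add: koszul_diff_minus koszul_diff_cmult koszul_diff_rescale koszul_diff_diff)
        from I_add[OF this I_prod_face[OF G hb[OF G], of l']]
        show ?thesis by (simp add: algebra_simps power_add)
      qed
      \<comment> \<open>\<open>colon_prod\<close> is applied to a cochain of degree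
        \<open>r' + ?b * (p + 1)\<close>; adding \<open>s\<close> takes this degree beyond
        \<open>c\<close>.\<close>
      define s where "s = nat (c - r' - int ?b * int (Suc p) + 1)"
      have "koszul_trivial I (Suc p) r' a m'"
      proof (rule koszul_trivialI[where l = "l + l' + s" and h = "\<lambda>F. prod x F ^ s * q F"])
        fix F assume "F \<in> faces n (Suc p - 1)"
        then have F: "F \<in> faces n p" by simp
        show "prod x F ^ s * q F \<in> gr (r' + int (a + (l + l' + s)) * (int (Suc p) - 1))"
          using gr_prod_face[OF F q[OF F], of s] by (simp add: algebra_simps)
      next
        fix F assume F: "F \<in> faces n (Suc p)"
        have "prod x F ^ (l + l') * m' F - koszul_diff x ?b q F \<in> gr (r' + int ?b * int (Suc p))"
          using gr_prod_face[OF F m'gr[OF F], of "l + l'"] gr_koszul_diff[OF F, of q "r' + int ?b * int p" ?b] q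
          by (intro gr_diff) (simp_all add: algebra_simps)
        from colon_prod[OF F this z[OF F], of s]
        have "prod x F ^ s * (prod x F ^ (l + l') * m' F - koszul_diff x ?b q F) \<in> I"
          by (simp add: s_def)
        then show "prod x F ^ (l + l' + s) * m' F
            - koszul_diff x (a + (l + l' + s)) (\<lambda>F. prod x F ^ s * q F) F \<in> I"
          using koszul_diff_rescale[OF faces_finite[OF F], of x ?b s q]
          by (simp add: algebra_simps power_add)
      qed
      with nt show False by simp
    qed
  qed
  then show ?thesis by (auto simp: r'_def)
qed

text \<open>This is exactness at the cohomology of the section. The connecting map sends
  \<open>h\<close> to \<open>u\<close>, the quotient of \<open>d h\<close> by \<open>x_w\<close>
  modulo \<open>I\<close>. If \<open>u\<close> becomes a coboundary, \<open>h\<close> can be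
  corrected by a multiple of \<open>x_w\<close> to a cocycle modulo \<open>I\<close>; if that one is
  trivial too, so is \<open>h\<close> modulo \<open>I'\<close>.\<close>

lemma nonzero_cohomology_sectionD:
  assumes "nonzero_cohomology I' p r"
  shows "nonzero_cohomology I p r \<or> nonzero_cohomology I (Suc p) (r - 1)"
proof (rule ccontr)
  assume "\<not> ?thesis"
  then have n0: "\<And>a m. koszul_cocycle I p r a m \<Longrightarrow> koszul_trivial I p r a m"
    and n1: "\<And>a m. koszul_cocycle I (Suc p) (r - 1) a m \<Longrightarrow> koszul_trivial I (Suc p) (r - 1) a m"
    unfolding nonzero_cohomology_def by blast+
  obtain a h where ch: "koszul_cocycle I' p r a h" and t: "\<not> koszul_trivial I' p r a h"
    using assms unfolding nonzero_cohomology_def by blast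
  have hgr: "\<And>F. F \<in> faces n p \<Longrightarrow> h F \<in> gr (r + int a * int p)"
    using ch by (simp add: koszul_cocycle_def)
  have "\<exists>u\<in>gr (r - 1 + int a * int (Suc p)). koszul_diff x a h G - x w * u \<in> I" if G: "G \<in> faces n (Suc p)" for G
  proof -
    have "koszul_diff x a h G \<in> gr (r + int a * int (Suc p))"
      using gr_koszul_diff[OF G, of h "r + int a * int p" a] hgr by (simp add: algebra_simps)
    moreover have "koszul_diff x a h G \<in> I'" using ch G by (simp add: koszul_cocycle_def)
    ultimately show ?thesis using I' by (fastforce simp: algebra_simps)
  qed
  then obtain u where u: "\<And>G. G \<in> faces n (Suc p) \<Longrightarrow> u G \<in> gr (r - 1 + int a * int (Suc p))"
    and ub: "\<And>G. G \<in> faces n (Suc p) \<Longrightarrow> koszul_diff x a h G - x w * u G \<in> I" by metis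
  \<comment> \<open>\<open>d u\<close> is killed by \<open>x_w\<close> modulo \<open>I\<close> only.
    Its degree is the one subtracted here from \<open>c\<close>, so a factor \<open>x_G^s\<close>
    puts it into \<open>I\<close> and makes the rescaled \<open>u\<close> a cocycle.\<close>
  define s where "s = nat (c - (r - 1 + int a * int (Suc p) + int a) + 1)"
  have "koszul_cocycle I (Suc p) (r - 1) (a + s) (\<lambda>F. prod x F ^ s * u F)"
    unfolding koszul_cocycle_def
  proof (intro conjI ballI)
    fix F assume F: "F \<in> faces n (Suc p)"
    show "prod x F ^ s * u F \<in> gr (r - 1 + int (a + s) * int (Suc p))"
      using gr_prod_face[OF F u[OF F], of s] by (simp add: algebra_simps)
  next
    fix G assume G: "G \<in> faces n (Suc (Suc p))"
    have "koszul_diff x a (\<lambda>G. koszul_diff x a h G - x w * u G) G \<in> I"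
      by (rule I_koszul_diff[OF G ub])
    then have "x w * koszul_diff x a u G \<in> I"
      using I_uminus faces_finite[OF G] by (fastforce simp: koszul_diff_minus koszul_diff_cmult koszul_diff_diff)
    moreover have "koszul_diff x a u G \<in> gr (r - 1 + int a * int (Suc p) + int a)"
      by (rule gr_koszul_diff[OF G u])
    ultimately have "prod x G ^ s * koszul_diff x a u G \<in> I"
    proof (intro colon_prod[OF G])
      show "c < r - 1 + int a * int (Suc p) + int a + int s" unfolding s_def by linarith
    qed
    then
    show "koszul_diff x (a + s) (\<lambda>F. prod x F ^ s * u F) G \<in> I"
      by (simp add: koszul_diff_rescale faces_finite[OF G])
  qed
  from n1[OF this] obtain l e
    where e: "\<And>F. F \<in> faces n p \<Longrightarrow> e F \<in> gr (r - 1 + int (a + s + l) * int p)"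
      and eb: "\<And>F. F \<in> faces n (Suc p) \<Longrightarrow>
        prod x F ^ l * (prod x F ^ s * u F) - koszul_diff x (a + s + l) e F \<in> I"
    unfolding koszul_trivial_def by auto
  let ?b = "a + (s + l)"
  \<comment> \<open>Multiples of \<open>x_w\<close> lie in \<open>I'\<close>, so \<open>h'\<close>
    represents the same class as \<open>h\<close> modulo \<open>I'\<close>; subtracting
    \<open>x_w e\<close> cancels the obstruction \<open>x_w u\<close> in \<open>d h\<close>.\<close>
  define h' where "h' F = prod x F ^ (s + l) * h F - x w * e F" for F
  have "koszul_cocycle I p r ?b h'"
    unfolding koszul_cocycle_def
  proof (intro conjI ballI)
    fix F assume F: "F \<in> faces n p"
    show "h' F \<in> gr (r + int ?b * int p)"
      unfolding h'_def
      using gr_prod_face[OF F hgr[OF F], of "s + l"] gr_x[OF w e[OF F]]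
      by (intro gr_diff) (simp_all add: algebra_simps)
  next
    fix G assume G: "G \<in> faces n (Suc p)"
    have "koszul_diff x ?b h' G = prod x G ^ (s + l) * koszul_diff x a h G - x w * koszul_diff x ?b e G"
      unfolding h'_def by (simp only: koszul_diff_minus koszul_diff_cmult koszul_diff_rescale[OF faces_finite[OF G]])
    also have "\<dots> = prod x G ^ (s + l) * (koszul_diff x a h G - x w * u G)
      + x w * (prod x G ^ l * (prod x G ^ s * u G) - koszul_diff x (a + s + l) e G)"
      by (simp add: algebra_simps power_add)
    also have "\<dots> \<in> I"
      by (intro I_add I_x w I_prod_face[OF G] ub[OF G] eb[OF G])
    finally show "koszul_diff x ?b h' G \<in> I" .
  qed
  from n0[OF this] obtain L e'
    where e': "\<And>F. F \<in> faces n (p - 1) \<Longrightarrow> e' F \<in> gr (r + int (?b + L) * (int p - 1))"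
      and eb': "\<And>F. F \<in> faces n p \<Longrightarrow> prod x F ^ L * h' F - koszul_diff x (?b + L) e' F \<in> I"
    unfolding koszul_trivial_def by blast
  have "koszul_trivial I' p r a h"
  proof (rule koszul_trivialI[where l = "s + l + L" and h = e'])
    fix F assume "F \<in> faces n (p - 1)"
    then show "e' F \<in> gr (r + int (a + (s + l + L)) * (int p - 1))"
      using e' by (simp add: add.assoc)
  next
    fix F assume F: "F \<in> faces n p"
    let ?c = "a + (s + l + L)"
    have "koszul_diff x ?c e' F \<in> gr (r + int ?c * int p)"
    proof (cases p)
      case 0
      with F show ?thesis by (simp add: faces_0 gr_zero)
    next
      case (Suc p')
      with gr_koszul_diff[of F p' e' "r + int ?c * (int p - 1)" ?c] F e' show ?thesis
        by (simp add: algebra_simps)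
    qed
    moreover have "prod x F ^ (s + l + L) * h F \<in> gr (r + int ?c * int p)"
      using gr_prod_face[OF F hgr[OF F], of "s + l + L"] by (simp add: algebra_simps)
    moreover have "prod x F ^ L * e F \<in> gr (r + int ?c * int p - 1)"
      using gr_prod_face[OF F e[OF F], of L] by (simp add: algebra_simps)
    moreover have "prod x F ^ (s + l + L) * h F - koszul_diff x ?c e' F - x w * (prod x F ^ L * e F) \<in> I"
      using eb'[OF F] by (simp add: h'_def algebra_simps power_add)
    ultimately show "prod x F ^ (s + l + L) * h F - koszul_diff x ?c e' F \<in> I'"
      using I'[OF gr_diff] by blast
  qed
  with t show False by simp
qed

end

section \<open>Initial ideals of sections and saturations\<close>

abbreviation restr :: "nat \<Rightarrow> 'k::field mpoly \<Rightarrow> 'k mpoly"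
  where "restr w \<equiv> filter_keys (\<lambda>m. m \<in> mons w)"

section \<open>Forms\<close>

lemma hom_part_iff:
  "f \<in> hom_part n r \<longleftrightarrow> f \<in> carrier (poly_ring n) \<and> (\<forall>m\<in>Poly_Mapping.keys f. int (mon_deg m) = r)"
  by (simp add: hom_part_def)

lemma hom_part_filter_keys: "f \<in> hom_part n r \<Longrightarrow> filter_keys P f \<in> hom_part n r"
  by (auto simp: hom_part_iff carrier_poly_ring)

lemma hom_part_0 [simp]: "0 \<in> hom_part n r"
  by (simp add: hom_part_iff carrier_poly_ring)

lemma hom_part_add: "f \<in> hom_part n r \<Longrightarrow> g \<in> hom_part n r \<Longrightarrow> f + g \<in> hom_part n r"
  using Poly_Mapping.keys_add[of f g] by (fastforce simp: hom_part_iff carrier_poly_ring)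

lemma keys_uminus: "Poly_Mapping.keys (- f) = Poly_Mapping.keys (f :: _ \<Rightarrow>\<^sub>0 'b::ab_group_add)"
  by (auto simp: in_keys_iff)

lemma hom_part_uminus: "f \<in> hom_part n r \<Longrightarrow> - f \<in> hom_part n r"
  by (simp add: hom_part_iff carrier_poly_ring keys_uminus)

lemma hom_part_diff: "f \<in> hom_part n r \<Longrightarrow> g \<in> hom_part n r \<Longrightarrow> f - g \<in> hom_part n r"
  using hom_part_add[of f n r "- g"] hom_part_uminus[of g] by simp

lemma hom_part_monomial_mult:
  "u \<in> mons n \<Longrightarrow> f \<in> hom_part n r \<Longrightarrow> monomial u * f \<in> hom_part n (r + int (mon_deg u))"
  by (auto simp: hom_part_iff carrier_poly_ring keys_monomial_mult mon_deg_add mons_add_iff)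

lemma hom_component_id: "f \<in> hom_part n (int r) \<Longrightarrow> hom_component r f = f"
  unfolding hom_component_eq by (rule filter_keys_id) (simp add: hom_part_iff)

lemma hom_part_neg: "f \<in> hom_part n r \<Longrightarrow> r < 0 \<Longrightarrow> f = 0"
  using keys_eq_empty[of f] by (auto simp: hom_part_iff)

section \<open>Homogeneous ideals and the exponents of the initial ideal\<close>

lemma homogeneous_ideal_ideal: "homogeneous_ideal n I \<Longrightarrow> ideal I (poly_ring n)"
  by (simp add: homogeneous_ideal_def)

lemma hom_component_ideal:
  assumes "homogeneous_ideal n I" "f \<in> I"
  shows "hom_component r f \<in> I" "hom_component r f \<in> hom_part n (int r)"
proof -
  have "f \<in> carrier (poly_ring n)"
    using ideal_carrier[OF homogeneous_ideal_ideal] assms by blast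
  then show "hom_component r f \<in> I" "hom_component r f \<in> hom_part n (int r)"
    using assms by (auto simp: homogeneous_ideal_def hom_part_iff hom_component_eq carrier_poly_ring)
qed

text \<open>The exponents of the monomials in in(I). The witnesses are restricted to forms, because
  killing the last variables preserves leading monomials of forms only.\<close>

definition lead_mons :: "nat \<Rightarrow> 'k::field mpoly set \<Rightarrow> mon set"
  where "lead_mons n I =
    {u. \<exists>g\<in>I. g \<noteq> 0 \<and> g \<in> hom_part n (int (mon_deg u)) \<and> lead_mon g = u}"

lemma lead_mons_subset: "lead_mons n I \<subseteq> mons n"
  using lead_mon_in_keys by (fastforce simp: lead_mons_def hom_part_iff carrier_poly_ring)

lemma lead_mons_add:
  assumes "ideal I (poly_ring n)" "u \<in> lead_mons n I" "v \<in> mons n"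
  shows "v + u \<in> lead_mons n I"
proof -
  obtain g where g: "g \<in> I" "g \<noteq> 0" "g \<in> hom_part n (int (mon_deg u))" "lead_mon g = u"
    using assms(2) by (auto simp: lead_mons_def)
  have "monomial v * g \<in> I"
    by (rule ideal_mult[OF assms(1) g(1) monomial_closed[OF assms(3)]])
  moreover have "monomial v * g \<in> hom_part n (int (mon_deg (v + u)))"
    using hom_part_monomial_mult[OF assms(3) g(3)] by (simp add: mon_deg_add add.commute)
  ultimately show ?thesis
    using g unfolding lead_mons_def by (auto intro!: bexI[of _ "monomial v * g"] simp: lead_mon_monomial_mult)
qed

text \<open>The homogeneous component in the degree of the leading monomial lies in \<open>I\<close>
  and keeps that leading monomial.\<close>

lemma lead_mon_in_lead_mons:
  assumes "homogeneous_ideal n I" "f \<in> I" "f \<noteq> 0"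
  shows "lead_mon f \<in> lead_mons n I"
proof -
  let ?g = "hom_component (mon_deg (lead_mon f)) f"
  have k: "lead_mon f \<in> Poly_Mapping.keys ?g"
    using lead_mon_in_keys[OF assms(3)] by (simp add: hom_component_eq)
  moreover have "lead_mon ?g = lead_mon f"
    by (rule lead_monI[OF k]) (use lead_mon_greatest[OF assms(3)] in \<open>simp add: hom_component_eq\<close>)
  ultimately show ?thesis
    using hom_component_ideal[OF assms(1,2)] unfolding lead_mons_def
    by (intro CollectI bexI[of _ ?g]) auto
qed

lemma initial_ideal_iff:
  fixes I :: "'k::field mpoly set"
  assumes "homogeneous_ideal n I"
  shows "f \<in> initial_ideal n I \<longleftrightarrow> Poly_Mapping.keys f \<subseteq> lead_mons n I"
proof -
  interpret R: ring "poly_ring n :: 'k mpoly ring" using cring_poly_ring by (rule cring.axioms)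
  let ?G = "{monomial (lead_mon f) :: 'k mpoly | f. f \<in> I \<and> f \<noteq> 0}"
  note id = homogeneous_ideal_ideal[OF assms]
  have "?G \<subseteq> {f. Poly_Mapping.keys f \<subseteq> lead_mons n I}"
    using lead_mon_in_lead_mons[OF assms] by auto
  with ideal_keys_subset[OF lead_mons_subset lead_mons_add[OF id]]
  have "initial_ideal n I \<subseteq> {f. Poly_Mapping.keys f \<subseteq> lead_mons n I}"
    unfolding initial_ideal_def by (rule R.genideal_minimal)
  moreover have "f \<in> initial_ideal n I" if f: "Poly_Mapping.keys f \<subseteq> lead_mons n I"
  proof -
    have sub: "?G \<subseteq> carrier (poly_ring n)"
      using lead_mon_in_lead_mons[OF assms] lead_mons_subset by (force simp: carrier_poly_ring)
    show ?thesis unfolding initial_ideal_def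
    proof (rule ideal_memI[OF R.genideal_ideal[OF sub]])
      fix u assume "u \<in> Poly_Mapping.keys f"
      with f have "u \<in> lead_mons n I" by auto
      then have "monomial u \<in> ?G" unfolding lead_mons_def by auto
      then show "monomial u \<in> Idl\<^bsub>poly_ring n\<^esub> ?G" using R.genideal_self[OF sub] by (rule rev_subsetD)
    qed
  qed
  ultimately show ?thesis by auto
qed

section \<open>Evaluation of variables and the ideals J and J tilde\<close>

lemma poly_subst_restr:
  assumes "f \<in> carrier (poly_ring n)"
  shows "poly_subst (\<lambda>j. if j > w then 0 else var j) f = restr w f"
proof -
  have *: "Poly_Mapping.single 0 c * (\<Prod>j\<in>Poly_Mapping.keys m. (if j > w then 0 else var j) ^ Poly_Mapping.lookup m j)
     = (if m \<in> mons w then Poly_Mapping.single m c else (0 :: 'a mpoly))" if m: "m \<in> mons n" for m and c :: 'a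
  proof (cases "m \<in> mons w")
    case True
    have "(\<Prod>j\<in>Poly_Mapping.keys m. (if j > w then 0 else var j) ^ Poly_Mapping.lookup m j) =
      (\<Prod>j\<in>Poly_Mapping.keys m. (monomial (Poly_Mapping.single j (Poly_Mapping.lookup m j)) :: 'a mpoly))"
      by (rule prod.cong) (use True in \<open>auto simp: mons_def subset_iff var_power\<close>)
    also have "\<dots> = monomial m" by (simp add: monomial_prod sum_single_lookup)
    finally show ?thesis using True by (simp add: monomial_def mult_single)
  next
    case False
    with m obtain j where "j \<in> Poly_Mapping.keys m" "j > w" by (auto simp: mons_def subset_iff not_le)
    then have "(\<Prod>j\<in>Poly_Mapping.keys m. (if j > w then 0 else var j) ^ Poly_Mapping.lookup m j) = (0 :: 'a mpoly)"
      by (intro prod_zero) (auto intro!: bexI[of _ j] simp: in_keys_iff)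
    with False show ?thesis by simp
  qed
  have "poly_subst (\<lambda>j. if j > w then 0 else var j) f =
     (\<Sum>m\<in>Poly_Mapping.keys f. if m \<in> mons w then Poly_Mapping.single m (Poly_Mapping.lookup f m) else 0)"
    unfolding poly_subst_def
    by (intro sum.cong refl *) (use assms in \<open>auto simp: carrier_poly_ring\<close>)
  also have "\<dots> = (\<Sum>m | m \<in> Poly_Mapping.keys f \<and> m \<in> mons w. Poly_Mapping.single m (Poly_Mapping.lookup f m))"
    by (rule sum.inter_filter[symmetric]) simp
  finally show ?thesis by (simp add: sum_single_lookup_filter)
qed

lemma poly_subst_dehomogenize:
  "poly_subst (\<lambda>j. if j = w then 1 else var j) (monomial m) = (monomial (filter_keys (\<lambda>j. j \<noteq> w) m) :: 'k::field mpoly)"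
proof -
  have "poly_subst (\<lambda>j. if j = w then 1 else var j) (monomial m) =
    (\<Prod>j\<in>Poly_Mapping.keys m. (if j = w then 1 else var j :: 'k mpoly) ^ Poly_Mapping.lookup m j)"
    by (simp add: poly_subst_def monomial_def)
  also have "\<dots> = (\<Prod>j\<in>Poly_Mapping.keys m. monomial (if j \<noteq> w then Poly_Mapping.single j (Poly_Mapping.lookup m j) else 0))"
    by (rule prod.cong) (auto simp: var_power monomial_0)
  also have "\<dots> = monomial (filter_keys (\<lambda>j. j \<noteq> w) m)"
    by (simp only: monomial_prod sum.inter_filter[OF finite_keys, symmetric] sum_single_lookup_filter)
  finally show ?thesis .
qed

lemma J_ideal_iff:
  fixes I :: "'k::field mpoly set"
  assumes "homogeneous_ideal n I"
  shows "f \<in> J_ideal n I i \<longleftrightarrow> Poly_Mapping.keys f \<subseteq> lead_mons n I \<inter> mons (n - i)"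
proof -
  have "J_ideal n I i = restr (n - i) ` initial_ideal n I"
    unfolding J_ideal_def
    by (rule image_cong[OF refl poly_subst_restr])
       (use initial_ideal_iff[OF assms] lead_mons_subset[of n I] in \<open>auto simp: carrier_poly_ring\<close>)
  also have "\<dots> = {f :: 'k mpoly. Poly_Mapping.keys f \<subseteq> lead_mons n I \<inter> mons (n - i)}"
  proof (intro equalityI subsetI)
    fix f :: "'k mpoly" assume f: "f \<in> {f. Poly_Mapping.keys f \<subseteq> lead_mons n I \<inter> mons (n - i)}"
    then have "f = restr (n - i) f" by (intro filter_keys_id[symmetric]) auto
    with f show "f \<in> restr (n - i) ` initial_ideal n I" by (auto simp: initial_ideal_iff[OF assms])
  qed (auto simp: initial_ideal_iff[OF assms])
  finally show ?thesis by simp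
qed

text \<open>\<open>J_tilde\<close> is the saturation of the monomial ideal \<open>J_ideal\<close>
  with respect to its last variable. Both are spanned by monomials, so a degree of the quotient is
  detected by a single monomial.\<close>

lemma J_tilde_J_ideal_iff:
  fixes I :: "'k::field mpoly set"
  assumes I: "homogeneous_ideal n I" and i: "i < n"
  shows "(\<exists>f\<in>J_tilde n I i \<inter> hom_part (n - i) r. f \<notin> J_ideal n I i) \<longleftrightarrow>
    (\<exists>u\<in>mons (n - i). int (mon_deg u) = r \<and> u \<notin> lead_mons n I \<and>
       (\<exists>k. u + Poly_Mapping.single (n - i) k \<in> lead_mons n I))"
    (is "?L \<longleftrightarrow> ?R")
proof -
  define w where "w = n - i"
  have w: "w \<in> {1..w}" "w \<le> n" using i by (auto simp: w_def)
  interpret R: ring "poly_ring w :: 'k mpoly ring" using cring_poly_ring by (rule cring.axioms)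
  let ?K = "{u \<in> mons w. \<exists>k. u + Poly_Mapping.single w k \<in> lead_mons n I}"
  let ?G = "{monomial (filter_keys (\<lambda>j. j \<noteq> w) m) :: 'k mpoly | m. m \<in> lead_mons n I \<inter> mons w}"
  note id = homogeneous_ideal_ideal[OF I]
  have Jt: "J_tilde n I i = Idl\<^bsub>poly_ring w\<^esub> ?G"
    unfolding J_tilde_def by (simp add: J_ideal_iff[OF I] poly_subst_dehomogenize w_def)
  have split: "filter_keys (\<lambda>j. j \<noteq> w) m + Poly_Mapping.single w (Poly_Mapping.lookup m w) = m" for m :: mon
    by (rule poly_mapping_eqI) (simp add: lookup_add lookup_single when_def)
  have fk: "filter_keys (\<lambda>j. j \<noteq> w) m \<in> ?K" if "m \<in> lead_mons n I \<inter> mons w" for m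
  proof -
    have "filter_keys (\<lambda>j. j \<noteq> w) m \<in> mons w" using that by (auto simp: mons_def)
    moreover have "filter_keys (\<lambda>j. j \<noteq> w) m + Poly_Mapping.single w (Poly_Mapping.lookup m w) \<in> lead_mons n I"
      using that split[of m] by simp
    ultimately show ?thesis by blast
  qed
  have "ideal {f :: 'k mpoly. Poly_Mapping.keys f \<subseteq> ?K} (poly_ring w)"
  proof (rule ideal_keys_subset)
    fix u v assume u: "u \<in> ?K" and v: "v \<in> mons w"
    then obtain k where "u + Poly_Mapping.single w k \<in> lead_mons n I" by auto
    from lead_mons_add[OF id this, of v] have "v + u + Poly_Mapping.single w k \<in> lead_mons n I"
      using v mons_mono[OF w(2)] by (auto simp: add.assoc)
    with u v show "v + u \<in> ?K" by (auto simp: mons_add_iff)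
  qed auto
  moreover have "?G \<subseteq> {f. Poly_Mapping.keys f \<subseteq> ?K}" using fk by auto
  ultimately have sub: "J_tilde n I i \<subseteq> {f. Poly_Mapping.keys f \<subseteq> ?K}"
    unfolding Jt by (rule R.genideal_minimal)
  show ?thesis
  proof
    assume ?L
    then obtain f where f: "f \<in> J_tilde n I i" "f \<in> hom_part w r" "f \<notin> J_ideal n I i"
      by (auto simp: w_def)
    then obtain u where u: "u \<in> Poly_Mapping.keys f" "u \<notin> lead_mons n I \<inter> mons w"
      using J_ideal_iff[OF I] by (auto simp: w_def)
    with sub f have "u \<in> ?K" "int (mon_deg u) = r" by (auto simp: hom_part_iff)
    with u show ?R by (auto simp: w_def)
  next
    assume ?R
    then obtain u k where u: "u \<in> mons w" "int (mon_deg u) = r" "u \<notin> lead_mons n I"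
      "u + Poly_Mapping.single w k \<in> lead_mons n I" by (auto simp: w_def)
    let ?m = "u + Poly_Mapping.single w k"
    have m: "?m \<in> lead_mons n I \<inter> mons w" using u mons_single[OF w(1)] by (simp add: mons_add_iff)
    \<comment> \<open>Putting \<open>x_w = 1\<close> forgets the added power, so \<open>u\<close> is
      a generator of \<open>J_tilde\<close> times a power of \<open>x_w\<close>.\<close>
    have "filter_keys (\<lambda>j. j \<noteq> w) ?m = filter_keys (\<lambda>j. j \<noteq> w) u"
      by (rule poly_mapping_eqI) (simp add: lookup_add lookup_single)
    then have g: "monomial (filter_keys (\<lambda>j. j \<noteq> w) u) \<in> ?G" using m by (metis (mono_tags, lifting) mem_Collect_eq)
    have subc: "?G \<subseteq> carrier (poly_ring w)" using fk by (auto simp: carrier_poly_ring)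
    have "monomial (Poly_Mapping.single w (Poly_Mapping.lookup u w)) * monomial (filter_keys (\<lambda>j. j \<noteq> w) u) \<in> Idl\<^bsub>poly_ring w\<^esub> ?G"
      by (rule ideal_mult[OF R.genideal_ideal[OF subc]])
         (use g R.genideal_self[OF subc] in blast, intro monomial_closed mons_single w)
    then have "monomial u \<in> J_tilde n I i"
      using split[of u] by (simp add: Jt monomial_mult add.commute)
    moreover have "(monomial u :: 'k mpoly) \<in> hom_part w r" using u by (simp add: hom_part_iff carrier_poly_ring)
    moreover have "(monomial u :: 'k mpoly) \<notin> J_ideal n I i" using u by (simp add: J_ideal_iff[OF I])
    ultimately show ?L by (auto simp: w_def)
  qed
qed

section \<open>Leading monomials and saturations of the sections\<close>

text \<open>This is the ideal \<open>I + (x\<^bsub>w+1\<^esub>, \<dots>, x\<^sub>n)\<close>.\<close>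

definition section_ideal :: "nat \<Rightarrow> 'k::field mpoly set \<Rightarrow> nat \<Rightarrow> 'k mpoly set"
  where "section_ideal n I w = {f \<in> carrier (poly_ring n). restr w f \<in> restr w ` I}"

lemma restr_monomial_mult: "u \<in> mons w \<Longrightarrow> restr w (monomial u * f) = monomial u * restr w f"
  by (simp add: filter_keys_monomial_mult mons_add_iff)

lemma restr_hom_component: "restr w (hom_component r f) = hom_component r (restr w f)"
  by (simp add: hom_component_eq filter_keys_filter_keys conj_commute)

text \<open>The element of \<open>I\<close> that agrees with \<open>f\<close> after the evaluation
  need not be a form; its component in the degree of \<open>f\<close> is one, and evaluation
  commutes with taking components.\<close>

lemma section_idealD:
  assumes I: "homogeneous_ideal n I" and f: "f \<in> section_ideal n I w" "f \<in> hom_part n r"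
  shows "\<exists>g\<in>I \<inter> hom_part n r. restr w f = restr w g"
proof (cases "r < 0")
  case True
  then have "f = 0" using hom_part_neg f by blast
  then show ?thesis using ideal_zero[OF homogeneous_ideal_ideal[OF I]] by force
next
  case False
  then obtain q where q: "r = int q" by (metis nonneg_eq_int not_less)
  obtain g where g: "g \<in> I" "restr w f = restr w g" using f by (auto simp: section_ideal_def)
  have "restr w f = hom_component q (restr w f)"
    using hom_component_id[of f n q] f(2) q by (metis restr_hom_component)
  then have "restr w f = restr w (hom_component q g)" by (metis g(2) restr_hom_component)
  then show ?thesis using hom_component_ideal[OF I g(1), of q] q by blast
qed

text \<open>
  The property that singles out the reverse lexicographic order: killing the last variables
  does not change the leading monomial of a form which survives.
\<close>

lemma lead_mon_restr:
  assumes g: "g \<in> hom_part n r" "restr w g \<noteq> 0"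
  shows "lead_mon (restr w g) = lead_mon g"
proof (rule sym, rule lead_monI)
  have l: "lead_mon (restr w g) \<in> Poly_Mapping.keys g" "lead_mon (restr w g) \<in> mons w"
    using lead_mon_in_keys[OF g(2)] by auto
  then show "lead_mon (restr w g) \<in> Poly_Mapping.keys g" by simp
  fix u assume u: "u \<in> Poly_Mapping.keys g" "u \<noteq> lead_mon (restr w g)"
  show "drl_less u (lead_mon (restr w g))"
  proof (cases "u \<in> mons w")
    case True
    then show ?thesis using lead_mon_greatest[OF g(2), of u] u by simp
  next
    case False
    have "mon_deg u = mon_deg (lead_mon (restr w g))" "u \<in> mons n"
      using g u l by (auto simp: hom_part_iff carrier_poly_ring) (metis of_nat_eq_iff)
    with False l show ?thesis by (intro drl_less_mons) auto
  qed
qed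

lemma lead_mon_section:
  assumes I: "homogeneous_ideal n I" and f: "f \<in> section_ideal n I w" "f \<in> hom_part n r" "restr w f \<noteq> 0"
  shows "lead_mon (restr w f) \<in> lead_mons n I"
proof -
  obtain g where g: "g \<in> I" "g \<in> hom_part n r" "restr w f = restr w g"
    using section_idealD[OF I f(1,2)] by auto
  moreover from this f(3) have "g \<noteq> 0" by auto
  ultimately show ?thesis
    using lead_mon_restr[OF g(2), of w] lead_mon_in_lead_mons[OF I g(1)] f(3) by simp
qed

text \<open>The converse of \<open>lead_mon_section\<close>: a form of \<open>I\<close> whose
  leading monomial avoids the last variables survives their evaluation, and the result still has
  that leading monomial.\<close>

lemma lead_mons_section:
  assumes I: "homogeneous_ideal n I" and u: "u \<in> lead_mons n I" "u \<in> mons w"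
  shows "\<exists>f\<in>section_ideal n I w \<inter> hom_part n (int (mon_deg u)).
    f \<noteq> 0 \<and> restr w f = f \<and> lead_mon f = u"
proof -
  obtain g where g: "g \<in> I" "g \<noteq> 0" "g \<in> hom_part n (int (mon_deg u))" "lead_mon g = u"
    using u by (auto simp: lead_mons_def)
  have "u \<in> Poly_Mapping.keys (restr w g)" using lead_mon_in_keys[OF g(2)] g u by simp
  then have nz: "restr w g \<noteq> 0" by (metis empty_iff keys_zero)
  have "restr w g \<in> section_ideal n I w"
    using g by (auto simp: section_ideal_def hom_part_iff filter_keys_filter_keys carrier_poly_ring)
  moreover have "restr w g \<in> hom_part n (int (mon_deg u))" by (rule hom_part_filter_keys[OF g(3)])
  moreover have "lead_mon (restr w g) = u" using lead_mon_restr[OF g(3) nz] g by simp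
  moreover have "restr w (restr w g) = restr w g" by (simp add: filter_keys_filter_keys)
  ultimately show ?thesis using nz by blast
qed

lemma section_ideal_ideal:
  fixes I :: "'k::field mpoly set"
  assumes I: "ideal I (poly_ring n)"
  shows "0 \<in> section_ideal n I w"
    and "f \<in> section_ideal n I w \<Longrightarrow> g \<in> section_ideal n I w \<Longrightarrow> f + g \<in> section_ideal n I w"
    and "f \<in> section_ideal n I w \<Longrightarrow> - f \<in> section_ideal n I w"
    and "u \<in> mons n \<Longrightarrow> f \<in> section_ideal n I w \<Longrightarrow> monomial u * f \<in> section_ideal n I w"
    and "f \<in> section_ideal n I w \<Longrightarrow> Poly_Mapping.single 0 c * f \<in> section_ideal n I w"
proof -
  show "0 \<in> section_ideal n I w"
    using ideal_zero[OF I] by (auto simp: section_ideal_def carrier_poly_ring intro!: image_eqI[of _ _ 0])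
  show "f + g \<in> section_ideal n I w" if f: "f \<in> section_ideal n I w" and g: "g \<in> section_ideal n I w"
  proof -
    obtain f' where f': "f' \<in> I" "restr w f = restr w f'" using f by (auto simp: section_ideal_def)
    obtain g' where "g' \<in> I" "restr w g = restr w g'" using g by (auto simp: section_ideal_def)
    with f' have "restr w (f + g) = restr w (f' + g')" "f' + g' \<in> I"
      by (simp_all add: filter_keys_add ideal_add[OF I])
    then show ?thesis using f g poly_ring_closed(1) by (auto simp: section_ideal_def)
  qed
  show "- f \<in> section_ideal n I w" if f: "f \<in> section_ideal n I w"
  proof -
    obtain f' where "f' \<in> I" "restr w f = restr w f'" using f by (auto simp: section_ideal_def)
    then have "restr w (- f) = restr w (- f')" "- f' \<in> I"
      by (simp_all add: filter_keys_uminus ideal_uminus[OF I])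
    then show ?thesis using f poly_ring_closed(3) by (auto simp: section_ideal_def)
  qed
  \<comment> \<open>Here \<open>h'\<close> is the evaluation of \<open>h\<close>; for a monomial
    that contains one of the killed variables it is 0.\<close>
  have *: "h * f \<in> section_ideal n I w"
    if f: "f \<in> section_ideal n I w" and h: "h \<in> carrier (poly_ring n)"
      and r: "\<And>g :: 'k mpoly. restr w (h * g) = h' * restr w g" for h h' f
  proof -
    obtain g where "g \<in> I" "restr w f = restr w g" using f by (auto simp: section_ideal_def)
    then have "h * g \<in> I" "restr w (h * f) = restr w (h * g)" using ideal_mult[OF I _ h] r by auto
    moreover have "h * f \<in> carrier (poly_ring n)" using f h poly_ring_closed(2) by (auto simp: section_ideal_def)
    ultimately show ?thesis by (auto simp: section_ideal_def)
  qed
  show "monomial u * f \<in> section_ideal n I w" if "u \<in> mons n" "f \<in> section_ideal n I w"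
  proof (rule *[OF that(2) monomial_closed[OF that(1)]])
    fix g :: "'k mpoly"
    show "restr w (monomial u * g) = (if u \<in> mons w then monomial u else 0) * restr w g"
      by (auto simp: filter_keys_monomial_mult mons_add_iff intro: poly_mapping_eqI)
  qed
  have sc: "restr w (Poly_Mapping.single 0 c * g) = Poly_Mapping.single 0 c * restr w g" for g :: "'k mpoly"
    using lookup_single_mult_add[of 0 c g] lookup_single_mult_add[of 0 c "restr w g"]
    by (intro poly_mapping_eqI) auto
  show "Poly_Mapping.single 0 c * f \<in> section_ideal n I w" if "f \<in> section_ideal n I w"
    by (rule *[OF that _ sc]) (simp add: carrier_poly_ring)
qed

lemma monomial_factor:
  fixes f :: "'k::field mpoly"
  assumes "\<And>v. v \<in> Poly_Mapping.keys f \<Longrightarrow> k \<le> Poly_Mapping.lookup v w"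
  shows "\<exists>g. f = monomial (Poly_Mapping.single w k) * g"
proof
  let ?s = "Poly_Mapping.single w k"
  have inj: "inj ((+) ?s)" by (simp add: inj_def)
  \<comment> \<open>Translating the exponents by \<open>?s\<close> is division by the power of
    \<open>x_w\<close>.\<close>
  show "f = monomial ?s * Poly_Mapping.map_key ((+) ?s) f"
  proof (rule poly_mapping_eqI)
    fix v
    show "Poly_Mapping.lookup f v = Poly_Mapping.lookup (monomial ?s * Poly_Mapping.map_key ((+) ?s) f) v"
    proof (cases "\<exists>q. v = ?s + q")
      case True
      then show ?thesis
        by (auto simp: monomial_def lookup_single_mult_add map_key.rep_eq[OF inj])
    next
      case False
      have "v = ?s + (v - ?s)" if "k \<le> Poly_Mapping.lookup v w"
        by (rule poly_mapping_eqI) (use that in \<open>auto simp: lookup_add lookup_minus lookup_single when_def\<close>)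
      with False assms have "v \<notin> Poly_Mapping.keys f" by blast
      moreover have "v \<notin> Poly_Mapping.keys (monomial ?s * Poly_Mapping.map_key ((+) ?s) f)"
        using False by (auto simp: keys_monomial_mult)
      ultimately show ?thesis by (simp add: in_keys_iff)
    qed
  qed
qed

text \<open>From monomials to forms: in variables up to \<open>x_w\<close>, a power of
  \<open>x_w\<close> dividing the leading monomial of a form divides the whole form, so it can be
  divided out. From forms to monomials: among the torsion forms outside the ideal, one with smallest
  leading monomial cannot be reduced further, so that this monomial is not in in(I).\<close>

lemma colon_section_ideal_iff:
  fixes I :: "'k::field mpoly set"
  assumes I: "homogeneous_ideal n I" and w: "w \<in> {1..n}"
  shows "(\<exists>f\<in>hom_part n r. f \<notin> section_ideal n I w \<and> (\<exists>k. var w ^ k * f \<in> section_ideal n I w)) \<longleftrightarrow>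
    (\<exists>u\<in>mons w. int (mon_deg u) = r \<and> u \<notin> lead_mons n I \<and>
       (\<exists>k. u + Poly_Mapping.single w k \<in> lead_mons n I))"
    (is "?L \<longleftrightarrow> ?R")
proof
  note sid = section_ideal_ideal[OF homogeneous_ideal_ideal[OF I]]
  have wm: "Poly_Mapping.single w k \<in> mons w" "Poly_Mapping.single w k \<in> mons n" for k
    using w by (auto intro!: mons_single)
  have mwn: "mons w \<subseteq> mons n" using w by (intro mons_mono) auto
  {
    assume ?R
    then obtain u k where u: "u \<in> mons w" "int (mon_deg u) = r" "u \<notin> lead_mons n I"
      "u + Poly_Mapping.single w k \<in> lead_mons n I" by blast
    let ?v = "u + Poly_Mapping.single w k"
    have "?v \<in> mons w" using u wm by (simp add: mons_add_iff)
    from lead_mons_section[OF I u(4) this] obtain f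
      where f: "f \<in> section_ideal n I w" "f \<in> hom_part n (int (mon_deg ?v))" "f \<noteq> 0" "restr w f = f" "lead_mon f = ?v"
      by auto
    \<comment> \<open>The first difference from the leading monomial, seen from the last variable,
      is a larger exponent. As \<open>x_w\<close> is the last variable present, its exponent in
      \<open>v\<close> is not smaller than in \<open>?v\<close>.\<close>
    have "k \<le> Poly_Mapping.lookup v w" if v: "v \<in> Poly_Mapping.keys f" for v
    proof (cases "v = ?v")
      case False
      then have dl: "drl_less v ?v" using lead_mon_greatest[OF f(3) v] f(5) by simp
      have "int (mon_deg v) = int (mon_deg ?v)" using f(2) v by (simp add: hom_part_iff)
      then have "mon_deg v = mon_deg ?v" by (simp only: of_nat_eq_iff)
      with dl obtain j where j: "Poly_Mapping.lookup v j > Poly_Mapping.lookup ?v j"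
        "\<forall>l>j. Poly_Mapping.lookup v l = Poly_Mapping.lookup ?v l"
        by (auto simp: drl_less_def)
      have "v \<in> mons w" using v f(4) keys_filter_keys[of "\<lambda>m. m \<in> mons w" f] by auto
      moreover have "j \<in> Poly_Mapping.keys v" using j(1) by (simp add: in_keys_iff)
      ultimately have "j \<le> w" by (auto simp: mons_def)
      then have "Poly_Mapping.lookup ?v w \<le> Poly_Mapping.lookup v w"
        using j by (cases "j = w") auto
      then show ?thesis by (simp add: lookup_add)
    qed (simp add: lookup_add)
    then obtain g where g: "f = monomial (Poly_Mapping.single w k) * g" using monomial_factor by blast
    have kg: "Poly_Mapping.keys f = (+) (Poly_Mapping.single w k) ` Poly_Mapping.keys g"
      by (simp add: g keys_monomial_mult)
    have gnz: "g \<noteq> 0" using g f by auto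
    have lg: "lead_mon g = u"
      using f(5) lead_mon_monomial_mult[OF gnz, of "Poly_Mapping.single w k"] by (simp add: g add.commute)
    have gh: "g \<in> hom_part n r"
      using f(2) u(2) by (auto simp: hom_part_iff kg carrier_poly_ring mons_add_iff mon_deg_add)
    have "Poly_Mapping.keys f \<subseteq> mons w"
      using f(4) keys_filter_keys[of "\<lambda>m. m \<in> mons w" f] by auto
    then have rg: "restr w g = g"
      by (intro filter_keys_id) (auto simp: kg mons_add_iff)
    have "g \<notin> section_ideal n I w"
      using lead_mon_section[OF I _ gh, of w] u(3) lg gnz rg by auto
    moreover have "var w ^ k * g \<in> section_ideal n I w"
      using f(1) by (simp add: g var_power)
    ultimately show ?L using gh by blast
  }
  assume ?L
  \<comment> \<open>Requiring \<open>restr w f = f\<close> keeps the leading monomials among those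
    in \<open>x_1,...,x_w\<close>, where in(I) describes the section.\<close>
  define X where "X = {f \<in> hom_part n r. restr w f = f \<and> f \<notin> section_ideal n I w \<and>
    (\<exists>k. var w ^ k * f \<in> section_ideal n I w)}"
  have X0: "0 \<notin> X" using sid by (simp add: X_def)
  have "\<exists>m\<in>lead_mon ` X. \<forall>u\<in>lead_mon ` X. u \<noteq> m \<longrightarrow> drl_less m u"
  proof (rule finite_total_greatest)
    have "lead_mon ` X \<subseteq> {u \<in> mons n. mon_deg u = nat r}"
    proof
      fix u assume "u \<in> lead_mon ` X"
      then obtain f where f: "f \<in> X" "u = lead_mon f" by auto
      then have "u \<in> Poly_Mapping.keys f" using X0 lead_mon_in_keys[of f] by auto
      with f show "u \<in> {u \<in> mons n. mon_deg u = nat r}" by (auto simp: X_def hom_part_iff carrier_poly_ring)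
    qed
    then show "finite (lead_mon ` X)" using finite_mons_deg by (rule finite_subset)
    obtain f k where f: "f \<in> hom_part n r" "f \<notin> section_ideal n I w" "var w ^ k * f \<in> section_ideal n I w"
      using \<open>?L\<close> by blast
    have "restr w f \<in> X"
      using f hom_part_filter_keys[OF f(1)] unfolding X_def
      by (auto simp: section_ideal_def var_power restr_monomial_mult[OF wm(1)] filter_keys_filter_keys
          hom_part_iff carrier_poly_ring keys_monomial_mult intro!: exI[of _ k])
    then show "lead_mon ` X \<noteq> {}" by auto
    show "\<And>u v w. drl_less v u \<Longrightarrow> drl_less w v \<Longrightarrow> drl_less w u" using drl_trans by blast
    show "\<And>u v. u \<noteq> v \<Longrightarrow> drl_less v u \<or> drl_less u v" using drl_total by blast
  qed
  then obtain f where f: "f \<in> X" and min: "\<And>g. g \<in> X \<Longrightarrow> lead_mon g \<noteq> lead_mon f \<Longrightarrow> drl_less (lead_mon f) (lead_mon g)"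
    by auto
  define u where "u = lead_mon f"
  have fh: "f \<in> hom_part n r" "restr w f = f" "f \<notin> section_ideal n I w" using f by (auto simp: X_def)
  have fnz: "f \<noteq> 0" using f X0 by auto
  have uk: "u \<in> Poly_Mapping.keys f" using lead_mon_in_keys[OF fnz] by (simp add: u_def)
  then have um: "u \<in> mons w" "int (mon_deg u) = r"
    using fh keys_filter_keys[of "\<lambda>m. m \<in> mons w" f] by (auto simp: hom_part_iff)
  obtain k where k: "var w ^ k * f \<in> section_ideal n I w" using f by (auto simp: X_def)
  let ?s = "Poly_Mapping.single w k"
  have "lead_mon (restr w (monomial ?s * f)) \<in> lead_mons n I"
    using k fnz fh(2) hom_part_monomial_mult[OF wm(2) fh(1), of k]
    by (intro lead_mon_section[OF I]) (auto simp: var_power restr_monomial_mult[OF wm(1)])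
  then have "u + ?s \<in> lead_mons n I"
    by (simp add: restr_monomial_mult[OF wm(1)] fh(2) lead_mon_monomial_mult[OF fnz] u_def add.commute)
  moreover have "u \<notin> lead_mons n I"
  proof
    assume "u \<in> lead_mons n I"
    from lead_mons_section[OF I this um(1)] obtain g
      where g: "g \<in> section_ideal n I w" "g \<in> hom_part n r" "g \<noteq> 0" "restr w g = g" "lead_mon g = u"
      using um(2) by auto
    \<comment> \<open>This scalar cancels the leading term of \<open>f\<close>. The difference stays
      in \<open>X\<close> with a strictly smaller leading monomial, against minimality.\<close>
    define c where "c = Poly_Mapping.lookup f u / Poly_Mapping.lookup g u"
    define cg where "cg = Poly_Mapping.single 0 c * g"
    have cgl: "Poly_Mapping.lookup cg v = c * Poly_Mapping.lookup g v" for v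
      using lookup_single_mult_add[of 0 c g v] by (simp add: cg_def)
    have cgs: "cg \<in> section_ideal n I w" unfolding cg_def by (rule sid(5)[OF g(1)])
    have cgk: "Poly_Mapping.keys cg \<subseteq> Poly_Mapping.keys g" by (auto simp: in_keys_iff cgl)
    then have cgh: "cg \<in> hom_part n r" using g(2) by (auto simp: hom_part_iff carrier_poly_ring)
    have "Poly_Mapping.keys g \<subseteq> mons w" using g(4) keys_filter_keys[of "\<lambda>m. m \<in> mons w" g] by auto
    then have cgr: "restr w cg = cg" using cgk by (intro filter_keys_id) auto
    let ?h = "f - cg"
    have diff: "f - cg \<in> section_ideal n I w \<longleftrightarrow> f \<in> section_ideal n I w"
      using sid(2)[of "f - cg" w cg] sid(2)[of f w "- cg"] sid(3)[of cg w] cgs by auto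
    have "var w ^ k * (f - cg) \<in> section_ideal n I w"
      using sid(2)[OF k sid(3)[OF sid(4)[OF wm(2)[of k] cgs]]] by (simp add: right_diff_distrib var_power)
    then have hX: "?h \<in> X"
      using fh cgr hom_part_diff[OF fh(1) cgh] diff by (auto simp: X_def filter_keys_diff)
    then have hnz: "?h \<noteq> 0" using X0 by auto
    have l: "lead_mon ?h \<in> Poly_Mapping.keys ?h" by (rule lead_mon_in_keys[OF hnz])
    have "Poly_Mapping.lookup g u \<noteq> 0" using lead_mon_in_keys[OF g(3)] g(5) by (simp add: in_keys_iff)
    then have "u \<notin> Poly_Mapping.keys ?h" by (simp add: in_keys_iff lookup_minus cgl c_def)
    with l have ne: "lead_mon ?h \<noteq> u" by auto
    have "lead_mon ?h \<in> Poly_Mapping.keys f \<union> Poly_Mapping.keys g"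
      using l by (auto simp: in_keys_iff lookup_minus cgl)
    then have "drl_less (lead_mon ?h) u"
      using lead_mon_greatest[OF fnz, of "lead_mon ?h"] lead_mon_greatest[OF g(3), of "lead_mon ?h"] ne g(5)
      by (auto simp: u_def)
    moreover have "drl_less u (lead_mon ?h)" using min[OF hX] ne by (simp add: u_def)
    ultimately show False using drl_trans drl_irrefl by blast
  qed
  ultimately show ?R using um by blast
qed

text \<open>The point where the monomial side meets cohomology: the supremum of the degrees on the
  left is \<open>c_i\<close>, while those on the right are the degrees of torsion in the
  section.\<close>

lemma c_inv_degree_iff:
  fixes I :: "'k::field mpoly set"
  assumes "homogeneous_ideal n I" "i < n"
  shows "(\<exists>f\<in>J_tilde n I i \<inter> hom_part (n - i) r. f \<notin> J_ideal n I i) \<longleftrightarrow>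
    (\<exists>f\<in>hom_part n r. f \<notin> section_ideal n I (n - i) \<and> (\<exists>k. var (n - i) ^ k * f \<in> section_ideal n I (n - i)))"
  using assms by (subst J_tilde_J_ideal_iff colon_section_ideal_iff; simp)+

section \<open>Cech cohomology as a limit of Koszul cohomology\<close>

lemma poly_ring_nat_pow: "(f :: 'k::field mpoly) [^]\<^bsub>poly_ring n\<^esub> (k::nat) = f ^ k"
  by (induction k) (simp_all add: nat_pow_def mult.commute)

lemma var_closed: "j \<in> {1..n} \<Longrightarrow> var j \<in> carrier (poly_ring n :: 'k::field mpoly ring)"
  unfolding var_def by (intro monomial_closed mons_single)

lemma power_closed: "f \<in> carrier (poly_ring n) \<Longrightarrow> f ^ k \<in> carrier (poly_ring n :: 'k::field mpoly ring)"
  by (induction k) (auto intro: poly_ring_closed)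

lemma prod_var_closed: "F \<subseteq> {1..n} \<Longrightarrow> prod var F \<in> carrier (poly_ring n :: 'k::field mpoly ring)"
  by (induction F rule: infinite_finite_induct) (auto intro!: poly_ring_closed var_closed)

lemma sum_closed: "(\<And>j. j \<in> A \<Longrightarrow> f j \<in> carrier (poly_ring n)) \<Longrightarrow> sum f A \<in> carrier (poly_ring n :: 'k::field mpoly ring)"
  by (induction A rule: infinite_finite_induct) (auto intro!: poly_ring_closed)

lemma koszul_sign_cases: "koszul_sign G j = (1 :: 'a::comm_ring_1) \<or> koszul_sign G j = (- 1 :: 'a)"
  by (simp add: koszul_sign_def)

lemma koszul_diff_closed:
  assumes "G \<in> faces n (Suc p)" "\<And>F. F \<in> faces n p \<Longrightarrow> m F \<in> carrier (poly_ring n)"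
  shows "koszul_diff var a m G \<in> carrier (poly_ring n :: 'k::field mpoly ring)"
  unfolding koszul_diff_def
proof (intro sum_closed poly_ring_closed power_closed var_closed)
  fix j assume j: "j \<in> G"
  show "koszul_sign G j \<in> carrier (poly_ring n :: 'k mpoly ring)"
    using koszul_sign_cases[of G j, where 'a = "'k mpoly"]
      poly_ring_closed(5)[of n, where 'k = 'k] poly_ring_closed(3)[OF poly_ring_closed(5), of n, where 'k = 'k] by auto
  show "j \<in> {1..n}" using j assms(1) by (auto simp: faces_def)
  show "m (G - {j}) \<in> carrier (poly_ring n)" by (intro assms(2) faces_remove[OF assms(1) j])
qed

lemma face_prod_eq:
  assumes "F \<subseteq> {1..n}"
  shows "face_prod (poly_ring n :: 'k::field mpoly ring) var F = prod var F"
proof -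
  interpret cring "poly_ring n :: 'k mpoly ring" by (rule cring_poly_ring)
  have "finite F" using assms by (rule finite_subset) simp
  then show ?thesis unfolding face_prod_def using assms
  proof (induction F rule: finite_induct)
    case empty
    show ?case by (simp only: finprod_empty poly_ring_ops prod.empty)
  next
    case (insert j F)
    have "finprod (poly_ring n :: 'k mpoly ring) var (insert j F) = var j \<otimes>\<^bsub>poly_ring n\<^esub> finprod (poly_ring n) var F"
    proof (rule finprod_insert)
      have "\<And>i. i \<in> insert j F \<Longrightarrow> var i \<in> carrier (poly_ring n :: 'k mpoly ring)"
        using insert.prems by (intro var_closed) blast
      then show "var \<in> F \<rightarrow> carrier (poly_ring n :: 'k mpoly ring)"
        "var j \<in> carrier (poly_ring n :: 'k mpoly ring)" by auto
    qed (use insert in auto)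
    moreover have "finprod (poly_ring n :: 'k mpoly ring) var F = prod var F" using insert by blast
    ultimately show ?case by (simp only: poly_ring_ops prod.insert[OF insert(1,2)])
  qed
qed

locale cech_quotient =
  fixes n :: nat and I :: "'k::field mpoly set"
  assumes I: "homogeneous_ideal n I"
begin

abbreviation R where "R \<equiv> poly_ring n :: 'k mpoly ring"
abbreviation M where "M \<equiv> quot_module R I"

lemma Iideal: "ideal I R"
  by (rule homogeneous_ideal_ideal[OF I])

sublocale graded_ideal var n "hom_part n" I
proof
  fix f g :: "'k mpoly" and j :: nat
  show "0 \<in> I" "f \<in> I \<Longrightarrow> g \<in> I \<Longrightarrow> f + g \<in> I" "f \<in> I \<Longrightarrow> - f \<in> I"
    using ideal_zero[OF Iideal] ideal_add[OF Iideal] ideal_uminus[OF Iideal] by auto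
  show "j \<in> {1..n} \<Longrightarrow> f \<in> I \<Longrightarrow> var j * f \<in> I"
    by (rule ideal_mult[OF Iideal _ var_closed])
  fix r
  show "j \<in> {1..n} \<Longrightarrow> f \<in> hom_part n r \<Longrightarrow> var j * f \<in> hom_part n (r + 1)"
    using hom_part_monomial_mult[OF mons_single[of j n 1], of f r] by (simp add: var_def)
qed (auto intro: hom_part_add hom_part_uminus)

section \<open>The module S/I by representatives\<close>

definition coset :: "'k mpoly \<Rightarrow> 'k mpoly set"
  where "coset f = I +>\<^bsub>R\<^esub> f"

lemma coset_mem: "g \<in> coset f \<longleftrightarrow> g - f \<in> I"
  unfolding coset_def a_r_coset_def' by (auto simp: algebra_simps) (metis add_diff_cancel_left' diff_add_cancel)

lemma coset_eq_iff: "coset f = coset g \<longleftrightarrow> f - g \<in> I"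
proof
  assume "coset f = coset g"
  moreover have "f \<in> coset f" by (simp add: coset_mem I_zero)
  ultimately show "f - g \<in> I" by (simp add: coset_mem)
next
  assume d: "f - g \<in> I"
  have "h - f \<in> I \<longleftrightarrow> h - g \<in> I" for h
    using I_add[OF _ d, of "h - f"] I_diff[OF _ d, of "h - g"] by auto
  then show "coset f = coset g" by (auto simp: coset_mem)
qed

lemma quot_carrier: "carrier M = coset ` carrier R"
  by (auto simp: quot_module_def FactRing_def A_RCOSETS_def' coset_def)

lemma quot_add:
  assumes "f \<in> carrier R" "g \<in> carrier R"
  shows "coset f \<oplus>\<^bsub>M\<^esub> coset g = coset (f + g)"
proof -
  interpret ideal I R by (rule Iideal)
  show ?thesis using a_rcos_sum[OF assms] by (simp add: quot_module_def FactRing_def coset_def)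
qed

lemma quot_zero: "\<zero>\<^bsub>M\<^esub> = coset 0"
  by (auto simp: quot_module_def FactRing_def coset_mem)

lemma quot_smult:
  assumes "c \<in> carrier R"
  shows "c \<odot>\<^bsub>M\<^esub> coset f = coset (c * f)"
proof -
  have "coset (c * y) = coset (c * f)" if "y \<in> coset f" for y
    using ideal_mult[OF Iideal _ assms, of "y - f"] that by (simp add: coset_eq_iff coset_mem right_diff_distrib)
  then have "(\<Union>y\<in>coset f. coset (c * y)) = (\<Union>y\<in>coset f. coset (c * f))" by (intro SUP_cong) auto
  also have "\<dots> = coset (c * f)" using coset_mem[of f f] I_zero by auto
  finally show ?thesis by (simp add: quot_module_def coset_def[symmetric])
qed

section \<open>Fractions whose denominators are powers of a face product\<close>

lemma face_subset: "F \<in> faces n p \<Longrightarrow> F \<subseteq> {1..n}"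
  by (simp add: faces_def)

text \<open>Equality of the fractions \<open>f / x_F^a\<close> and \<open>g / x_F^b\<close> over
  S/I, expressed by representatives in S.\<close>

definition frac_equiv :: "nat set \<Rightarrow> 'k mpoly \<Rightarrow> nat \<Rightarrow> 'k mpoly \<Rightarrow> nat \<Rightarrow> bool"
  where "frac_equiv F f a g b \<longleftrightarrow> (\<exists>l. prod var F ^ (l + b) * f - prod var F ^ (l + a) * g \<in> I)"

definition cfrac :: "nat set \<Rightarrow> 'k mpoly \<Rightarrow> nat \<Rightarrow> ('k mpoly set \<times> nat) set"
  where "cfrac F f a = fraction R M (face_prod R var F) (coset f) a"

lemma prod_var_mult: "F \<subseteq> {1..n} \<Longrightarrow> f \<in> I \<Longrightarrow> prod var F ^ k * f \<in> I"
  by (intro ideal_mult[OF Iideal] power_closed prod_var_closed)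

text \<open>Monotonicity in \<open>l\<close> is what allows one exponent to serve all faces at
  once.\<close>

lemma frac_equiv_mono:
  assumes "F \<subseteq> {1..n}" "prod var F ^ (l + b) * f - prod var F ^ (l + a) * g \<in> I" "l \<le> l'"
  shows "prod var F ^ (l' + b) * f - prod var F ^ (l' + a) * g \<in> I"
proof -
  obtain k where "l' = l + k" using assms(3) le_Suc_ex by blast
  then show ?thesis
    using prod_var_mult[OF assms(1,2), of k] by (simp add: algebra_simps power_add)
qed

lemma frac_equiv_refl: "frac_equiv F f a f a"
  by (simp add: frac_equiv_def I_zero)

lemma frac_equiv_sym: "frac_equiv F f a g b \<Longrightarrow> frac_equiv F g b f a"
  unfolding frac_equiv_def using I_uminus by (metis minus_diff_eq)

lemma frac_equiv_trans:
  assumes F: "F \<subseteq> {1..n}" and "frac_equiv F f a g b" "frac_equiv F g b h c"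
  shows "frac_equiv F f a h c"
proof -
  let ?P = "prod var F :: 'k mpoly"
  obtain l l' where "?P ^ (l + b) * f - ?P ^ (l + a) * g \<in> I" "?P ^ (l' + c) * g - ?P ^ (l' + b) * h \<in> I"
    using assms by (auto simp: frac_equiv_def)
  from I_add[OF prod_var_mult[OF F this(1), of "l' + c"] prod_var_mult[OF F this(2), of "l + a"]]
  have "?P ^ (l + l' + b + c) * f - ?P ^ (l + l' + b + a) * h \<in> I"
    by (simp add: algebra_simps power_add)
  then show ?thesis unfolding frac_equiv_def by blast
qed

lemma frac_mem:
  assumes "F \<subseteq> {1..n}"
  shows "(X, b) \<in> cfrac F f a \<longleftrightarrow> (\<exists>g\<in>carrier R. X = coset g \<and> frac_equiv F f a g b)"
proof -
  have pc: "prod var F ^ k \<in> carrier R" for k by (intro power_closed prod_var_closed assms)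
  have eq: "prod var F ^ i \<odot>\<^bsub>M\<^esub> coset f = prod var F ^ j \<odot>\<^bsub>M\<^esub> coset g \<longleftrightarrow>
    prod var F ^ i * f - prod var F ^ j * g \<in> I" for i j g
    by (simp add: quot_smult[OF pc] coset_eq_iff)
  show ?thesis
    unfolding cfrac_def fraction_def frac_equiv_def face_prod_eq[OF assms] poly_ring_nat_pow
    by (auto simp: quot_carrier eq) blast
qed

lemma frac_eq_iff:
  assumes F: "F \<subseteq> {1..n}" and g: "g \<in> carrier R"
  shows "cfrac F f a = cfrac F g b \<longleftrightarrow> frac_equiv F f a g b"
proof
  assume "cfrac F f a = cfrac F g b"
  moreover have "(coset g, b) \<in> cfrac F g b" using g frac_equiv_refl by (auto simp: frac_mem[OF F])
  ultimately obtain g' where g': "coset g = coset g'" "frac_equiv F f a g' b"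
    by (metis frac_mem[OF F])
  have "frac_equiv F g' b g b"
    using prod_var_mult[OF F, of "g' - g" b] g'(1) I_uminus[of "g - g'"]
    by (auto simp: frac_equiv_def coset_eq_iff right_diff_distrib intro!: exI[of _ 0])
  then show "frac_equiv F f a g b" using frac_equiv_trans[OF F g'(2)] by blast
next
  assume "frac_equiv F f a g b"
  then have "frac_equiv F f a h c \<longleftrightarrow> frac_equiv F g b h c" for h c
    using frac_equiv_trans[OF F] frac_equiv_sym by blast
  then show "cfrac F f a = cfrac F g b" by (auto simp: frac_mem[OF F])
qed

lemma frac_expand:
  assumes F: "F \<subseteq> {1..n}" and f: "f \<in> carrier R"
  shows "cfrac F f a = cfrac F (prod var F ^ k * f) (a + k)"
proof -
  have "prod var F ^ k * f \<in> carrier R" by (intro poly_ring_closed power_closed prod_var_closed F f)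
  moreover have "prod var F ^ (0 + (a + k)) * f - prod var F ^ (0 + a) * (prod var F ^ k * f) = 0"
    by (simp add: power_add)
  then have "frac_equiv F f a (prod var F ^ k * f) (a + k)"
    unfolding frac_equiv_def using I_zero by metis
  ultimately show ?thesis using frac_eq_iff[OF F] by blast
qed

text \<open>The operations on a localization are unions over all representatives of a class. Such a
  union collapses as soon as its value is the same for every representative.\<close>

lemma frac_Union:
  assumes F: "F \<subseteq> {1..n}" and f: "f \<in> carrier R"
    and "\<And>g b. g \<in> carrier R \<Longrightarrow> frac_equiv F f a g b \<Longrightarrow> \<Phi> (coset g) b = C"
  shows "(\<Union>(m, b)\<in>cfrac F f a. \<Phi> m b) = C"
proof -
  have "\<Phi> m b = C" if "(m, b) \<in> cfrac F f a" for m b using that assms(3) by (auto simp: frac_mem[OF F])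
  moreover have "(coset f, a) \<in> cfrac F f a" using f frac_equiv_refl by (auto simp: frac_mem[OF F])
  ultimately show ?thesis by fastforce
qed

section \<open>The localizations as abelian groups\<close>

abbreviation L where "L F \<equiv> cech_loc R M var F"

lemma L_carrier: "carrier (L F) = {cfrac F f a | f a. f \<in> carrier R}"
  by (auto simp: cech_loc_def localization_def cfrac_def quot_carrier)

lemma L_zero: "\<zero>\<^bsub>L F\<^esub> = cfrac F 0 0"
  by (simp add: cech_loc_def localization_def cfrac_def quot_zero)

lemma L_add:
  assumes F: "F \<subseteq> {1..n}" and f: "f \<in> carrier R" "f' \<in> carrier R"
  shows "cfrac F f a \<oplus>\<^bsub>L F\<^esub> cfrac F f' a = cfrac F (f + f') a"
proof -
  let ?P = "prod var F :: 'k mpoly"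
  have pc: "?P ^ k \<in> carrier R" for k by (intro power_closed prod_var_closed F)
  have "cfrac F f a \<oplus>\<^bsub>L F\<^esub> cfrac F f' a = (\<Union>(m, b)\<in>cfrac F f a. \<Union>(m', b')\<in>cfrac F f' a.
        fraction R M ?P ((?P ^ b') \<odot>\<^bsub>M\<^esub> m \<oplus>\<^bsub>M\<^esub> (?P ^ b) \<odot>\<^bsub>M\<^esub> m') (b + b'))"
    by (simp add: cech_loc_def localization_def face_prod_eq[OF F] poly_ring_nat_pow)
  also have "\<dots> = cfrac F (f + f') a"
  proof (intro frac_Union F f)
    fix g b g' b' assume g: "g \<in> carrier R" "frac_equiv F f a g b" "g' \<in> carrier R" "frac_equiv F f' a g' b'"
    have c: "?P ^ b' * g \<in> carrier R" "?P ^ b * g' \<in> carrier R" "?P ^ b' * g + ?P ^ b * g' \<in> carrier R" "f + f' \<in> carrier R"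
      using g f pc by (auto intro!: poly_ring_closed)
    have "fraction R M ?P ((?P ^ b') \<odot>\<^bsub>M\<^esub> coset g \<oplus>\<^bsub>M\<^esub> (?P ^ b) \<odot>\<^bsub>M\<^esub> coset g') (b + b')
      = cfrac F (?P ^ b' * g + ?P ^ b * g') (b + b')"
      using c by (simp add: quot_smult[OF pc] quot_add cfrac_def face_prod_eq[OF F])
    also have "\<dots> = cfrac F (f + f') a"
    proof -
      obtain l l' where "?P ^ (l + b) * f - ?P ^ (l + a) * g \<in> I" "?P ^ (l' + b') * f' - ?P ^ (l' + a) * g' \<in> I"
        using g by (auto simp: frac_equiv_def)
      from I_add[OF prod_var_mult[OF F this(1), of "l' + b'"] prod_var_mult[OF F this(2), of "l + b"]]
      have "?P ^ (l + l' + (b + b')) * (f + f') - ?P ^ (l + l' + a) * (?P ^ b' * g + ?P ^ b * g') \<in> I"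
        by (simp add: algebra_simps power_add)
      then have "frac_equiv F (f + f') a (?P ^ b' * g + ?P ^ b * g') (b + b')"
        unfolding frac_equiv_def by blast
      then show ?thesis using frac_eq_iff[OF F] c by (metis frac_equiv_sym)
    qed
    finally show "fraction R M ?P ((?P ^ b') \<odot>\<^bsub>M\<^esub> coset g \<oplus>\<^bsub>M\<^esub> (?P ^ b) \<odot>\<^bsub>M\<^esub> coset g') (b + b') = cfrac F (f + f') a" .
  qed
  finally show ?thesis .
qed

lemma frac_zero: "F \<subseteq> {1..n} \<Longrightarrow> cfrac F 0 0 = cfrac F 0 a"
  using frac_expand[of F 0 0 a] poly_ring_closed(4)[of n, where 'k = 'k] by simp

text \<open>With a common denominator the group laws reduce to those of the numerators; three
  elements are what associativity needs.\<close>

lemma L_common: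
  assumes F: "F \<subseteq> {1..n}" and "x \<in> carrier (L F)" "y \<in> carrier (L F)" "z \<in> carrier (L F)"
  obtains f g h a where "f \<in> carrier R" "g \<in> carrier R" "h \<in> carrier R"
    "x = cfrac F f a" "y = cfrac F g a" "z = cfrac F h a"
proof -
  obtain f a g b h c where *: "f \<in> carrier R" "g \<in> carrier R" "h \<in> carrier R"
    "x = cfrac F f a" "y = cfrac F g b" "z = cfrac F h c"
    using assms by (auto simp: L_carrier)
  have "x = cfrac F (prod var F ^ (b + c) * f) (a + b + c)" "y = cfrac F (prod var F ^ (a + c) * g) (a + b + c)"
    "z = cfrac F (prod var F ^ (a + b) * h) (a + b + c)"
    using frac_expand[OF F *(1), of a "b + c"] frac_expand[OF F *(2), of b "a + c"] frac_expand[OF F *(3), of c "a + b"] *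
    by (simp_all add: ac_simps)
  then show ?thesis by (rule that[rotated 3]) (intro poly_ring_closed power_closed prod_var_closed F *)+
qed

lemma L_abelian_group:
  assumes F: "F \<subseteq> {1..n}"
  shows "abelian_group (L F)"
proof (rule abelian_groupI)
  fix x y z assume xyz: "x \<in> carrier (L F)" "y \<in> carrier (L F)" "z \<in> carrier (L F)"
  obtain f g h a where *: "f \<in> carrier R" "g \<in> carrier R" "h \<in> carrier R"
    "x = cfrac F f a" "y = cfrac F g a" "z = cfrac F h a"
    by (rule L_common[OF F xyz])
  show "x \<oplus>\<^bsub>L F\<^esub> y \<oplus>\<^bsub>L F\<^esub> z = x \<oplus>\<^bsub>L F\<^esub> (y \<oplus>\<^bsub>L F\<^esub> z)"
    using * by (simp add: L_add[OF F] poly_ring_closed add.assoc)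
next
  fix x y assume xy: "x \<in> carrier (L F)" "y \<in> carrier (L F)"
  obtain f g h a where *: "f \<in> carrier R" "g \<in> carrier R" 
    "x = cfrac F f a" "y = cfrac F g a"
    by (rule L_common[OF F xy xy(2)])
  show "x \<oplus>\<^bsub>L F\<^esub> y \<in> carrier (L F)" using * by (auto simp: L_add[OF F] L_carrier intro: poly_ring_closed)
  show "x \<oplus>\<^bsub>L F\<^esub> y = y \<oplus>\<^bsub>L F\<^esub> x" using * by (simp add: L_add[OF F] add.commute)
next
  show "\<zero>\<^bsub>L F\<^esub> \<in> carrier (L F)" unfolding L_zero L_carrier using poly_ring_closed(4) by blast
next
  fix x assume "x \<in> carrier (L F)"
  then obtain f a where *: "f \<in> carrier R" "x = cfrac F f a" by (auto simp: L_carrier)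
  show "\<zero>\<^bsub>L F\<^esub> \<oplus>\<^bsub>L F\<^esub> x = x"
    using * by (simp add: L_zero frac_zero[OF F, of a] L_add[OF F] poly_ring_closed)
  show "\<exists>y\<in>carrier (L F). y \<oplus>\<^bsub>L F\<^esub> x = \<zero>\<^bsub>L F\<^esub>"
  proof
    show "cfrac F (- f) a \<in> carrier (L F)" unfolding L_carrier using poly_ring_closed(3)[OF *(1)] by blast
    show "cfrac F (- f) a \<oplus>\<^bsub>L F\<^esub> x = \<zero>\<^bsub>L F\<^esub>"
      using * by (simp add: L_zero frac_zero[OF F, of a] L_add[OF F] poly_ring_closed)
  qed
qed

lemma L_uminus:
  assumes F: "F \<subseteq> {1..n}" and f: "f \<in> carrier R"
  shows "\<ominus>\<^bsub>L F\<^esub> cfrac F f a = cfrac F (- f) a"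
proof (rule abelian_group.minus_equality[OF L_abelian_group[OF F]])
  show "cfrac F (- f) a \<oplus>\<^bsub>L F\<^esub> cfrac F f a = \<zero>\<^bsub>L F\<^esub>"
    using f by (simp add: L_zero frac_zero[OF F, of a] L_add[OF F] poly_ring_closed)
qed (use f in \<open>auto simp: L_carrier intro: poly_ring_closed\<close>)

lemma L_finsum:
  assumes F: "F \<subseteq> {1..n}" and "finite A" "\<And>j. j \<in> A \<Longrightarrow> f j \<in> carrier R"
  shows "finsum (L F) (\<lambda>j. cfrac F (f j) a) A = cfrac F (\<Sum>j\<in>A. f j) a"
proof -
  interpret abelian_group "L F" by (rule L_abelian_group[OF F])
  show ?thesis using assms(2,3)
  proof (induction A rule: finite_induct)
    case empty
    show ?case using frac_zero[OF F, of a] by (simp only: finsum_empty L_zero sum.empty)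
  next
    case (insert i A)
    have "finsum (L F) (\<lambda>j. cfrac F (f j) a) (insert i A)
      = cfrac F (f i) a \<oplus>\<^bsub>L F\<^esub> finsum (L F) (\<lambda>j. cfrac F (f j) a) A"
      by (rule finsum_insert) (use insert in \<open>auto simp: L_carrier\<close>)
    also have "\<dots> = cfrac F (f i) a \<oplus>\<^bsub>L F\<^esub> cfrac F (\<Sum>j\<in>A. f j) a"
      using insert by simp
    also have "\<dots> = cfrac F (\<Sum>j\<in>insert i A. f j) a"
      using insert by (simp add: L_add[OF F] sum_closed)
    finally show ?case .
  qed
qed

lemma cech_res_frac:
  assumes G: "G \<subseteq> {1..n}" and j: "j \<in> G" and f: "f \<in> carrier R"
  shows "cech_res R M var G j (cfrac (G - {j}) f a) = cfrac G (var j ^ a * f) a"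
proof -
  have G': "G - {j} \<subseteq> {1..n}" using G by auto
  have vc: "var j ^ k \<in> carrier R" for k using G j by (intro power_closed var_closed) auto
  have "finite G" using G by (rule finite_subset) simp
  then have P: "prod var G = var j * (prod var (G - {j}) :: 'k mpoly)" using j by (simp add: prod.remove)
  show ?thesis unfolding cech_res_def face_prod_eq[OF G] poly_ring_nat_pow
  proof (rule frac_Union[OF G' f])
    fix g b assume g: "g \<in> carrier R" "frac_equiv (G - {j}) f a g b"
    have c: "var j ^ b * g \<in> carrier R" "var j ^ a * f \<in> carrier R" using g f vc by (auto intro: poly_ring_closed)
    obtain l where l: "prod var (G - {j}) ^ (l + b) * f - prod var (G - {j}) ^ (l + a) * g \<in> I"
      using g by (auto simp: frac_equiv_def)
    \<comment> \<open>Since \<open>x_G\<close> is \<open>x_j\<close> times the product over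
      \<open>G - {j}\<close>, the relation over \<open>G\<close> is a power of \<open>x_j\<close>
      times the given one.\<close>
    have "prod var G ^ (l + b) * (var j ^ a * f) - prod var G ^ (l + a) * (var j ^ b * g) =
      var j ^ (l + a + b) * (prod var (G - {j}) ^ (l + b) * f - prod var (G - {j}) ^ (l + a) * g)"
      by (simp add: P power_mult_distrib algebra_simps power_add)
    also have "\<dots> \<in> I" by (rule ideal_mult[OF Iideal l vc])
    finally have "frac_equiv G (var j ^ a * f) a (var j ^ b * g) b" unfolding frac_equiv_def by blast
    then have "cfrac G (var j ^ b * g) b = cfrac G (var j ^ a * f) a" using frac_eq_iff[OF G c(1)] by blast
    then show "fraction R M (prod var G) ((var j ^ b) \<odot>\<^bsub>M\<^esub> coset g) b = cfrac G (var j ^ a * f) a"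
      by (simp add: quot_smult[OF vc] cfrac_def face_prod_eq[OF G])
  qed
qed


section \<open>Cochains with a common denominator\<close>

lemma finite_faces: "finite (faces n p)"
  by (rule finite_subset[of _ "Pow {1..n}"]) (auto simp: faces_def)

text \<open>There are finitely many faces and the property is upward closed, so the sum of the
  individual exponents works everywhere.\<close>

lemma faces_uniform:
  assumes "\<And>F. F \<in> faces n p \<Longrightarrow> \<exists>l. Q F l" and "\<And>F l l'. F \<in> faces n p \<Longrightarrow> Q F l \<Longrightarrow> l \<le> l' \<Longrightarrow> Q F l'"
  shows "\<exists>l::nat. \<forall>F\<in>faces n p. Q F l"
proof -
  obtain l where l: "\<And>F. F \<in> faces n p \<Longrightarrow> Q F (l F)" using assms(1) by metis
  have "Q F (\<Sum>F\<in>faces n p. l F)" if "F \<in> faces n p" for F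
    using assms(2)[OF that l[OF that]] member_le_sum[OF that _ finite_faces, of l] by simp
  then show ?thesis by blast
qed

text \<open>The map from the Koszul cochains of exponent \<open>a\<close> to the Cech cochains,
  which form their direct limit.\<close>

definition cochain :: "nat \<Rightarrow> (nat set \<Rightarrow> 'k mpoly) \<Rightarrow> nat \<Rightarrow> nat set \<Rightarrow> ('k mpoly set \<times> nat) set"
  where "cochain p m a = (\<lambda>F\<in>faces n p. cfrac F (m F) a)"

abbreviation C where "C p \<equiv> cech_group R M var n p"

lemma cochain_closed: "(\<And>F. F \<in> faces n p \<Longrightarrow> m F \<in> carrier R) \<Longrightarrow> cochain p m a \<in> carrier (C p)"
  by (auto simp: cech_group_def cochain_def L_carrier)

lemma cochain_expand:
  assumes "\<And>F. F \<in> faces n p \<Longrightarrow> m F \<in> carrier R"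
  shows "cochain p m a = cochain p (\<lambda>F. prod var F ^ k * m F) (a + k)"
  unfolding cochain_def using assms by (intro restrict_ext frac_expand face_subset)

lemma cochain_cong: "(\<And>F. F \<in> faces n p \<Longrightarrow> m F = m' F) \<Longrightarrow> cochain p m a = cochain p m' a"
  by (auto simp: cochain_def intro!: restrict_ext)

text \<open>Equality in the direct limit: the numerators agree modulo \<open>I\<close> after
  transition maps into a common stage. \<open>faces_uniform\<close> makes the stage independent of
  the face.\<close>

lemma cochain_eq_iff:
  assumes "\<And>F. F \<in> faces n p \<Longrightarrow> m' F \<in> carrier R"
  shows "cochain p m a = cochain p m' b \<longleftrightarrow>
    (\<exists>l. \<forall>F\<in>faces n p. prod var F ^ (l + b) * m F - prod var F ^ (l + a) * m' F \<in> I)"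
proof -
  have "cochain p m a = cochain p m' b \<longleftrightarrow> (\<forall>F\<in>faces n p. cfrac F (m F) a = cfrac F (m' F) b)"
  proof
    assume eq: "cochain p m a = cochain p m' b"
    show "\<forall>F\<in>faces n p. cfrac F (m F) a = cfrac F (m' F) b"
    proof
      fix F assume F: "F \<in> faces n p"
      have "cochain p m a F = cochain p m' b F" by (simp only: eq)
      then show "cfrac F (m F) a = cfrac F (m' F) b" using F by (simp add: cochain_def)
    qed
  next
    assume "\<forall>F\<in>faces n p. cfrac F (m F) a = cfrac F (m' F) b"
    then show "cochain p m a = cochain p m' b" unfolding cochain_def by (intro restrict_ext) blast
  qed
  also have "\<dots> \<longleftrightarrow> (\<forall>F\<in>faces n p. frac_equiv F (m F) a (m' F) b)"
    by (intro ball_cong refl frac_eq_iff face_subset assms)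
  also have "\<dots> \<longleftrightarrow> (\<exists>l. \<forall>F\<in>faces n p. prod var F ^ (l + b) * m F - prod var F ^ (l + a) * m' F \<in> I)"
    unfolding frac_equiv_def
    using faces_uniform[of p "\<lambda>F l. prod var F ^ (l + b) * m F - prod var F ^ (l + a) * m' F \<in> I"]
      frac_equiv_mono face_subset by blast
  finally show ?thesis .
qed

lemma cech_group_zero: "\<one>\<^bsub>C p\<^esub> = cochain p (\<lambda>_. 0) a"
  by (simp add: cech_group_def cochain_def L_zero) (intro restrict_ext frac_zero face_subset)

lemma cech_group_mult:
  assumes "\<And>F. F \<in> faces n p \<Longrightarrow> m F \<in> carrier R" "\<And>F. F \<in> faces n p \<Longrightarrow> m' F \<in> carrier R"
  shows "cochain p m a \<otimes>\<^bsub>C p\<^esub> cochain p m' a = cochain p (\<lambda>F. m F + m' F) a"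
  by (simp only: cech_group_def cochain_def mult_product_group)
    (rule restrict_ext, simp, metis L_add assms face_subset)

text \<open>A common denominator, with numerators kept in a family \<open>Q\<close> of sets stable under expanding fractions.\<close>

lemma cochain_repr:
  assumes "f \<in> extensional (faces n p)"
    and "\<And>F. F \<in> faces n p \<Longrightarrow> \<exists>m a. m \<in> Q F a \<and> f F = cfrac F m a"
    and Q: "\<And>F a k m. F \<in> faces n p \<Longrightarrow> m \<in> Q F a \<Longrightarrow> m \<in> carrier R \<and> prod var F ^ k * m \<in> Q F (a + k)"
  shows "\<exists>m a. (\<forall>F\<in>faces n p. m F \<in> Q F a) \<and> f = cochain p m a"
proof -
  have "\<exists>a. \<forall>F\<in>faces n p. \<exists>m. m \<in> Q F a \<and> f F = cfrac F m a"
  proof (rule faces_uniform)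
    fix F a a' assume F: "F \<in> faces n p" and m: "\<exists>m. m \<in> Q F a \<and> f F = cfrac F m a" and "a \<le> a'"
    from m obtain m where m: "m \<in> Q F a" "f F = cfrac F m a" by blast
    obtain k where k: "a' = a + k" using \<open>a \<le> a'\<close> le_Suc_ex by blast
    have "f F = cfrac F (prod var F ^ k * m) (a + k)"
      using frac_expand[OF face_subset[OF F]] Q[OF F m(1)] m(2) by simp
    then show "\<exists>m. m \<in> Q F a' \<and> f F = cfrac F m a'" using Q[OF F m(1), of k] k by blast
  qed (use assms(2) in blast)
  then obtain a m where "\<And>F. F \<in> faces n p \<Longrightarrow> m F \<in> Q F a \<and> f F = cfrac F (m F) a" by metis
  then have m: "\<forall>F\<in>faces n p. m F \<in> Q F a" "\<And>F. F \<in> faces n p \<Longrightarrow> f F = cfrac F (m F) a" by auto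
  have "f = cochain p m a"
    by (rule extensionalityI[OF assms(1)]) (simp_all add: cochain_def m(2))
  with m(1) show ?thesis by blast
qed

lemma cech_group_repr:
  assumes "f \<in> carrier (C p)"
  shows "\<exists>m a. (\<forall>F\<in>faces n p. m F \<in> carrier R) \<and> f = cochain p m a"
proof (rule cochain_repr)
  show "f \<in> extensional (faces n p)" using assms by (auto simp: cech_group_def PiE_def)
  show "\<exists>m a. m \<in> carrier R \<and> f F = cfrac F m a" if "F \<in> faces n p" for F
  proof -
    have "f F \<in> carrier (L F)" using assms that by (auto simp: cech_group_def)
    then show ?thesis by (auto simp: L_carrier)
  qed
qed (auto intro!: poly_ring_closed power_closed prod_var_closed face_subset)

text \<open>Restricting from \<open>G - {j}\<close> to \<open>G\<close> multiplies the numerator by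
  \<open>x_j^a\<close> and keeps the exponent \<open>a\<close> of the denominator, which is the
  Koszul differential on numerators.\<close>

lemma cech_diff_cochain:
  assumes m: "\<And>F. F \<in> faces n p \<Longrightarrow> m F \<in> carrier R"
  shows "cech_diff R M var n p (cochain p m a) = cochain (Suc p) (koszul_diff var a m) a"
proof -
  have "finsum (L G) (\<lambda>j. if even (card {l \<in> G. l < j})
           then cech_res R M var G j (cochain p m a (G - {j}))
           else \<ominus>\<^bsub>L G\<^esub> cech_res R M var G j (cochain p m a (G - {j}))) G
      = cfrac G (koszul_diff var a m G) a" if G: "G \<in> faces n (Suc p)" for G
  proof -
    interpret abelian_group "L G" by (rule L_abelian_group[OF face_subset[OF G]])
    have c: "koszul_sign G j * var j ^ a * m (G - {j}) \<in> carrier R" "var j ^ a * m (G - {j}) \<in> carrier R" if "j \<in> G" for j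
    proof -
      have "j \<in> {1..n}" using that face_subset[OF G] by auto
      then show "var j ^ a * m (G - {j}) \<in> carrier R"
        by (intro poly_ring_closed power_closed var_closed m faces_remove[OF G that])
      then show "koszul_sign G j * var j ^ a * m (G - {j}) \<in> carrier R"
        using koszul_sign_cases[of G j, where 'a = "'k mpoly"] poly_ring_closed(3) by auto
    qed
    have "finsum (L G) (\<lambda>j. if even (card {l \<in> G. l < j})
           then cech_res R M var G j (cochain p m a (G - {j}))
           else \<ominus>\<^bsub>L G\<^esub> cech_res R M var G j (cochain p m a (G - {j}))) G
      = finsum (L G) (\<lambda>j. cfrac G (koszul_sign G j * var j ^ a * m (G - {j})) a) G"
    proof (rule finsum_cong')
      show "(\<lambda>j. cfrac G (koszul_sign G j * var j ^ a * m (G - {j})) a) \<in> G \<rightarrow> carrier (L G)"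
        using c(1) by (auto simp: L_carrier)
      fix j assume j: "j \<in> G"
      have "cech_res R M var G j (cochain p m a (G - {j})) = cfrac G (var j ^ a * m (G - {j})) a"
        using cech_res_frac[OF face_subset[OF G] j m[OF faces_remove[OF G j]]] faces_remove[OF G j]
        by (simp add: cochain_def)
      then show "(if even (card {l \<in> G. l < j})
           then cech_res R M var G j (cochain p m a (G - {j}))
           else \<ominus>\<^bsub>L G\<^esub> cech_res R M var G j (cochain p m a (G - {j})))
        = cfrac G (koszul_sign G j * var j ^ a * m (G - {j})) a"
        using L_uminus[OF face_subset[OF G] c(2)[OF j], of a] by (simp add: koszul_sign_def)
    qed simp
    also have "\<dots> = cfrac G (koszul_diff var a m G) a"
      unfolding koszul_diff_def by (rule L_finsum[OF face_subset[OF G] faces_finite[OF G] c(1)])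
    finally show ?thesis .
  qed
  then show ?thesis unfolding cech_diff_def cochain_def[of "Suc p"] by (intro restrict_ext)
qed

section \<open>Cocycles, coboundaries and their cosets\<close>

abbreviation Z where "Z p \<equiv> cech_cocycles R M var n p"
abbreviation B where "B p \<equiv> cech_coboundaries R M var n p"

lemma cochain_cocycle_iff:
  assumes m: "\<And>F. F \<in> faces n p \<Longrightarrow> m F \<in> carrier R"
  shows "cochain p m a \<in> Z p \<longleftrightarrow> (\<exists>l. \<forall>G\<in>faces n (Suc p). prod var G ^ l * koszul_diff var a m G \<in> I)"
proof -
  have "cochain p m a \<in> Z p \<longleftrightarrow>
    cochain (Suc p) (koszul_diff var a m) a = cochain (Suc p) (\<lambda>_. 0) 0"
    using cochain_closed[of p m a] m cech_group_zero[of "Suc p" 0]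
    by (simp add: cech_cocycles_def kernel_def cech_diff_cochain[OF m])
  also have "\<dots> \<longleftrightarrow> (\<exists>l. \<forall>G\<in>faces n (Suc p). prod var G ^ l * koszul_diff var a m G \<in> I)"
    by (subst cochain_eq_iff) (simp_all add: poly_ring_closed)
  finally show ?thesis .
qed

lemma coboundaries_eq:
  "B p = {cochain p (koszul_diff var b h) b | h b. \<forall>F\<in>faces n (p - 1). h F \<in> carrier R}"
proof (cases p)
  case 0
  \<comment> \<open>For \<open>p = 0\<close> the Koszul differential vanishes on the only face, so
    the truncated index yields just the zero cochain.\<close>
  have "cochain 0 (koszul_diff var b h) b = \<one>\<^bsub>C 0\<^esub>" for b and h :: "nat set \<Rightarrow> 'k mpoly"
    unfolding cech_group_zero[of 0 b] by (rule cochain_cong) (simp add: faces_0)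
  moreover have "\<exists>h :: nat set \<Rightarrow> 'k mpoly. \<forall>F\<in>faces n (p - 1). h F \<in> carrier R"
    by (rule exI[of _ "\<lambda>_. 0"]) (simp add: poly_ring_closed)
  ultimately show ?thesis using 0 by (auto simp: cech_coboundaries_def)
next
  case (Suc q)
  show ?thesis
  proof (intro equalityI subsetI)
    fix f assume "f \<in> B p"
    then obtain g where g: "g \<in> carrier (C q)" "f = cech_diff R M var n q g"
      using Suc by (auto simp: cech_coboundaries_def)
    obtain h b where h: "\<forall>F\<in>faces n q. h F \<in> carrier R" "g = cochain q h b"
      using cech_group_repr[OF g(1)] by blast
    then have "f = cochain p (koszul_diff var b h) b" using g(2) Suc by (simp add: cech_diff_cochain)
    with h(1) Suc show "f \<in> {cochain p (koszul_diff var b h) b | h b. \<forall>F\<in>faces n (p - 1). h F \<in> carrier R}"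
      by auto
  next
    fix f assume "f \<in> {cochain p (koszul_diff var b h) b | h b. \<forall>F\<in>faces n (p - 1). h F \<in> carrier R}"
    then obtain h b where h: "\<And>F. F \<in> faces n q \<Longrightarrow> h F \<in> carrier R" "f = cochain p (koszul_diff var b h) b"
      using Suc by auto
    then have "f = cech_diff R M var n q (cochain q h b)" using Suc by (simp add: cech_diff_cochain)
    moreover have "cochain q h b \<in> carrier (C q)" using h(1) by (rule cochain_closed)
    ultimately show "f \<in> B p" using Suc by (auto simp: cech_coboundaries_def)
  qed
qed

lemma coboundary_koszul_closed:
  assumes "\<forall>F\<in>faces n (p - 1). h F \<in> carrier R" "F \<in> faces n p"
  shows "koszul_diff var b h F \<in> carrier R"
proof (cases p)
  case 0
  then show ?thesis using assms by (simp add: faces_0 poly_ring_closed)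
next
  case (Suc q)
  then show ?thesis using koszul_diff_closed[of F n q h b] assms by simp
qed

text \<open>Both coboundaries are rescaled to exponent \<open>a + b\<close>, where their sources can
  be added or subtracted. The second claim is subtraction, written as solving an equation.\<close>

lemma coboundaries_closed:
  assumes "f \<in> B p" "g \<in> B p"
  shows "f \<otimes>\<^bsub>C p\<^esub> g \<in> B p" "\<exists>h\<in>B p. h \<otimes>\<^bsub>C p\<^esub> g = f"
proof -
  obtain u a v b where u: "\<forall>F\<in>faces n (p - 1). u F \<in> carrier R" "f = cochain p (koszul_diff var a u) a"
    and v: "\<forall>F\<in>faces n (p - 1). v F \<in> carrier R" "g = cochain p (koszul_diff var b v) b"
    using assms unfolding coboundaries_eq by blast
  let ?u = "\<lambda>F. prod var F ^ b * u F" and ?v = "\<lambda>F. prod var F ^ a * v F" and ?c = "a + b"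
  have c: "\<forall>F\<in>faces n (p - 1). ?u F \<in> carrier R" "\<forall>F\<in>faces n (p - 1). ?v F \<in> carrier R"
    using u v by (auto intro!: poly_ring_closed power_closed prod_var_closed face_subset)
  have f: "f = cochain p (koszul_diff var ?c ?u) ?c"
    unfolding u(2) using coboundary_koszul_closed[OF u(1)]
    by (subst cochain_expand[where k = b]) (auto intro!: cochain_cong simp: koszul_diff_rescale faces_finite)
  have "cochain p (koszul_diff var b v) b = cochain p (koszul_diff var (b + a) ?v) (b + a)"
    using coboundary_koszul_closed[OF v(1)]
    by (subst cochain_expand[where k = a]) (auto intro!: cochain_cong simp: koszul_diff_rescale faces_finite)
  then have g: "g = cochain p (koszul_diff var ?c ?v) ?c" unfolding v(2) by (simp add: add.commute)
  have "f \<otimes>\<^bsub>C p\<^esub> g = cochain p (\<lambda>F. koszul_diff var ?c ?u F + koszul_diff var ?c ?v F) ?c"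
    unfolding f g using coboundary_koszul_closed[OF c(1)] coboundary_koszul_closed[OF c(2)]
    by (intro cech_group_mult)
  also have "\<dots> = cochain p (koszul_diff var ?c (\<lambda>F. ?u F + ?v F)) ?c"
    by (rule cochain_cong) (simp add: koszul_diff_def distrib_left sum.distrib)
  finally show "f \<otimes>\<^bsub>C p\<^esub> g \<in> B p"
    unfolding coboundaries_eq using c poly_ring_closed(1) by blast
  let ?h = "\<lambda>F. ?u F - ?v F"
  have hc: "\<forall>F\<in>faces n (p - 1). ?h F \<in> carrier R" using c poly_ring_diff_closed by blast
  have "cochain p (koszul_diff var ?c ?h) ?c \<otimes>\<^bsub>C p\<^esub> g
     = cochain p (\<lambda>F. koszul_diff var ?c ?h F + koszul_diff var ?c ?v F) ?c"
    unfolding g using coboundary_koszul_closed[OF hc] coboundary_koszul_closed[OF c(2)]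
    by (intro cech_group_mult)
  also have "\<dots> = f"
    unfolding f by (rule cochain_cong) (simp only: koszul_diff_minus diff_add_cancel)
  finally have "cochain p (koszul_diff var ?c ?h) ?c \<otimes>\<^bsub>C p\<^esub> g = f" .
  moreover have "cochain p (koszul_diff var ?c ?h) ?c \<in> B p" unfolding coboundaries_eq using hc by blast
  ultimately show "\<exists>h\<in>B p. h \<otimes>\<^bsub>C p\<^esub> g = f" by blast
qed

lemma one_coboundary: "\<one>\<^bsub>C p\<^esub> \<in> B p"
proof -
  have "\<one>\<^bsub>C p\<^esub> = cochain p (koszul_diff var 0 (\<lambda>_. 0)) 0"
    unfolding cech_group_zero[of p 0] by (rule cochain_cong) (simp add: koszul_diff_def)
  then show ?thesis unfolding coboundaries_eq using poly_ring_closed(4) by blast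
qed

text \<open>A coboundary is absorbed because coboundaries are closed under sums and differences.
  Conversely \<open>f\<close> lies in its own coset, the zero cochain being a coboundary.\<close>

lemma coset_coboundaries_iff:
  assumes "f \<in> carrier (C p)"
  shows "B p #>\<^bsub>C p\<^esub> f = B p \<longleftrightarrow> f \<in> B p"
proof
  assume f: "f \<in> B p"
  show "B p #>\<^bsub>C p\<^esub> f = B p"
  proof (intro equalityI subsetI)
    fix g assume "g \<in> B p #>\<^bsub>C p\<^esub> f"
    then obtain h where h: "h \<in> B p" "g = h \<otimes>\<^bsub>C p\<^esub> f" unfolding r_coset_def by blast
    show "g \<in> B p" unfolding h(2) by (rule coboundaries_closed(1)[OF h(1) f])
  next
    fix g assume "g \<in> B p"
    then obtain h where "h \<in> B p" "h \<otimes>\<^bsub>C p\<^esub> f = g" using coboundaries_closed(2)[OF _ f] by blast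
    then show "g \<in> B p #>\<^bsub>C p\<^esub> f" unfolding r_coset_def by blast
  qed
next
  assume eq: "B p #>\<^bsub>C p\<^esub> f = B p"
  have "\<one>\<^bsub>C p\<^esub> \<otimes>\<^bsub>C p\<^esub> f = f"
  proof -
    obtain m a where m: "\<forall>F\<in>faces n p. m F \<in> carrier R" "f = cochain p m a"
      using cech_group_repr[OF assms] by blast
    then show ?thesis
      unfolding cech_group_zero[of p a] using cech_group_mult[of p "\<lambda>_. 0" m a] by (simp add: poly_ring_closed)
  qed
  moreover have "\<one>\<^bsub>C p\<^esub> \<otimes>\<^bsub>C p\<^esub> f \<in> B p #>\<^bsub>C p\<^esub> f"
    using one_coboundary unfolding r_coset_def by blast
  ultimately show "f \<in> B p" using eq by simp
qed

section \<open>Graded parts and the comparison with Koszul cohomology\<close>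

lemma loc_part_eq:
  "cech_loc_part R M (quot_part n I) var F r = {cfrac F f a | f a. f \<in> hom_part n (r + int a * int (card F))}"
  unfolding cech_loc_part_def quot_part_def cfrac_def coset_def by blast

lemma local_cohomology_part_nonzero_iff:
  "local_cohomology_part R M (quot_part n I) var n p r \<noteq> {\<one>\<^bsub>local_cohomology R M var n p\<^esub>} \<longleftrightarrow>
    (\<exists>m a. (\<forall>F\<in>faces n p. m F \<in> hom_part n (r + int a * int p)) \<and> cochain p m a \<in> Z p \<and> cochain p m a \<notin> B p)"
    (is "?P \<noteq> _ \<longleftrightarrow> ?E")
proof -
  let ?Q = "\<lambda>f. f \<in> Z p \<and> (\<forall>F\<in>faces n p. f F \<in> cech_loc_part R M (quot_part n I) var F r)"
  have ZC: "f \<in> carrier (C p)" if "f \<in> Z p" for f using that by (simp add: cech_cocycles_def kernel_def)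
  have Q: "?Q f \<longleftrightarrow> f \<in> Z p \<and> (\<exists>m a. (\<forall>F\<in>faces n p. m F \<in> hom_part n (r + int a * int p)) \<and> f = cochain p m a)" for f
  proof (intro conj_cong refl iffI)
    assume f: "f \<in> Z p" "\<forall>F\<in>faces n p. f F \<in> cech_loc_part R M (quot_part n I) var F r"
    show "\<exists>m a. (\<forall>F\<in>faces n p. m F \<in> hom_part n (r + int a * int p)) \<and> f = cochain p m a"
    proof (rule cochain_repr[where Q = "\<lambda>F a. hom_part n (r + int a * int p)"])
      show "f \<in> extensional (faces n p)" using ZC[OF f(1)] by (auto simp: cech_group_def PiE_def)
      show "\<exists>m a. m \<in> hom_part n (r + int a * int p) \<and> f F = cfrac F m a" if F: "F \<in> faces n p" for F
      proof -
        have "card F = p" using F by (simp add: faces_def)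
        moreover from f(2) F have "f F \<in> cech_loc_part R M (quot_part n I) var F r" by (rule bspec)
        ultimately have "f F \<in> {cfrac F f a | f a. f \<in> hom_part n (r + int a * int p)}"
          by (simp only: loc_part_eq)
        then show ?thesis by blast
      qed
      show "m \<in> carrier R \<and> prod var F ^ k * m \<in> hom_part n (r + int (a + k) * int p)"
        if "F \<in> faces n p" "m \<in> hom_part n (r + int a * int p)" for F a k m
        using gr_prod_face[OF that, of k] that(2) by (simp add: algebra_simps hom_part_iff)
    qed
  next
    assume "\<exists>m a. (\<forall>F\<in>faces n p. m F \<in> hom_part n (r + int a * int p)) \<and> f = cochain p m a"
    then obtain m a where m: "\<forall>F\<in>faces n p. m F \<in> hom_part n (r + int a * int p)" "f = cochain p m a" by blast
    show "\<forall>F\<in>faces n p. f F \<in> cech_loc_part R M (quot_part n I) var F r"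
    proof
      fix F assume F: "F \<in> faces n p"
      then have "f F = cfrac F (m F) a" "card F = p" by (simp_all add: m(2) cochain_def) (simp add: faces_def)
      moreover have "m F \<in> hom_part n (r + int a * int p)" using m(1) F by (rule bspec)
      ultimately show "f F \<in> cech_loc_part R M (quot_part n I) var F r" unfolding loc_part_eq
        by (intro CollectI exI[of _ "m F"] exI[of _ a] conjI) simp_all
    qed
  qed
  have one: "\<one>\<^bsub>local_cohomology R M var n p\<^esub> = B p"
    by (simp add: local_cohomology_def FactGroup_def)
  have part: "?P = {B p #>\<^bsub>C p\<^esub> f | f. ?Q f}"
    unfolding local_cohomology_part_def by simp
  \<comment> \<open>The zero class always belongs to the graded part, so the part differs from
    \<open>{B p}\<close> exactly if it contains another coset.\<close>
  have "?Q (cochain p (\<lambda>_. 0) 0)"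
    unfolding Q
  proof (intro conjI exI)
    show "cochain p (\<lambda>_. 0) 0 \<in> Z p"
      by (subst cochain_cocycle_iff) (simp_all add: poly_ring_closed koszul_diff_def I_zero)
    show "\<forall>F\<in>faces n p. 0 \<in> hom_part n (r + int 0 * int p)" by simp
  qed (rule refl)
  moreover have "B p #>\<^bsub>C p\<^esub> cochain p (\<lambda>_. 0) 0 = B p"
    unfolding coset_coboundaries_iff[OF cochain_closed[of p "\<lambda>_. 0", OF poly_ring_closed(4)]]
    using one_coboundary[of p] by (simp only: cech_group_zero[of p 0])
  ultimately have "B p \<in> ?P" unfolding part by blast
  then have "?P \<noteq> {B p} \<longleftrightarrow> (\<exists>X\<in>?P. X \<noteq> B p)" by blast
  also have "\<dots> \<longleftrightarrow> (\<exists>f. ?Q f \<and> B p #>\<^bsub>C p\<^esub> f \<noteq> B p)"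
    unfolding part by (simp only: bex_simps mem_Collect_eq Bex_def) metis
  also have "\<dots> \<longleftrightarrow> (\<exists>f. ?Q f \<and> f \<notin> B p)"
    by (intro ex_cong1 conj_cong refl arg_cong[where f = Not] coset_coboundaries_iff ZC) simp
  also have "\<dots> \<longleftrightarrow> ?E" unfolding Q by metis
  finally show ?thesis unfolding one .
qed

text \<open>A source of a Cech coboundary need not be homogeneous; projecting it makes it so.
  Degrees are integers since sources may be required in negative degrees, where the projection is
  0.\<close>

abbreviation hom_proj :: "int \<Rightarrow> 'k mpoly \<Rightarrow> 'k mpoly"
  where "hom_proj e \<equiv> filter_keys (\<lambda>m. int (mon_deg m) = e)"

lemma hom_proj_ideal: "f \<in> I \<Longrightarrow> hom_proj e f \<in> I"
proof (cases "e < 0")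
  case True
  then have "hom_proj e f = 0" by (intro poly_mapping_eqI) auto
  then show ?thesis using I_zero by simp
next
  case False
  assume "f \<in> I"
  moreover obtain q where "e = int q" using False by (metis nonneg_eq_int not_less)
  ultimately show ?thesis using hom_component_ideal(1)[OF I, of f q] by (simp add: hom_component_eq)
qed

lemma hom_proj_id: "f \<in> hom_part n e \<Longrightarrow> hom_proj e f = f"
  by (rule filter_keys_id) (simp add: hom_part_iff)

lemma hom_proj_hom_part: "f \<in> carrier R \<Longrightarrow> hom_proj e f \<in> hom_part n e"
  by (auto simp: hom_part_iff carrier_poly_ring)

lemma hom_proj_koszul_diff:
  "hom_proj e (koszul_diff var a h G) = koszul_diff var a (\<lambda>F. hom_proj (e - int a) (h F)) G"
proof -
  have "hom_proj e (koszul_sign G j * var j ^ a * f) = koszul_sign G j * var j ^ a * hom_proj (e - int a) f" for j f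
  proof -
    have "hom_proj e (monomial (Poly_Mapping.single j a) * f) = monomial (Poly_Mapping.single j a) * hom_proj (e - int a) f"
      unfolding filter_keys_monomial_mult mon_deg_add
      by (rule arg_cong[where f = "\<lambda>P. monomial _ * filter_keys P f"]) auto
    then show ?thesis by (simp add: koszul_sign_def var_power filter_keys_uminus)
  qed
  then show ?thesis unfolding koszul_diff_def by (simp add: filter_keys_sum)
qed

text \<open>Cech cocycles and coboundaries satisfy their equations only in the limit. Passing to a
  large exponent turns these into congruences modulo \<open>I\<close>, and projection to the right
  degree makes the sources homogeneous.\<close>

lemma local_cohomology_iff:
  "local_cohomology_part R M (quot_part n I) var n p r \<noteq> {\<one>\<^bsub>local_cohomology R M var n p\<^esub>} \<longleftrightarrow>
    nonzero_cohomology I p r"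
  unfolding local_cohomology_part_nonzero_iff
proof
  assume "\<exists>m a. (\<forall>F\<in>faces n p. m F \<in> hom_part n (r + int a * int p)) \<and> cochain p m a \<in> Z p \<and> cochain p m a \<notin> B p"
  then obtain m a where m: "\<And>F. F \<in> faces n p \<Longrightarrow> m F \<in> hom_part n (r + int a * int p)"
    and Z: "cochain p m a \<in> Z p" and nB: "cochain p m a \<notin> B p" by blast
  have mc: "\<And>F. F \<in> faces n p \<Longrightarrow> m F \<in> carrier R" using m by (simp add: hom_part_iff)
  obtain l where l: "\<And>G. G \<in> faces n (Suc p) \<Longrightarrow> prod var G ^ l * koszul_diff var a m G \<in> I"
    using Z cochain_cocycle_iff[of p m a, OF mc] by blast
  \<comment> \<open>The differential of \<open>m\<close> lies in \<open>I\<close> only after a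
    factor \<open>x_G^l\<close>; the expanded numerators represent the same Cech cochain and form a
    Koszul cocycle.\<close>
  let ?m = "\<lambda>F. prod var F ^ l * m F"
  have cm: "cochain p m a = cochain p ?m (a + l)" by (rule cochain_expand[OF mc])
  have "koszul_cocycle I p r (a + l) ?m"
    unfolding koszul_cocycle_def
  proof (intro conjI ballI)
    fix F assume F: "F \<in> faces n p"
    show "?m F \<in> hom_part n (r + int (a + l) * int p)"
      using gr_prod_face[OF F m[OF F], of l] by (simp add: algebra_simps)
  next
    fix G assume G: "G \<in> faces n (Suc p)"
    show "koszul_diff var (a + l) ?m G \<in> I" using l[OF G] by (simp add: koszul_diff_rescale faces_finite[OF G])
  qed
  moreover have "\<not> koszul_trivial I p r (a + l) ?m"
  proof
    assume "koszul_trivial I p r (a + l) ?m"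
    then obtain l' h where h: "\<And>F. F \<in> faces n (p - 1) \<Longrightarrow> h F \<in> hom_part n (r + int (a + l + l') * (int p - 1))"
      and hb: "\<And>F. F \<in> faces n p \<Longrightarrow> prod var F ^ l' * ?m F - koszul_diff var (a + l + l') h F \<in> I"
      unfolding koszul_trivial_def by blast
    have hc: "\<forall>F\<in>faces n (p - 1). h F \<in> carrier R" using h by (simp add: hom_part_iff)
    have "cochain p ?m (a + l) = cochain p (\<lambda>F. prod var F ^ l' * ?m F) (a + l + l')"
      by (rule cochain_expand) (intro poly_ring_closed power_closed prod_var_closed face_subset mc)
    also have "\<dots> = cochain p (koszul_diff var (a + l + l') h) (a + l + l')"
      using coboundary_koszul_closed[OF hc] prod_var_mult[OF face_subset hb]
      by (subst cochain_eq_iff) (auto simp: right_diff_distrib intro!: exI[of _ 0])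
    also have "\<dots> \<in> B p" unfolding coboundaries_eq using hc by blast
    finally show False using nB cm by simp
  qed
  ultimately show "nonzero_cohomology I p r" unfolding nonzero_cohomology_def by blast
next
  assume "nonzero_cohomology I p r"
  then obtain a m where Z: "koszul_cocycle I p r a m" and nB: "\<not> koszul_trivial I p r a m"
    unfolding nonzero_cohomology_def by blast
  have m: "\<And>F. F \<in> faces n p \<Longrightarrow> m F \<in> hom_part n (r + int a * int p)"
    using Z by (simp add: koszul_cocycle_def)
  have mc: "\<And>F. F \<in> faces n p \<Longrightarrow> m F \<in> carrier R" using m by (simp add: hom_part_iff)
  have "cochain p m a \<in> Z p"
  proof (subst cochain_cocycle_iff)
    have "\<forall>G\<in>faces n (Suc p). prod var G ^ 0 * koszul_diff var a m G \<in> I"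
      using Z by (simp add: koszul_cocycle_def)
    then show "\<exists>l. \<forall>G\<in>faces n (Suc p). prod var G ^ l * koszul_diff var a m G \<in> I" by blast
  qed (rule mc)
  moreover have "cochain p m a \<notin> B p"
  proof
    assume "cochain p m a \<in> B p"
    then obtain h b where hc: "\<forall>F\<in>faces n (p - 1). h F \<in> carrier R"
      and "cochain p m a = cochain p (koszul_diff var b h) b"
      unfolding coboundaries_eq by blast
    then obtain l where l: "\<And>F. F \<in> faces n p \<Longrightarrow> prod var F ^ (l + b) * m F - prod var F ^ (l + a) * koszul_diff var b h F \<in> I"
      using cochain_eq_iff[of p "koszul_diff var b h" m a b] coboundary_koszul_closed[OF hc] by blast
    let ?e = "r + int (a + (l + b)) * int p"
    \<comment> \<open>The source is first brought to the exponent \<open>a + (l + b)\<close> of the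
      congruence, then replaced by its component in the degree that \<open>koszul_trivial\<close>
      demands.\<close>
    let ?h = "\<lambda>F. hom_proj (r + int (a + (l + b)) * (int p - 1)) (prod var F ^ (l + a) * h F)"
    have "koszul_trivial I p r a m"
    proof (rule koszul_trivialI[where l = "l + b" and h = ?h])
      fix F assume F: "F \<in> faces n (p - 1)"
      show "?h F \<in> hom_part n (r + int (a + (l + b)) * (int p - 1))"
        by (intro hom_proj_hom_part poly_ring_closed power_closed prod_var_closed face_subset[OF F]) (use hc F in blast)
    next
      fix F assume F: "F \<in> faces n p"
      have deg: "?e - int (a + (l + b)) = r + int (a + (l + b)) * (int p - 1)" by (simp add: algebra_simps)
      have 1: "prod var F ^ (l + b) * m F \<in> hom_part n ?e"
        using gr_prod_face[OF F m[OF F], of "l + b"] by (simp add: algebra_simps)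
      have 2: "prod var F ^ (l + a) * koszul_diff var b h F
          = koszul_diff var (a + (l + b)) (\<lambda>F. prod var F ^ (l + a) * h F) F"
        using koszul_diff_rescale[OF faces_finite[OF F], of var b "l + a" h] by (simp add: ac_simps)
      show "prod var F ^ (l + b) * m F - koszul_diff var (a + (l + b)) ?h F \<in> I"
        using hom_proj_ideal[OF l[OF F], of ?e]
        unfolding 2 filter_keys_diff hom_proj_id[OF 1] hom_proj_koszul_diff deg .
    qed
    with nB show False by simp
  qed
  ultimately show "\<exists>m a. (\<forall>F\<in>faces n p. m F \<in> hom_part n (r + int a * int p)) \<and> cochain p m a \<in> Z p \<and> cochain p m a \<notin> B p"
    using m by blast
qed

end

section \<open>Partial regularity\<close>

lemma restr_restr: "v \<le> w \<Longrightarrow> restr v (restr w f) = restr v f"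
  using mons_mono[of v w] by (intro poly_mapping_eqI) auto

text \<open>On forms, killing one more variable amounts to adding \<open>x_w\<close> to the ideal.
  This supplies the axiom on \<open>I'\<close> in \<open>hyperplane_section\<close>.\<close>

lemma section_ideal_step:
  fixes I :: "'k::field mpoly set"
  assumes I: "homogeneous_ideal n I" and w: "w \<in> {1..n}" and f: "f \<in> hom_part n e"
  shows "f \<in> section_ideal n I (w - 1) \<longleftrightarrow>
    (\<exists>g\<in>hom_part n (e - 1). f - var w * g \<in> section_ideal n I w)"
proof
  assume "f \<in> section_ideal n I (w - 1)"
  then obtain h where h: "h \<in> I" "h \<in> hom_part n e" "restr (w - 1) f = restr (w - 1) h"
    using section_idealD[OF I _ f] by auto
  \<comment> \<open>By the choice of \<open>h\<close>, the difference \<open>f - h\<close> vanishes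
    for \<open>x_w = ... = x_n = 0\<close>, so every monomial left in \<open>q\<close> contains
    \<open>x_w\<close>.\<close>
  define q where "q = restr w (f - h)"
  have fh: "f - h \<in> hom_part n e" by (rule hom_part_diff[OF f h(2)])
  have q0: "restr (w - 1) q = 0"
    using h(3) by (simp add: q_def restr_restr filter_keys_diff)
  have "1 \<le> Poly_Mapping.lookup v w" if v: "v \<in> Poly_Mapping.keys q" for v
  proof -
    have "v \<in> mons w" using v by (simp add: q_def)
    moreover have "v \<notin> mons (w - 1)"
    proof
      assume "v \<in> mons (w - 1)"
      then have "v \<in> Poly_Mapping.keys (restr (w - 1) q)" using v by simp
      then show False unfolding q0 by simp
    qed
    ultimately obtain j where "j \<in> Poly_Mapping.keys v" "1 \<le> j" "j \<le> w" "\<not> j \<le> w - 1"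
      unfolding mons_def by fastforce
    then have "w \<in> Poly_Mapping.keys v" by (metis One_nat_def Suc_pred' le_SucE le_less_trans less_le_trans not_le zero_less_one)
    then show ?thesis by (simp add: in_keys_iff)
  qed
  then obtain g where g: "q = var w * g" unfolding var_def using monomial_factor by blast
  have kq: "Poly_Mapping.keys q = (+) (Poly_Mapping.single w 1) ` Poly_Mapping.keys g"
    by (simp add: g var_def keys_monomial_mult)
  have "q \<in> hom_part n e" unfolding q_def by (rule hom_part_filter_keys[OF fh])
  then have "g \<in> hom_part n (e - 1)"
    by (auto simp: hom_part_iff kq carrier_poly_ring mons_add_iff mon_deg_add)
  moreover have "f - var w * g \<in> section_ideal n I w"
  proof -
    have "restr w (f - q) = restr w h" by (simp add: q_def filter_keys_diff restr_restr)
    moreover have "f - q \<in> carrier (poly_ring n)"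
      using f fh by (intro poly_ring_diff_closed) (auto simp: q_def hom_part_iff intro: filter_keys_closed)
    ultimately show ?thesis using h(1) by (auto simp: section_ideal_def g)
  qed
  ultimately show "\<exists>g\<in>hom_part n (e - 1). f - var w * g \<in> section_ideal n I w" by blast
next
  assume "\<exists>g\<in>hom_part n (e - 1). f - var w * g \<in> section_ideal n I w"
  then obtain g h where h: "h \<in> I" "restr w (f - var w * g) = restr w h"
    by (auto simp: section_ideal_def)
  have "Poly_Mapping.keys (restr (w - 1) (var w * g)) = {}"
    using w by (auto simp: var_def keys_monomial_mult mons_add_iff) (auto simp: mons_def)
  then have z: "restr (w - 1) (var w * g) = 0" unfolding keys_eq_empty .
  have "restr (w - 1) f = restr (w - 1) (f - var w * g)" using z by (simp add: filter_keys_diff)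
  also have "\<dots> = restr (w - 1) (restr w (f - var w * g))" by (simp add: restr_restr)
  also have "\<dots> = restr (w - 1) h" by (simp add: h(2) restr_restr)
  finally show "f \<in> section_ideal n I (w - 1)"
    using h(1) f by (auto simp: section_ideal_def hom_part_iff)
qed

lemma section_ideal_top:
  assumes "ideal I (poly_ring n)"
  shows "section_ideal n I n = I"
proof -
  have "restr n f = f" if "f \<in> carrier (poly_ring n)" for f :: "'a mpoly"
    using that by (intro filter_keys_id) (auto simp: carrier_poly_ring)
  then show ?thesis using ideal_carrier[OF assms] by (force simp: section_ideal_def)
qed

context cech_quotient
begin

text \<open>The degrees whose supremum is \<open>c_i\<close>; once bounded above, they are also the
  degrees of the zeroth cohomology of the section.\<close>

definition colon_degree :: "nat \<Rightarrow> int \<Rightarrow> bool"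
  where "colon_degree i r \<longleftrightarrow> (\<exists>f\<in>hom_part n r. f \<notin> section_ideal n I (n - i) \<and>
    (\<exists>k. var (n - i) ^ k * f \<in> section_ideal n I (n - i)))"

lemma hyperplane_section_section_ideal:
  assumes i: "i < n" and c: "\<And>r. colon_degree i r \<Longrightarrow> r \<le> c"
  shows "hyperplane_section var n (hom_part n) (section_ideal n I (n - i)) (section_ideal n I (n - Suc i)) (n - i) c"
proof unfold_locales
  fix f g :: "'k mpoly" and j
  note sid = section_ideal_ideal[OF Iideal, where w = "n - i"]
  show "0 \<in> section_ideal n I (n - i)" by (rule sid)
  show "f \<in> section_ideal n I (n - i) \<Longrightarrow> g \<in> section_ideal n I (n - i) \<Longrightarrow> f + g \<in> section_ideal n I (n - i)"
    by (rule sid)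
  show "f \<in> section_ideal n I (n - i) \<Longrightarrow> - f \<in> section_ideal n I (n - i)" by (rule sid)
  show "j \<in> {1..n} \<Longrightarrow> f \<in> section_ideal n I (n - i) \<Longrightarrow> var j * f \<in> section_ideal n I (n - i)"
    unfolding var_def by (intro sid mons_single)
  show w: "n - i \<in> {1..n}" using i by auto
  fix e
  show "f \<in> section_ideal n I (n - Suc i) \<longleftrightarrow> (\<exists>g\<in>hom_part n (e - 1). f - var (n - i) * g \<in> section_ideal n I (n - i))"
    if "f \<in> hom_part n e"
    using section_ideal_step[OF I w that] by simp
  fix k
  show "f \<in> section_ideal n I (n - i)"
    if "f \<in> hom_part n e" "c < e" "var (n - i) ^ k * f \<in> section_ideal n I (n - i)"
    using that c[of e] unfolding colon_degree_def by force
qed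

text \<open>Both bounds are phrased by individual degrees, so infinite values never enter the
  induction. The section index \<open>i\<close> is left arbitrary: each step trades one
  cohomological degree for one further cut and keeps \<open>i + s\<close> fixed.\<close>

lemma cohomology_colon_degrees:
  assumes "i + s < n" and "\<And>j r. j \<le> i + s \<Longrightarrow> colon_degree j r \<Longrightarrow> r \<le> c j"
  shows "(\<forall>q\<le>s. \<forall>r. nonzero_cohomology (section_ideal n I (n - i)) q r \<longrightarrow>
      (\<exists>q'\<le>s. \<exists>r'. colon_degree (i + q') r' \<and> r + int q \<le> r')) \<and>
    (\<forall>q'\<le>s. \<forall>r'. colon_degree (i + q') r' \<longrightarrow>
      (\<exists>q\<le>s. \<exists>r. nonzero_cohomology (section_ideal n I (n - i)) q r \<and> r' \<le> r + int q))"
  using assms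
proof (induction s arbitrary: i)
  case 0
  interpret H: hyperplane_section var n "hom_part n" "section_ideal n I (n - i)" "section_ideal n I (n - Suc i)" "n - i" "c i"
    using 0 by (intro hyperplane_section_section_ideal) simp_all
  have "nonzero_cohomology (section_ideal n I (n - i)) 0 r \<longleftrightarrow> colon_degree i r" for r
    using H.nonzero_cohomology_0_iff unfolding colon_degree_def by blast
  then show ?case by auto
next
  case (Suc s)
  interpret H: hyperplane_section var n "hom_part n" "section_ideal n I (n - i)" "section_ideal n I (n - Suc i)" "n - i" "c i"
    using Suc.prems by (intro hyperplane_section_section_ideal) simp_all
  have zero: "nonzero_cohomology (section_ideal n I (n - i)) 0 r \<longleftrightarrow> colon_degree i r" for r
    using H.nonzero_cohomology_0_iff unfolding colon_degree_def by blast
  have IH1: "\<exists>q'\<le>s. \<exists>r'. colon_degree (Suc i + q') r' \<and> r + int q \<le> r'"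
    if "q \<le> s" "nonzero_cohomology (section_ideal n I (n - Suc i)) q r" for q r
    using Suc.IH[of "Suc i"] Suc.prems that by simp
  have IH2: "\<exists>q\<le>s. \<exists>r. nonzero_cohomology (section_ideal n I (n - Suc i)) q r \<and> r' \<le> r + int q"
    if "q' \<le> s" "colon_degree (Suc i + q') r'" for q' r'
    using Suc.IH[of "Suc i"] Suc.prems that by simp
  show ?case
  proof (intro conjI allI impI)
    fix q r assume q: "q \<le> Suc s" and nz: "nonzero_cohomology (section_ideal n I (n - i)) q r"
    show "\<exists>q'\<le>Suc s. \<exists>r'. colon_degree (i + q') r' \<and> r + int q \<le> r'"
    proof (cases q)
      case 0
      with nz zero[of r] have "colon_degree (i + 0) r" "r + int q \<le> r" by simp_all
      then show ?thesis using le0 by blast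
    next
      case (Suc p)
      with nz obtain k where k: "nonzero_cohomology (section_ideal n I (n - Suc i)) p (r + int k + 1)"
        using H.nonzero_cohomology_SucD by blast
      from Suc q have "p \<le> s" by simp
      \<comment> \<open>The gain of at least one in degree makes up for the loss of one in the
        cohomological index.\<close>
      from IH1[OF this k] obtain q' r' where "q' \<le> s" "colon_degree (Suc i + q') r'" "r + int k + 1 + int p \<le> r'"
        by blast
      then have "Suc q' \<le> Suc s" "colon_degree (i + Suc q') r'" "r + int q \<le> r'" using Suc by simp_all
      then show ?thesis by blast
    qed
  next
    fix q' r' assume q': "q' \<le> Suc s" and cd: "colon_degree (i + q') r'"
    show "\<exists>q\<le>Suc s. \<exists>r. nonzero_cohomology (section_ideal n I (n - i)) q r \<and> r' \<le> r + int q"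
    proof (cases q')
      case 0
      with cd zero[of r'] have "nonzero_cohomology (section_ideal n I (n - i)) 0 r'" "r' \<le> r' + int 0" by simp_all
      then show ?thesis using le0 by blast
    next
      case (Suc p')
      with cd q' have "p' \<le> s" "colon_degree (Suc i + p') r'" by simp_all
      from IH2[OF this] obtain p r
        where p: "p \<le> s" "nonzero_cohomology (section_ideal n I (n - Suc i)) p r" "r' \<le> r + int p" by blast
      \<comment> \<open>Either index and degree are unchanged, or the index rises by one and the
        degree falls by one; their sum is the same in both cases.\<close>
      from H.nonzero_cohomology_sectionD[OF p(2)] show ?thesis
      proof
        assume "nonzero_cohomology (section_ideal n I (n - i)) p r"
        with p show ?thesis using le_SucI by blast
      next
        assume "nonzero_cohomology (section_ideal n I (n - i)) (Suc p) (r - 1)"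
        moreover have "Suc p \<le> Suc s" "r' \<le> r - 1 + int (Suc p)" using p by simp_all
        ultimately show ?thesis by blast
      qed
    qed
  qed
qed

section \<open>From individual degrees to suprema\<close>

lemma a_inv_eq: "a_inv n I i = Sup {ereal (real_of_int r) | r. nonzero_cohomology I i r}"
  by (simp add: Defs.a_inv_def Let_def local_cohomology_iff)

lemma c_inv_eq: "i < n \<Longrightarrow> c_inv n I i = Sup {ereal (real_of_int r) | r. colon_degree i r}"
  by (simp add: c_inv_def c_inv_degree_iff[OF I] colon_degree_def)

lemma colon_degree_bounded:
  assumes "i < n" "c_inv n I i < \<infinity>"
  shows "\<exists>c. \<forall>r. colon_degree i r \<longrightarrow> r \<le> c"
proof -
  \<comment> \<open>A natural number above the supremum also covers the value minus
    infinity.\<close>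
  obtain N :: nat where N: "c_inv n I i < ereal (real N)" using less_PInf_Ex_of_nat[of "c_inv n I i"] assms(2) by auto
  have "r \<le> int N" if "colon_degree i r" for r
  proof -
    have "ereal (real_of_int r) \<le> c_inv n I i"
      unfolding c_inv_eq[OF assms(1)] using that by (intro Sup_upper) auto
    then have "ereal (real_of_int r) < ereal (real N)" using N by (rule le_less_trans)
    then show ?thesis by simp
  qed
  then show ?thesis by blast
qed

end

theorem theorem3p4:
  fixes n t :: nat and I :: "'k::field mpoly set"
  assumes "n \<ge> 1"
    and "homogeneous_ideal n I"
    and "I \<noteq> carrier (poly_ring n)"
    and "enat t \<le> min (krull_dim (poly_ring n Quot I)) (enat (n - 1))"
    and "\<And>i. i \<le> t \<Longrightarrow> c_inv n I i < \<infinity>"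
  shows "partial_reg n I t = Max (c_inv n I ` {0..t})"
proof -
  interpret cech_quotient n I by unfold_locales fact
  have t: "t < n" using assms(1,4) by auto
  have "\<forall>i. \<exists>c. i \<le> t \<longrightarrow> (\<forall>r. colon_degree i r \<longrightarrow> r \<le> c)"
    using colon_degree_bounded assms(5) t by (meson le_less_trans)
  then obtain c where "\<And>i r. i \<le> t \<Longrightarrow> colon_degree i r \<Longrightarrow> r \<le> c i" by metis
  \<comment> \<open>For \<open>i = 0\<close> no variable has been killed yet, and the section ideal
    is \<open>I\<close> itself.\<close>
  from cohomology_colon_degrees[of 0 t c] this t
  have coh: "\<And>q r. q \<le> t \<Longrightarrow> nonzero_cohomology I q r \<Longrightarrow> \<exists>q'\<le>t. \<exists>r'. colon_degree q' r' \<and> r + int q \<le> r'"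
    and col: "\<And>q' r'. q' \<le> t \<Longrightarrow> colon_degree q' r' \<Longrightarrow> \<exists>q\<le>t. \<exists>r. nonzero_cohomology I q r \<and> r' \<le> r + int q"
    by (simp_all add: section_ideal_top[OF Iideal])
  show ?thesis
  proof (rule antisym)
    show "partial_reg n I t \<le> Max (c_inv n I ` {0..t})"
      unfolding partial_reg_def
    proof (rule Max.boundedI, simp, simp, clarify)
      fix q assume "q \<in> {0..t}"
      then have q: "q \<le> t" by simp
      \<comment> \<open>Moving the finite number \<open>q\<close> to the other side leaves a plain
        supremum, which is bounded term by term.\<close>
      have "a_inv n I q \<le> Max (c_inv n I ` {0..t}) - ereal (real q)"
        unfolding a_inv_eq
      proof (rule Sup_least, clarify)
        fix r assume "nonzero_cohomology I q r"
        from coh[OF q this] obtain q' r' where *: "q' \<le> t" "colon_degree q' r'" "r + int q \<le> r'" by blast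
        then have "real_of_int r + real q \<le> real_of_int r'" by linarith
        then have "ereal (real_of_int r) + ereal (real q) \<le> ereal (real_of_int r')" by simp
        also have "\<dots> \<le> c_inv n I q'"
          using * t unfolding c_inv_eq[OF le_less_trans[OF *(1) t]] by (intro Sup_upper) auto
        also have "\<dots> \<le> Max (c_inv n I ` {0..t})" using * by (intro Max_ge) auto
        finally show "ereal (real_of_int r) \<le> Max (c_inv n I ` {0..t}) - ereal (real q)"
          by (simp add: ereal_le_minus)
      qed
      then show "a_inv n I q + ereal (real q) \<le> Max (c_inv n I ` {0..t})"
        by (simp add: ereal_le_minus)
    qed
    show "Max (c_inv n I ` {0..t}) \<le> partial_reg n I t"
    proof (rule Max.boundedI, simp, simp, clarify)
      fix q' assume "q' \<in> {0..t}"
      then have q': "q' \<le> t" by simp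
      show "c_inv n I q' \<le> partial_reg n I t"
        unfolding c_inv_eq[OF le_less_trans[OF q' t]]
      proof (rule Sup_least, clarify)
        fix r' assume "colon_degree q' r'"
        from col[OF q' this] obtain q r where *: "q \<le> t" "nonzero_cohomology I q r" "r' \<le> r + int q" by blast
        then have "real_of_int r' \<le> real_of_int r + real q" by linarith
        then have "ereal (real_of_int r') \<le> ereal (real_of_int r) + ereal (real q)" by simp
        also have "\<dots> \<le> a_inv n I q + ereal (real q)"
          using * unfolding a_inv_eq by (intro add_right_mono Sup_upper) auto
        also have "\<dots> \<le> partial_reg n I t"
          unfolding partial_reg_def using * by (intro Max_ge) auto
        finally show "ereal (real_of_int r') \<le> partial_reg n I t" .
      qed
    qed
  qed
qed

end
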